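(* As $x\to\infty$, \[\sum_{n\le x}r_2(n)=\pi\,\frac{x}{\log^2 x}\left(1+O\Bigl(\frac{1}{\log x}\Bigr)\right).\]
   Context: The sum is over positive integers $n\le x$, and $r_2(n):=\#\{(p,q):\ p^2+q^2=n,\ p,q\text{ prime}\}$, counting ordered pairs. $\log^2 x$ means $(\log x)^2$. The notation $f(x)=O(g(x))$ means there are constants $c>0$ and $x_0$ with $|f(x)|\le c|g(x)|$ for all $x>x_0$. *)

theory Defs
  imports Complex_Main "HOL-Library.Landau_Symbols" "HOL-Computational_Algebra.Primes"
begin

definition r2 :: "nat \<Rightarrow> nat" where
  "r2 n = card {(p, q). prime (p::nat) \<and> prime (q::nat) \<and> p\<^sup>2 + q\<^sup>2 = n}"

end

theory Submission
  imports Defs "HOL-Complex_Analysis.Complex_Analysis" "HOL-Real_Asymp.Real_Asymp" "HOL-Number_Theory.Prime_Powers"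
begin

text \<open>With \<open>R = sqrt x\<close>, the sum counts the pairs of primes in a quarter disc of radius \<open>R\<close> and area
  \<open>\<pi> x / 4\<close>, so what is needed is the prime number theorem with relative error \<open>O(1 / log x)\<close>.
  Euler--Maclaurin continues \<open>\<zeta>\<close> slightly to the left of the line \<open>Re s = 1\<close>, with growth
  \<open>O(\<bar>t\<bar> powr \<epsilon>)\<close> for any fixed \<open>\<epsilon>\<close>; Cauchy's estimates and the 3-4-1 inequality then give bounds of the
  same quality for the derivatives of \<open>\<zeta>\<close> and for \<open>1 / \<zeta>\<close> on \<open>1 \<le> Re s \<le> 2\<close>. Hence the second derivative of
  \<open>-\<zeta>'/\<zeta> - \<zeta>\<close>, whose coefficients are \<open>ln\<^sup>2 n (\<Lambda>(n) - 1)\<close>, is \<open>O(\<bar>t\<bar> powr (1/2))\<close> uniformly for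
  \<open>1 < Re s \<le> 2\<close>. Perron's formula with kernel \<open>1 / s\<^sup>2\<close> on the line \<open>Re s = 1 + 1 / ln x\<close>, with no shift of
  the contour, bounds the logarithmic averages of these coefficients by \<open>O(x)\<close>. Monotonicity turns this
  into an \<open>O(x ln x)\<close> error for the sum of \<open>\<Lambda>(n) ln\<^sup>2 n\<close>, a relative error of \<open>1 / ln x\<close>. Finally the pairs
  are counted with weight \<open>ln\<^sup>3 p ln\<^sup>3 q\<close>, which is nearly constant.\<close>

section \<open>The Perron kernel\<close>

text \<open>Two derivatives are the fewest that work. On the chosen line \<open>x powr s\<close> has
  modulus \<open>exp 1 * x\<close>, so the averaged sum is O(x) for any number k of derivatives
  (given small enough growth), while k logarithms raise the main term to
  \<open>x * ln x ^ k\<close>. Undoing the average over a window from \<open>x\<close> to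
  \<open>x * exp d\<close> multiplies the error by \<open>1 / d\<close> and adds
  \<open>d * x * ln x ^ k\<close>. The best \<open>d\<close> is the power -k/2 of
  \<open>ln x\<close>, which is also the relative error; so k = 2 and \<open>d = 1 / ln x\<close>.

  The exponents are multiples of \<epsilon> = 1/48. Multiplied by s - 1, zeta has growth exponent
  49/48; the 3-4-1 inequality yields the lower exponent 41/48; so each quotient of a derivative of
  \<open>zetaF\<close> by \<open>zetaF\<close> costs 8\<epsilon> = 1/6. The second derivative of a
  logarithmic derivative is cubic in such quotients, hence the 1/2, which the kernel turns into the
  integrable exponent -3/2. Any total below 1 would serve.

  The averaged bound is needed a second time, in undifferenced form: it controls the sum of
  \<open>ln (R / p)\<close> over primes, hence the cost of replacing \<open>ln p\<close> by
  \<open>ln R\<close> in the weights.\<close>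

lemma integrable_one_plus_abs_powr:
  "integrable lborel (\<lambda>t::real. (1 + \<bar>t\<bar>) powr (-3/2))"
proof -
  have half: "integrable lborel (\<lambda>t::real. indicator {0..} t *\<^sub>R (1 + \<bar>t\<bar>) powr (-3/2))"
  proof (rule integrableI_bounded)
    have "(\<integral>\<^sup>+t. ennreal ((1 + \<bar>t\<bar>) powr (-3/2)) * indicator {0..} t \<partial>lborel) = ennreal (0 - (- 2 * (1 + 0) powr (-1/2)))"
    proof (rule nn_integral_FTC_atLeast)
      show "((\<lambda>t::real. - 2 * (1 + t) powr (-1/2)) has_real_derivative (1 + \<bar>x\<bar>) powr (-3/2)) (at x)" if "0 \<le> x" for x
        using that by (auto intro!: derivative_eq_intros)
      show "((\<lambda>t::real. - 2 * (1 + t) powr (-1/2)) \<longlongrightarrow> 0) at_top" by real_asymp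
    qed auto
    also have "\<dots> < \<infinity>" by simp
    also have "(\<integral>\<^sup>+t. ennreal ((1 + \<bar>t\<bar>) powr (-3/2)) * indicator {0..} t \<partial>lborel)
      = (\<integral>\<^sup>+t. ennreal (norm (indicator {0..} t *\<^sub>R (1 + \<bar>t::real\<bar>) powr (-3/2))) \<partial>lborel)"
      by (rule nn_integral_cong) (auto simp: indicator_def)
    finally show "(\<integral>\<^sup>+t. ennreal (norm (indicator {0..} t *\<^sub>R (1 + \<bar>t::real\<bar>) powr (-3/2))) \<partial>lborel) < \<infinity>" .
  qed simp
  have "integrable lborel (\<lambda>t::real. indicator {0..} (0 + (-1) * t) *\<^sub>R (1 + \<bar>0 + (-1) * t\<bar>) powr (-3/2))"
    by (rule lborel_integrable_real_affine[OF half]) simp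
  from Bochner_Integration.integrable_add[OF half this] show ?thesis
    by (rule Bochner_Integration.integrable_bound) (auto simp: indicator_def)
qed

text \<open>The constant covers both \<open>c < 1\<close> and \<open>c \<ge> 1\<close>; the
  application has \<open>c > 1\<close>, where the maximum is 1.\<close>

lemma inverse_norm_square_vertical_le:
  assumes "0 < c"
  shows "1 / (norm (Complex c t))\<^sup>2 \<le> 2 * max 1 (1 / c\<^sup>2) * (1 + \<bar>t\<bar>) powr (-2)"
proof -
  define m where "m = min 1 (c\<^sup>2)"
  have m: "0 < m" "m \<le> 1" "m \<le> c\<^sup>2" using assms by (auto simp: m_def)
  have mm: "max 1 (1 / c\<^sup>2) = 1 / m" using assms by (auto simp: m_def max_def min_def field_simps)
  have "(1 + \<bar>t\<bar>) powr 2 = (1 + \<bar>t\<bar>)\<^sup>2" by simp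
  also have "\<dots> \<le> 2 * (1 + t\<^sup>2)" using sum_squares_bound[of 1 "\<bar>t\<bar>"] by (simp add: power2_eq_square algebra_simps)
  finally have 1: "(1 + \<bar>t\<bar>) powr 2 \<le> 2 * (1 + t\<^sup>2)" .
  have 2: "m * (1 + t\<^sup>2) \<le> (norm (Complex c t))\<^sup>2"
    using m mult_right_mono[of m 1 "t\<^sup>2"] by (simp add: cmod_power2 algebra_simps)
  have p: "0 < m * (1 + t\<^sup>2)" using m by (simp add: add_pos_nonneg)
  have q: "0 < (1 + \<bar>t\<bar>) powr 2" by (subst powr_gt_zero) linarith
  have "1 / (norm (Complex c t))\<^sup>2 \<le> 1 / (m * (1 + t\<^sup>2))"
    by (rule divide_left_mono) (use 2 p mult_pos_pos[OF less_le_trans[OF p 2] p] in auto)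
  also have "\<dots> = (1 / m) * (1 / (1 + t\<^sup>2))" by simp
  also have "1 / (1 + t\<^sup>2) \<le> 2 / (1 + \<bar>t\<bar>) powr 2"
  proof -
    have "1 / u \<le> 2 / w" if "w \<le> 2 * u" "0 < w" "0 < u" for u w :: real using that by (simp add: field_simps)
    from this[OF 1 q] show ?thesis by (simp add: add_pos_nonneg)
  qed
  then have "(1 / m) * (1 / (1 + t\<^sup>2)) \<le> (1 / m) * (2 / (1 + \<bar>t\<bar>) powr 2)"
    using m by (intro mult_left_mono) auto
  finally show ?thesis unfolding mm by (simp add: powr_minus_divide)
qed

lemma integrable_perron_kernel:
  assumes "0 < c"
  shows "integrable lborel (\<lambda>t. exp (of_real y * Complex c t) / (Complex c t)\<^sup>2)"
proof (rule Bochner_Integration.integrable_bound)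
  show "integrable lborel (\<lambda>t. exp (c * y) * (2 * max 1 (1 / c\<^sup>2)) * (1 + \<bar>t\<bar>) powr (-3/2))"
    using integrable_one_plus_abs_powr by simp
  have nz: "of_real c + \<i> * of_real t \<noteq> 0" for t using assms by (simp add: complex_eq_iff)
  have "continuous_on UNIV (\<lambda>t. exp (of_real y * (of_real c + \<i> * of_real t)) / (of_real c + \<i> * of_real t)\<^sup>2)"
    using nz by (intro continuous_intros) simp
  then show "(\<lambda>t. exp (of_real y * Complex c t) / (Complex c t)\<^sup>2) \<in> borel_measurable lborel"
    using borel_measurable_continuous_onI by (simp add: Complex_eq)
  show "AE t in lborel. norm (exp (of_real y * Complex c t) / (Complex c t)\<^sup>2)
    \<le> norm (exp (c * y) * (2 * max 1 (1 / c\<^sup>2)) * (1 + \<bar>t\<bar>) powr (-3/2))"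
  proof (rule AE_I2)
    fix t
    have "norm (exp (of_real y * Complex c t) / (Complex c t)\<^sup>2) = exp (c * y) * (1 / (norm (Complex c t))\<^sup>2)"
      by (simp add: norm_divide norm_power mult.commute)
    also have "\<dots> \<le> exp (c * y) * (2 * max 1 (1 / c\<^sup>2) * (1 + \<bar>t\<bar>) powr (-2))"
      by (intro mult_left_mono inverse_norm_square_vertical_le assms) auto
    also have "\<dots> \<le> exp (c * y) * (2 * max 1 (1 / c\<^sup>2) * (1 + \<bar>t\<bar>) powr (-3/2))"
      by (intro mult_left_mono powr_mono) auto
    finally show "norm (exp (of_real y * Complex c t) / (Complex c t)\<^sup>2)
      \<le> norm (exp (c * y) * (2 * max 1 (1 / c\<^sup>2)) * (1 + \<bar>t\<bar>) powr (-3/2))" by simp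
  qed
qed

lemma contour_integral_rectpath:
  assumes "continuous_on (path_image (rectpath a b)) f"
  shows "contour_integral (rectpath a b) f =
    contour_integral (linepath a (Complex (Re b) (Im a))) f
    + contour_integral (linepath (Complex (Re b) (Im a)) b) f
    + contour_integral (linepath b (Complex (Re a) (Im b))) f
    + contour_integral (linepath (Complex (Re a) (Im b)) a) f"
proof -
  have i: "f contour_integrable_on linepath a (Complex (Re b) (Im a))"
    "f contour_integrable_on linepath (Complex (Re b) (Im a)) b"
    "f contour_integrable_on linepath b (Complex (Re a) (Im b))"
    "f contour_integrable_on linepath (Complex (Re a) (Im b)) a"
    by (intro contour_integrable_continuous_linepath continuous_on_subset[OF assms];
        simp add: rectpath_def Let_def path_image_join le_supI1 le_supI2)+
  then show ?thesis
    by (simp add: rectpath_def Let_def contour_integral_join)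
qed

text \<open>The segment is closed by three sides of a box on which \<open>s\<close> has modulus at
  least \<open>R\<close> and \<open>exp (y * s)\<close> modulus at most \<open>exp (c * y)\<close>:
  to the left for \<open>y \<ge> 0\<close>, around the double pole at 0 with residue
  \<open>y\<close>, and to the right for \<open>y < 0\<close>, where nothing is enclosed. Each side
  has length at most \<open>2 * R\<close>, which accounts for the 6.\<close>

lemma perron_truncated:
  fixes c y R :: real
  assumes c: "0 < c" "c < R"
  defines "f \<equiv> \<lambda>s. exp (of_real y * s) / s\<^sup>2"
  shows "norm (integral {-R..R} (\<lambda>t. f (Complex c t)) - of_real (2 * pi * max 0 y)) \<le> 6 * exp (c * y) / R"
proof -
  have R: "0 < R" using c by simp
  \<comment> \<open>Abscissa of the far vertical side, with the sign that ensures
    \<open>d * y \<le> c * y\<close>.\<close>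
  define d where "d = (if 0 \<le> y then - R else R)"
  have mid: "contour_integral (linepath (Complex c (-R)) (Complex c R)) f = \<i> * integral {-R..R} (\<lambda>t. f (Complex c t))"
    by (rule contour_integral_linepath_same_Re) (use R in auto)
  have seg: "norm (contour_integral (linepath a b) f) \<le> exp (c * y) / R\<^sup>2 * norm (b - a)"
    if "\<And>s. s \<in> closed_segment a b \<Longrightarrow> R \<le> norm s \<and> Re s * y \<le> c * y" for a b
  proof (rule contour_integral_bound_linepath)
    have nz: "s \<noteq> 0" if "s \<in> closed_segment a b" for s using \<open>\<And>s. s \<in> closed_segment a b \<Longrightarrow> _\<close>[OF that] R by auto
    show "f contour_integrable_on linepath a b"
      unfolding f_def by (intro contour_integrable_continuous_linepath continuous_intros) (use nz in auto)
    fix s assume s: "s \<in> closed_segment a b"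
    have "R\<^sup>2 \<le> (norm s)\<^sup>2" using that[OF s] R by (intro power_mono) auto
    then show "norm (f s) \<le> exp (c * y) / R\<^sup>2"
      using that[OF s] R nz[OF s] unfolding f_def norm_divide norm_power norm_exp_eq_Re
      by (intro frac_le) (auto simp: mult.commute)
  qed (use R in auto)
  have segh: "norm (contour_integral (linepath a b) f) \<le> 2 * exp (c * y) / R"
    if "\<bar>Re a\<bar> \<le> R" "\<bar>Re b\<bar> \<le> R" "\<bar>Im a\<bar> = R" "Im b = Im a" "Re a * y \<le> c * y" "Re b * y \<le> c * y" for a b
  proof -
    have "norm (contour_integral (linepath a b) f) \<le> exp (c * y) / R\<^sup>2 * norm (b - a)"
    proof (rule seg)
      fix s assume s: "s \<in> closed_segment a b"
      then obtain u where u: "0 \<le> u" "u \<le> 1" "s = (1 - u) *\<^sub>R a + u *\<^sub>R b" by (auto simp: closed_segment_def)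
      have "Im s = (1 - u) * Im a + u * Im b" using u by simp
      then have "Im s = Im a" using that by (simp add: algebra_simps)
      then have "R \<le> norm s" using abs_Im_le_cmod[of s] that by simp
      \<comment> \<open>\<open>Re s * y\<close> is affine along the side, so bounds at its two ends
        suffice.\<close>
      moreover have "Re s * y = (1 - u) * (Re a * y) + u * (Re b * y)" unfolding u(3) by (simp add: algebra_simps)
      then have "Re s * y \<le> (1 - u) * (c * y) + u * (c * y)" using u that
        by (auto intro!: add_mono mult_left_mono)
      ultimately show "R \<le> norm s \<and> Re s * y \<le> c * y" by (simp add: algebra_simps)
    qed
    also have "norm (b - a) = \<bar>Re b - Re a\<bar>" using that by (simp add: cmod_def)
    also have "exp (c * y) / R\<^sup>2 * \<bar>Re b - Re a\<bar> \<le> exp (c * y) / R\<^sup>2 * (2 * R)"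
      using that by (intro mult_left_mono) auto
    also have "\<dots> = 2 * exp (c * y) / R" using R by (simp add: power2_eq_square)
    finally show ?thesis .
  qed
  have segv: "norm (contour_integral (linepath a b) f) \<le> 2 * exp (c * y) / R"
    if "Re a = d" "Re b = d" "\<bar>Im a\<bar> \<le> R" "\<bar>Im b\<bar> \<le> R" for a b
  proof -
    have dd: "\<bar>d\<bar> = R" "d * y \<le> c * y" using c R mult_right_mono[of d c y] mult_right_mono_neg[of c d y] by (auto simp: d_def)
    have "norm (contour_integral (linepath a b) f) \<le> exp (c * y) / R\<^sup>2 * norm (b - a)"
    proof (rule seg)
      fix s assume s: "s \<in> closed_segment a b"
      then obtain u where u: "s = (1 - u) *\<^sub>R a + u *\<^sub>R b" by (auto simp: closed_segment_def)
      have "Re s = (1 - u) * Re a + u * Re b" using u by simp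
      then have "Re s = d" using that by (simp add: algebra_simps)
      then show "R \<le> norm s \<and> Re s * y \<le> c * y" using abs_Re_le_cmod[of s] dd by simp
    qed
    also have "norm (b - a) = \<bar>Im b - Im a\<bar>" using that by (simp add: cmod_def)
    also have "exp (c * y) / R\<^sup>2 * \<bar>Im b - Im a\<bar> \<le> exp (c * y) / R\<^sup>2 * (2 * R)"
      using that by (intro mult_left_mono) auto
    also have "\<dots> = 2 * exp (c * y) / R" using R by (simp add: power2_eq_square)
    finally show ?thesis .
  qed
  have "\<exists>A B C. \<i> * integral {-R..R} (\<lambda>t. f (Complex c t)) - \<i> * of_real (2 * pi * max 0 y) = A + B + C
     \<and> norm A \<le> 2 * exp (c * y) / R \<and> norm B \<le> 2 * exp (c * y) / R \<and> norm C \<le> 2 * exp (c * y) / R"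
  proof (cases "0 \<le> y")
    case True
    then have d: "d = - R" by (simp add: d_def)
    let ?a = "Complex (-R) (-R)" and ?b = "Complex c R"
    have pi: "path_image (rectpath ?a ?b) \<subseteq> UNIV - {0}"
      using c R by (auto simp: path_image_rectpath)
    have cont: "continuous_on (path_image (rectpath ?a ?b)) f"
      unfolding f_def by (intro continuous_intros) (use pi in auto)
    have "contour_integral (rectpath ?a ?b) f
      = 2 * pi * \<i> * (\<Sum>p\<in>{0}. winding_number (rectpath ?a ?b) p * residue f p)"
      by (rule Residue_theorem[of UNIV]) (use pi in \<open>auto simp: f_def intro!: holomorphic_intros\<close>)
    also have "\<dots> = 2 * pi * \<i> * (winding_number (rectpath ?a ?b) 0 * residue f 0)" by simp
    also have "winding_number (rectpath ?a ?b) 0 = 1"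
      by (rule winding_number_rectpath) (use c R in \<open>auto simp: in_box_complex_iff\<close>)
    \<comment> \<open>The pole has order two, so the residue is the first derivative of the
      exponential at 0.\<close>
    also have "residue f 0 = of_real y"
    proof -
      have "residue (\<lambda>z. exp (of_real y * z) / z ^ Suc 1) 0 = (deriv ^^ 1) (\<lambda>z. exp (of_real y * z)) 0 / fact 1"
        by (rule residue_holomorphic_over_power'[of UNIV]) (auto intro!: holomorphic_intros)
      also have "\<dots> = deriv (\<lambda>z. exp (of_real y * z)) 0" by simp
      also have "deriv (\<lambda>z. exp (of_real y * z)) (0::complex) = of_real y"
        by (rule DERIV_imp_deriv) (auto intro!: derivative_eq_intros)
      finally show ?thesis by (simp add: f_def power2_eq_square)
    qed
    finally have res: "contour_integral (rectpath ?a ?b) f = \<i> * of_real (2 * pi * max 0 y)" using True by simp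
    let ?A = "contour_integral (linepath (Complex (-R) (-R)) (Complex c (-R))) f"
    let ?B = "contour_integral (linepath (Complex c R) (Complex (-R) R)) f"
    let ?C = "contour_integral (linepath (Complex (-R) R) (Complex (-R) (-R))) f"
    have "\<i> * of_real (2 * pi * max 0 y) = ?A + \<i> * integral {-R..R} (\<lambda>t. f (Complex c t)) + ?B + ?C"
      using contour_integral_rectpath[OF cont] by (simp only: res mid complex.sel)
    then have "\<i> * integral {-R..R} (\<lambda>t. f (Complex c t)) - \<i> * of_real (2 * pi * max 0 y) = - ?A + - ?B + - ?C"
      by algebra
    moreover have ry: "- (R * y) \<le> c * y" using mult_right_mono[of "-R" c y] c R True by simp
    have "norm (- ?A) \<le> 2 * exp (c * y) / R" "norm (- ?B) \<le> 2 * exp (c * y) / R" "norm (- ?C) \<le> 2 * exp (c * y) / R"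
      unfolding norm_minus_cancel by (rule segh segv; use c R d ry in simp)+
    ultimately show ?thesis by blast
  next
    case False
    then have d: "d = R" by (simp add: d_def)
    let ?a = "Complex c (-R)" and ?b = "Complex R R"
    have pi: "path_image (rectpath ?a ?b) \<subseteq> {s. 0 < Re s}"
      using c R by (auto simp: path_image_rectpath)
    have cont: "continuous_on (path_image (rectpath ?a ?b)) f"
      unfolding f_def by (intro continuous_intros) (use pi in auto)
    let ?A = "contour_integral (linepath (Complex c (-R)) (Complex R (-R))) f"
    let ?B = "contour_integral (linepath (Complex R (-R)) (Complex R R)) f"
    let ?C = "contour_integral (linepath (Complex R R) (Complex c R)) f"
    have "(f has_contour_integral 0) (rectpath ?a ?b)"
    proof (rule Cauchy_theorem_convex_simple[of _ "{s. 0 < Re s}"])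
      show "f holomorphic_on {s. 0 < Re s}" unfolding f_def by (intro holomorphic_intros) auto
    qed (use pi in \<open>auto simp: convex_halfspace_Re_gt\<close>)
    then have "contour_integral (rectpath ?a ?b) f = 0" by (rule contour_integral_unique)
    moreover have "contour_integral (linepath (Complex c R) (Complex c (-R))) f
      = - contour_integral (linepath (Complex c (-R)) (Complex c R)) f"
      by (rule contour_integral_reverse_linepath)
         (auto intro!: continuous_on_subset[OF cont] simp: rectpath_def Let_def path_image_join closed_segment_commute)
    ultimately have "0 = ?A + ?B + ?C - \<i> * integral {-R..R} (\<lambda>t. f (Complex c t))"
      using contour_integral_rectpath[OF cont] by (simp only: mid complex.sel) simp
    then have "\<i> * integral {-R..R} (\<lambda>t. f (Complex c t)) - \<i> * of_real (2 * pi * max 0 y) = ?A + ?B + ?C"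
      using False by simp
    moreover have ry: "R * y \<le> c * y" using mult_right_mono_neg[of c R y] c R False by simp
    have "norm ?A \<le> 2 * exp (c * y) / R" "norm ?B \<le> 2 * exp (c * y) / R" "norm ?C \<le> 2 * exp (c * y) / R"
      by (rule segh segv; use c R d ry in simp)+
    ultimately show ?thesis by blast
  qed
  then obtain A B C where ABC: "\<i> * integral {-R..R} (\<lambda>t. f (Complex c t)) - \<i> * of_real (2 * pi * max 0 y) = A + B + C"
     "norm A \<le> 2 * exp (c * y) / R" "norm B \<le> 2 * exp (c * y) / R" "norm C \<le> 2 * exp (c * y) / R" by blast
  have "norm (integral {-R..R} (\<lambda>t. f (Complex c t)) - of_real (2 * pi * max 0 y))
    = norm (\<i> * (integral {-R..R} (\<lambda>t. f (Complex c t)) - of_real (2 * pi * max 0 y)))"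
    by (simp add: norm_mult)
  also have "\<dots> = norm (A + B + C)" using ABC(1) by (simp add: algebra_simps)
  also have "\<dots> \<le> 6 * exp (c * y) / R" using ABC(2-4) norm_triangle_ineq[of "A + B" C] norm_triangle_ineq[of A B] by simp
  finally show ?thesis .
qed

text \<open>The kernel is absolutely integrable, so its integral is the limit of symmetric
  truncations, whose error decays like \<open>1 / R\<close>. The squared denominator makes the
  result a ramp rather than a step, which is why logarithmic averages appear.\<close>

lemma perron_formula:
  fixes c y :: real
  assumes c: "0 < c"
  shows "(LINT t|lborel. exp (of_real y * Complex c t) / (Complex c t)\<^sup>2) = of_real (2 * pi * max 0 y)"
proof -
  define g where "g = (\<lambda>t. exp (of_real y * Complex c t) / (Complex c t)\<^sup>2)"
  have int: "integrable lborel g" unfolding g_def by (rule integrable_perron_kernel[OF c])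
  have "(\<lambda>n::nat. LINT t|lborel. indicator {- real n..real n} t *\<^sub>R g t) \<longlonglongrightarrow> (LINT t|lborel. g t)"
  proof (rule integral_dominated_convergence[where w = "\<lambda>t. norm (g t)"])
    show "AE t in lborel. (\<lambda>n. indicator {- real n..real n} t *\<^sub>R g t) \<longlonglongrightarrow> g t"
    proof (rule AE_I2, rule tendsto_eventually)
      fix t :: real
      show "\<forall>\<^sub>F n in sequentially. indicator {- real n..real n} t *\<^sub>R g t = g t"
        using eventually_ge_at_top[of "nat \<lceil>\<bar>t\<bar>\<rceil>"] by eventually_elim (auto simp: indicator_def nat_le_iff ceiling_le_iff)
    qed
  qed (use int in \<open>auto simp: indicator_def\<close>)
  moreover have "(LINT t|lborel. indicator {- R..R} t *\<^sub>R g t) = integral {-R..R} g" for R :: real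
    using set_borel_integral_eq_integral(2)[of "{-R..R}" g] int
    by (simp add: set_lebesgue_integral_def set_integrable_def integrable_mult_indicator)
  ultimately have lim1: "(\<lambda>n::nat. integral {- real n..real n} g) \<longlonglongrightarrow> (LINT t|lborel. g t)" by simp
  have "(\<lambda>n::nat. integral {- real n..real n} g - of_real (2 * pi * max 0 y)) \<longlonglongrightarrow> 0"
  proof (rule Lim_null_comparison)
    show "\<forall>\<^sub>F n in sequentially. norm (integral {- real n..real n} g - of_real (2 * pi * max 0 y)) \<le> 6 * exp (c * y) / real n"
      using eventually_gt_at_top[of "nat \<lceil>c\<rceil>"]
    proof eventually_elim
      case (elim n)
      then have "c < real n" by linarith
      from perron_truncated[OF c this] show ?case by (simp add: g_def)
    qed
    show "(\<lambda>n::nat. 6 * exp (c * y) / real n) \<longlonglongrightarrow> 0" by real_asymp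
  qed
  then have "(\<lambda>n::nat. integral {- real n..real n} g) \<longlonglongrightarrow> of_real (2 * pi * max 0 y)" by (simp add: LIM_zero_iff)
  from LIMSEQ_unique[OF lim1 this] show ?thesis by (simp add: g_def)
qed

section \<open>Dirichlet series and the Euler product\<close>

text \<open>Summation starts at \<open>n = 0\<close>, where the term vanishes because
  \<open>0 powr z = 0\<close>.\<close>

definition dir_series :: "(nat \<Rightarrow> real) \<Rightarrow> complex \<Rightarrow> complex" where
  "dir_series a s = (\<Sum>n. of_real (a n) * of_nat n powr (-s))"

definition dir_summable :: "(nat \<Rightarrow> real) \<Rightarrow> bool" where
  "dir_summable a \<longleftrightarrow> (\<forall>\<sigma>>1. summable (\<lambda>n. \<bar>a n\<bar> * real n powr (-\<sigma>)))"

lemma norm_nat_powr: "norm (of_nat n powr s :: complex) = real n powr (Re s)"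
  by (subst norm_powr_real_powr) auto

lemma norm_dir_term: "norm (of_real (a n) * of_nat n powr (-s) :: complex) = \<bar>a n\<bar> * real n powr (- Re s)"
  by (simp add: norm_mult norm_nat_powr)

lemma dir_summable_norm:
  "dir_summable a \<Longrightarrow> 1 < Re s \<Longrightarrow> summable (\<lambda>n. norm (of_real (a n) * of_nat n powr (-s) :: complex))"
  unfolding norm_dir_term dir_summable_def by blast

lemma dir_series_sums:
  assumes "dir_summable a" "1 < Re s"
  shows "(\<lambda>n. of_real (a n) * of_nat n powr (-s)) sums dir_series a s"
  unfolding dir_series_def using summable_norm_cancel[OF dir_summable_norm[OF assms]] by (rule summable_sums)

lemma dir_summable_mono:
  assumes "dir_summable b" "\<And>n. \<bar>a n\<bar> \<le> \<bar>b n\<bar>"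
  shows "dir_summable a"
  unfolding dir_summable_def
proof (intro allI impI)
  fix \<sigma> :: real assume "1 < \<sigma>"
  then have "summable (\<lambda>n. \<bar>b n\<bar> * real n powr (-\<sigma>))" using assms(1) by (simp add: dir_summable_def)
  then show "summable (\<lambda>n. \<bar>a n\<bar> * real n powr (-\<sigma>))"
    by (rule summable_comparison_test'[where N = 0]) (auto intro!: mult_right_mono assms(2))
qed

lemma dir_summable_diff:
  assumes "dir_summable a" "dir_summable b"
  shows "dir_summable (\<lambda>n. a n - b n)"
  unfolding dir_summable_def
proof (intro allI impI)
  fix \<sigma> :: real assume "1 < \<sigma>"
  then have "summable (\<lambda>n. \<bar>a n\<bar> * real n powr (-\<sigma>) + \<bar>b n\<bar> * real n powr (-\<sigma>))"
    using assms by (intro summable_add) (simp_all add: dir_summable_def)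
  then show "summable (\<lambda>n. \<bar>a n - b n\<bar> * real n powr (-\<sigma>))"
  proof (rule summable_comparison_test'[where N = 0])
    fix n
    have "\<bar>a n - b n\<bar> * real n powr (-\<sigma>) \<le> (\<bar>a n\<bar> + \<bar>b n\<bar>) * real n powr (-\<sigma>)"
      by (rule mult_right_mono) auto
    then show "norm (\<bar>a n - b n\<bar> * real n powr (-\<sigma>)) \<le> \<bar>a n\<bar> * real n powr (-\<sigma>) + \<bar>b n\<bar> * real n powr (-\<sigma>)"
      by (simp add: abs_mult distrib_right)
  qed
qed

lemma dir_series_diff:
  assumes "dir_summable a" "dir_summable b" "1 < Re s"
  shows "dir_series (\<lambda>n. a n - b n) s = dir_series a s - dir_series b s"
proof -
  have "(\<lambda>n. of_real (a n - b n) * of_nat n powr (-s)) sums (dir_series a s - dir_series b s)"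
    using sums_diff[OF dir_series_sums[OF assms(1,3)] dir_series_sums[OF assms(2,3)]] by (simp add: algebra_simps)
  then show ?thesis by (simp add: dir_series_def sums_iff)
qed

lemma dir_summable_1: "dir_summable (\<lambda>_. 1)"
  by (auto simp: dir_summable_def summable_real_powr_iff)

text \<open>Half of the excess \<open>\<sigma> - 1\<close> is spent on the logarithm, which is at
  most \<open>real n powr e / e\<close>; the other half keeps the series convergent.\<close>

lemma dir_summable_ln:
  assumes "dir_summable a"
  shows "dir_summable (\<lambda>n. ln (real n) * a n)"
  unfolding dir_summable_def
proof (intro allI impI)
  fix \<sigma> :: real assume \<sigma>: "1 < \<sigma>"
  define e where "e = (\<sigma> - 1) / 2"
  have e: "0 < e" "1 < \<sigma> - e" using \<sigma> by (auto simp: e_def field_simps)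
  have "summable (\<lambda>n. (1 / e) * (\<bar>a n\<bar> * real n powr (-(\<sigma> - e))))"
    using assms e(2) unfolding dir_summable_def by (intro summable_mult) blast
  then show "summable (\<lambda>n. \<bar>ln (real n) * a n\<bar> * real n powr (-\<sigma>))"
  proof (rule summable_comparison_test'[where N = 1])
    fix n :: nat assume n: "1 \<le> n"
    then have "ln (real n) \<le> real n powr e / e" using e by (intro ln_powr_bound) auto
    then have "ln (real n) * (\<bar>a n\<bar> * real n powr (-\<sigma>)) \<le> real n powr e / e * (\<bar>a n\<bar> * real n powr (-\<sigma>))"
      by (rule mult_right_mono) simp
    also have "\<dots> = (1 / e) * (\<bar>a n\<bar> * (real n powr e * real n powr (-\<sigma>)))" by simp
    also have "real n powr e * real n powr (-\<sigma>) = real n powr (-(\<sigma> - e))"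
      by (simp flip: powr_add)
    finally show "norm (\<bar>ln (real n) * a n\<bar> * real n powr (-\<sigma>)) \<le> (1 / e) * (\<bar>a n\<bar> * real n powr (-(\<sigma> - e)))"
      using n by (simp add: abs_mult mult.assoc)
  qed
qed

text \<open>Termwise differentiation, with a majorant uniform on a disc whose radius is half the
  distance from \<open>s\<close> to the line \<open>Re s = 1\<close>; each derivative of
  \<open>of_nat n powr (-s)\<close> brings down \<open>- ln (real n)\<close>.\<close>

lemma has_field_derivative_dir_series:
  assumes a: "dir_summable a" and s: "1 < Re s"
  shows "(dir_series a has_field_derivative - dir_series (\<lambda>n. ln (real n) * a n) s) (at s)"
proof -
  define f where "f = (\<lambda>n s. of_real (a n) * of_nat n powr (-s) :: complex)"
  define f' where "f' = (\<lambda>n s. - (of_real (ln (real n) * a n) * of_nat n powr (-s)) :: complex)"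
  have der: "(f n has_field_derivative f' n s) (at s)" for n s
  proof (cases "n = 0")
    case False
    then show ?thesis unfolding f_def f'_def powr_def
      by (auto intro!: derivative_eq_intros simp: Ln_of_nat)
  qed (simp add: f_def f'_def)
  have "\<exists>g g'. \<forall>s\<in>{s. 1 < Re s}. (\<lambda>n. f n s) sums g s \<and> (\<lambda>n. f' n s) sums g' s \<and> (g has_field_derivative g' s) (at s)"
  proof (rule series_and_derivative_comparison_local)
    fix s assume s: "s \<in> {s. 1 < Re s}"
    define d where "d = (Re s - 1) / 2"
    have d: "0 < d" "1 < Re s - d" using s by (auto simp: d_def field_simps)
    have "norm (f n z) \<le> \<bar>a n\<bar> * real n powr (-(Re s - d))" if "z \<in> ball s d" for n z
    proof (cases "n = 0")
      case False
      have "\<bar>Re (s - z)\<bar> < d" using abs_Re_le_cmod[of "s - z"] that by (simp add: dist_norm)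
      then have "- Re z \<le> - (Re s - d)" by simp
      then show ?thesis unfolding f_def norm_dir_term using False
        by (intro mult_left_mono powr_mono) auto
    qed (simp add: f_def)
    moreover have "summable (\<lambda>n. \<bar>a n\<bar> * real n powr (-(Re s - d)))"
      using a d by (auto simp: dir_summable_def)
    ultimately show "\<exists>d h. 0 < d \<and> summable h \<and> (\<forall>\<^sub>F n in sequentially. \<forall>y\<in>ball s d \<inter> {s. 1 < Re s}. cmod (f n y) \<le> h n)"
      using d by (intro exI[of _ d] exI[of _ "\<lambda>n. \<bar>a n\<bar> * real n powr (-(Re s - d))"]) auto
  qed (use der in \<open>auto simp: open_halfspace_Re_gt\<close>)
  then obtain g g' where g: "\<And>s. 1 < Re s \<Longrightarrow> (\<lambda>n. f n s) sums g s"
    "\<And>s. 1 < Re s \<Longrightarrow> (\<lambda>n. f' n s) sums g' s" "\<And>s. 1 < Re s \<Longrightarrow> (g has_field_derivative g' s) (at s)" by auto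
  have geq: "g z = dir_series a z" if "1 < Re z" for z
    using sums_unique2[OF g(1)[OF that]] dir_series_sums[OF a that] by (simp add: f_def)
  have g'eq: "g' s = - dir_series (\<lambda>n. ln (real n) * a n) s"
    using sums_unique2[OF g(2)[OF s]] sums_minus[OF dir_series_sums[OF dir_summable_ln[OF a] s]] by (simp add: f'_def)
  show ?thesis
    using has_field_derivative_transform_within_open[OF g(3)[OF s], of "{s. 1 < Re s}" "dir_series a"] s geq
    by (simp add: g'eq open_halfspace_Re_gt)
qed

section \<open>Products: the identity for \<open>mangoldt\<close>, the Euler product, the 3-4-1
  inequality\<close>

lemma has_sum_product_complex:
  fixes f :: "'a \<Rightarrow> complex" and g :: "'b \<Rightarrow> complex"
  assumes f: "(f has_sum a) A" and g: "(g has_sum b) B"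
  shows "((\<lambda>(x, y). f x * g y) has_sum (a * b)) (A \<times> B)"
proof -
  have na: "(\<lambda>x. norm (f x)) summable_on A" and nb: "(\<lambda>y. norm (g y)) summable_on B"
    using f g summable_on_iff_abs_summable_on_complex has_sum_imp_summable by blast+
  have "(\<lambda>(x, y). norm (f x) * norm (g y)) summable_on (A \<times> B)"
  proof (rule summable_on_SigmaI)
    show "((\<lambda>y. case (x, y) of (x, y) \<Rightarrow> norm (f x) * norm (g y)) has_sum norm (f x) * infsum (\<lambda>y. norm (g y)) B) B" for x
      using nb by (auto intro!: has_sum_cmult_right)
    show "(\<lambda>x. norm (f x) * (\<Sum>\<^sub>\<infinity>y\<in>B. norm (g y))) summable_on A"
      using na by (rule summable_on_cmult_left)
  qed auto
  then have "(\<lambda>z. norm (case z of (x, y) \<Rightarrow> f x * g y)) summable_on (A \<times> B)"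
    by (simp add: case_prod_unfold norm_mult)
  then have sm: "(\<lambda>(x, y). f x * g y) summable_on (A \<times> B)" by (rule abs_summable_summable)
  show ?thesis
  proof (rule has_sum_SigmaI[OF _ _ sm])
    show "((\<lambda>y. case (x, y) of (x, y) \<Rightarrow> f x * g y) has_sum f x * b) B" for x
      using g by (auto intro!: has_sum_cmult_right)
    show "((\<lambda>x. f x * b) has_sum a * b) A" using f by (rule has_sum_cmult_left)
  qed
qed

lemma dir_series_has_sum:
  assumes "dir_summable a" "1 < Re s"
  shows "((\<lambda>n. of_real (a n) * of_nat n powr (-s)) has_sum dir_series a s) {0<..}"
proof -
  have "((\<lambda>n. of_real (a n) * of_nat n powr (-s)) has_sum dir_series a s) UNIV"
    using norm_summable_imp_has_sum[OF dir_summable_norm[OF assms] dir_series_sums[OF assms]] .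
  also have "?this \<longleftrightarrow> ?thesis" by (rule has_sum_cong_neutral) auto
  finally show ?thesis .
qed

lemma nat_powr_mult: "(of_nat (m * n) :: complex) powr s = of_nat m powr s * of_nat n powr s"
  unfolding of_nat_mult by (rule powr_times_real) auto

lemma dir_summable_mangoldt: "dir_summable mangoldt"
proof (rule dir_summable_mono[OF dir_summable_ln[OF dir_summable_1]])
  fix n :: nat
  show "\<bar>mangoldt n\<bar> \<le> \<bar>ln (real n) * 1\<bar>"
    using mangoldt_le[of n] by (cases "n = 0") auto
qed

text \<open>The product of two absolutely convergent series is regrouped by
  \<open>n = d * m\<close>, and \<open>mangoldt\<close> summed over the divisors of \<open>n\<close>
  is \<open>ln n\<close>.\<close>

lemma dir_series_mangoldt:
  assumes s: "1 < Re s"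
  shows "dir_series mangoldt s * dir_series (\<lambda>_. 1) s = dir_series (\<lambda>n. ln (real n)) s"
proof -
  have ln: "dir_summable (\<lambda>n. ln (real n))" using dir_summable_ln[OF dir_summable_1] by simp
  have "((\<lambda>(d, m). (of_real (mangoldt d) * of_nat d powr (-s)) * (of_real 1 * of_nat m powr (-s)))
      has_sum dir_series mangoldt s * dir_series (\<lambda>_. 1) s) ({0<..} \<times> {0<..})"
    by (intro has_sum_product_complex dir_series_has_sum dir_summable_mangoldt dir_summable_1 s)
  also have "?this \<longleftrightarrow> ((\<lambda>(n, d). of_real (mangoldt d) * of_nat n powr (-s)) has_sum
      dir_series mangoldt s * dir_series (\<lambda>_. 1) s) (SIGMA n:{0<..}. {d. d dvd n})"
    by (rule has_sum_reindex_bij_witness[where i = "\<lambda>(n, d). (d, n div d)" and j = "\<lambda>(d, m). (d * m, d)"])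
       (auto simp: nat_powr_mult elim!: dvdE simp del: of_nat_mult)
  finally have "((\<lambda>n. \<Sum>d | d dvd n. of_real (mangoldt d) * of_nat n powr (-s)) has_sum
      dir_series mangoldt s * dir_series (\<lambda>_. 1) s) {0<..}"
    by (rule has_sum_SigmaD) (auto intro!: has_sum_finiteI)
  also have "?this \<longleftrightarrow> ((\<lambda>n. of_real (ln (real n)) * of_nat n powr (-s)) has_sum
      dir_series mangoldt s * dir_series (\<lambda>_. 1) s) {0<..}"
  proof (rule has_sum_cong)
    fix n :: nat assume "n \<in> {0<..}"
    then have "of_real (\<Sum>d | d dvd n. mangoldt d) = (of_real (ln (real n)) :: complex)"
      using mangoldt_sum[of n, where 'a = real] by simp
    then show "(\<Sum>d | d dvd n. of_real (mangoldt d) * of_nat n powr (-s)) = (of_real (ln (real n)) * of_nat n powr (-s) :: complex)"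
      by (simp flip: sum_distrib_right)
  qed
  finally show ?thesis using has_sum_unique[OF _ dir_series_has_sum[OF ln s]] by blast
qed

text \<open>The Euler product in sieve form, free of infinite products and of division:
  multiplication by a new prime \<open>p\<close> maps the numbers with no divisor in
  \<open>S\<close> onto those among them that \<open>p\<close> divides, so striking out the latter
  multiplies the sum by \<open>1 - of_nat p powr (-s)\<close>.\<close>

lemma has_sum_coprime_prime_set:
  assumes s: "1 < Re s" and S: "finite S" "\<And>p. p \<in> S \<Longrightarrow> prime (p::nat)"
  shows "((\<lambda>n. of_nat n powr (-s)) has_sum dir_series (\<lambda>_. 1) s * (\<Prod>p\<in>S. 1 - of_nat p powr (-s)))
    {n. 0 < n \<and> (\<forall>p\<in>S. \<not> p dvd n)}"
  using S
proof (induction S rule: finite_induct)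
  case empty
  then show ?case using dir_series_has_sum[OF dir_summable_1 s] by (simp add: greaterThan_def)
next
  case (insert p S)
  let ?A = "\<lambda>S. {n. 0 < n \<and> (\<forall>p\<in>S. \<not> p dvd n)}"
  define w where "w = dir_series (\<lambda>_. 1) s * (\<Prod>p\<in>S. 1 - of_nat p powr (-s))"
  have IH: "((\<lambda>n. of_nat n powr (-s)) has_sum w) (?A S)" using insert w_def by auto
  have p: "prime p" "0 < p" using insert by (auto intro: prime_gt_0_nat)
  have np: "\<not> q dvd p" if "q \<in> S" for q
    using that insert primes_dvd_imp_eq[of q p] p by auto
  have "((\<lambda>n. of_nat p powr (-s) * of_nat n powr (-s)) has_sum of_nat p powr (-s) * w) (?A S)"
    by (rule has_sum_cmult_right[OF IH])
  also have "?this \<longleftrightarrow> ((\<lambda>n. of_nat n powr (-s)) has_sum of_nat p powr (-s) * w) {n \<in> ?A S. p dvd n}"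
    by (rule has_sum_reindex_bij_witness[where i = "\<lambda>n. n div p" and j = "\<lambda>n. p * n"])
       (use p np insert in \<open>auto simp: nat_powr_mult prime_dvd_mult_iff elim!: dvdE simp del: of_nat_mult\<close>)
  finally have "((\<lambda>n. of_nat n powr (-s)) has_sum (w - of_nat p powr (-s) * w)) (?A S - {n \<in> ?A S. p dvd n})"
    by (intro has_sum_Diff[OF IH]) auto
  also have "?A S - {n \<in> ?A S. p dvd n} = ?A (insert p S)" by auto
  also have "w - of_nat p powr (-s) * w = dir_series (\<lambda>_. 1) s * (\<Prod>p\<in>insert p S. 1 - of_nat p powr (-s))"
    using insert by (simp add: w_def algebra_simps)
  finally show ?case .
qed

text \<open>Once the primes up to \<open>N\<close> are sieved out, every survivor other than 1 has a
  prime factor beyond \<open>N\<close>, so it exceeds \<open>N\<close> itself; the tail of a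
  convergent series bounds the contribution of all of these.\<close>

lemma euler_product_tendsto:
  assumes s: "1 < Re s"
  shows "(\<lambda>N. dir_series (\<lambda>_. 1) s * (\<Prod>p | prime p \<and> p \<le> N. 1 - of_nat p powr (-s))) \<longlonglongrightarrow> 1"
proof -
  let ?f = "\<lambda>n::nat. of_nat n powr (-s) :: complex" and ?g = "\<lambda>n::nat. real n powr (- Re s)"
  define Z where "Z = (\<Sum>n. ?g n)"
  have g: "summable ?g" using s by (simp add: summable_real_powr_iff)
  have gZ: "(?g has_sum Z) UNIV"
    unfolding Z_def using norm_summable_imp_has_sum[of ?g] g by (simp add: summable_sums)
  have gt: "(?g has_sum (Z - sum ?g {..N})) {N<..}" for N
  proof -
    have "UNIV - {..N} = {N<..}" by auto
    then show ?thesis using has_sum_Diff[OF gZ has_sum_finite[of "{..N}" ?g]] by simp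
  qed
  have bound: "norm (dir_series (\<lambda>_. 1) s * (\<Prod>p | prime p \<and> p \<le> N. 1 - of_nat p powr (-s)) - 1) \<le> Z - sum ?g {..N}" for N
  proof -
    let ?A = "{n. 0 < n \<and> (\<forall>p\<in>{p. prime p \<and> p \<le> N}. \<not> p dvd n)}"
    let ?w = "dir_series (\<lambda>_. 1) s * (\<Prod>p | prime p \<and> p \<le> N. 1 - of_nat p powr (-s))"
    have fA: "(?f has_sum ?w) ?A" by (rule has_sum_coprime_prime_set[OF s]) auto
    have "(?f has_sum (?w - sum ?f {1})) (?A - {1})"
      by (rule has_sum_Diff[OF fA has_sum_finite]) auto
    then have fA1: "(?f has_sum (?w - 1)) (?A - {1})" by simp
    have sub: "?A - {1} \<subseteq> {N<..}"
    proof
      fix n assume n: "n \<in> ?A - {1}"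
      then obtain p where p: "prime p" "p dvd n" using prime_factor_nat[of n] by auto
      then have "\<not> p \<le> N" "p \<le> n" using n dvd_imp_le[of p n] by auto
      then show "n \<in> {N<..}" by simp
    qed
    have "?g summable_on (?A - {1})"
      using summable_on_subset_banach[OF has_sum_imp_summable[OF gt] sub] .
    then obtain v where v: "(?g has_sum v) (?A - {1})" by (auto simp: summable_on_def)
    have "norm (?w - 1) \<le> v"
      by (rule norm_infsum_le[OF fA1 v]) (simp add: norm_nat_powr)
    also have "v \<le> Z - sum ?g {..N}"
      by (rule has_sum_mono_neutral[OF v gt]) (use sub in auto)
    finally show ?thesis .
  qed
  have "(\<lambda>N. sum ?g {..N}) \<longlonglongrightarrow> Z" using summable_LIMSEQ'[OF g] by (simp add: Z_def)
  then have "(\<lambda>N. Z - sum ?g {..N}) \<longlonglongrightarrow> Z - Z" by (intro tendsto_intros)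
  then have lim0: "(\<lambda>N. Z - sum ?g {..N}) \<longlonglongrightarrow> 0" by simp
  have "(\<lambda>N. dir_series (\<lambda>_. 1) s * (\<Prod>p | prime p \<and> p \<le> N. 1 - of_nat p powr (-s)) - 1) \<longlonglongrightarrow> 0"
    by (rule Lim_null_comparison[OF always_eventually lim0]) (use bound in blast)
  then show ?thesis by (simp add: LIM_zero_iff)
qed

text \<open>Expanding \<open>- ln (norm (1 - r * z))\<close> in powers of \<open>r\<close> gives
  terms \<open>r ^ n * Re (z ^ n) / n\<close>. Combined with weights 3, 4, 1 at \<open>1\<close>,
  \<open>w\<close>, \<open>w\<^sup>2\<close> they are non-negative, because 3 + 4 cos a + cos 2a = 2
  (1 + cos a)^2.\<close>

lemma euler_factor_341:
  fixes w :: complex and r :: real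
  assumes r: "0 \<le> r" "r < 1" and w: "norm w = 1"
  shows "norm (1 - of_real r :: complex) ^ 3 * norm (1 - of_real r * w) ^ 4 * norm (1 - of_real r * w\<^sup>2) \<le> 1"
proof -
  have L: "(\<lambda>n. r ^ n * Re (z ^ n) / real n) sums (- ln (norm (1 - of_real r * z)))" if "norm z = 1" for z :: complex
  proof -
    have "norm (- (of_real r * z)) < 1" using r that by (simp add: norm_mult)
    from Ln_series'[OF this] have "(\<lambda>n. - ((of_real r * z) ^ n) / of_nat n) sums ln (1 - of_real r * z)" by simp
    from sums_minus[OF sums_Re[OF this]]
    have A: "(\<lambda>n. Re ((of_real r * z) ^ n / of_nat n)) sums (- Re (ln (1 - of_real r * z)))" by simp
    have "of_real r * z \<noteq> 1" using \<open>norm (- (of_real r * z)) < 1\<close> by force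
    then have B: "Re (ln (1 - of_real r * z)) = ln (norm (1 - of_real r * z))" by (intro Re_Ln) auto
    have "(of_real r * z) ^ n / of_nat n = of_real (r ^ n / real n) * z ^ n" for n
      by (simp add: power_mult_distrib)
    then have C: "Re ((of_real r * z) ^ n / of_nat n) = r ^ n * Re (z ^ n) / real n" for n
      by (simp only: times_complex.sel Re_complex_of_real Im_complex_of_real) simp
    show ?thesis using A unfolding B C .
  qed
  have pos: "0 < norm (1 - of_real r * z)" if "norm z = 1" for z :: complex
  proof -
    have "norm (of_real r * z) < 1" using r that by (simp add: norm_mult)
    then have "of_real r * z \<noteq> 1" by force
    then show ?thesis by simp
  qed
  define A B C where "A = norm (1 - of_real r * 1 :: complex)" and "B = norm (1 - of_real r * w)" and "C = norm (1 - of_real r * w\<^sup>2)"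
  have pABC: "0 < A" "0 < B" "0 < C" unfolding A_def B_def C_def by (rule pos; simp add: w norm_power)+
  have "(\<lambda>n. 3 * (r ^ n * Re (1 ^ n) / real n) + 4 * (r ^ n * Re (w ^ n) / real n) + r ^ n * Re ((w\<^sup>2) ^ n) / real n)
    sums (3 * (- ln A) + 4 * (- ln B) + (- ln C))"
    unfolding A_def B_def C_def by (intro sums_add sums_mult L) (auto simp: w norm_power)
  moreover have "0 \<le> 3 * (r ^ n * Re (1 ^ n) / real n) + 4 * (r ^ n * Re (w ^ n) / real n) + r ^ n * Re ((w\<^sup>2) ^ n) / real n" for n
  proof -
    have "norm (w ^ n) = 1" using w by (simp add: norm_power)
    then have "(Re (w ^ n))\<^sup>2 + (Im (w ^ n))\<^sup>2 = 1" by (simp add: cmod_def)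
    moreover have "Re ((w\<^sup>2) ^ n) = (Re (w ^ n))\<^sup>2 - (Im (w ^ n))\<^sup>2"
      by (metis Re_power2 power_commutes power_even_eq power_mult mult.commute)
    ultimately have "3 + 4 * Re (w ^ n) + Re ((w\<^sup>2) ^ n) = 2 * (1 + Re (w ^ n))\<^sup>2" by (simp add: power2_eq_square algebra_simps)
    then have "0 \<le> 3 + 4 * Re (w ^ n) + Re ((w\<^sup>2) ^ n)" by simp
    then have "0 \<le> r ^ n / real n * (3 + 4 * Re (w ^ n) + Re ((w\<^sup>2) ^ n))" using r by (intro mult_nonneg_nonneg) auto
    then show ?thesis by (simp add: algebra_simps add_divide_distrib)
  qed
  ultimately have "0 \<le> 3 * (- ln A) + 4 * (- ln B) + (- ln C)" by (rule sums_le[OF _ sums_zero, rotated])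
  then have "ln (A ^ 3 * B ^ 4 * C) \<le> 0" using pABC by (simp add: ln_mult ln_realpow)
  then have "A ^ 3 * B ^ 4 * C \<le> 1" using pABC by (simp add: ln_le_zero_iff)
  then show ?thesis by (simp add: A_def B_def C_def)
qed

text \<open>Multiplying the inequality for a single Euler factor over the primes up to
  \<open>N\<close> bounds the combination of sieved products by the right-hand side. Those products
  tend to 1, so no logarithm of zeta is needed.\<close>

lemma zeta_341:
  assumes \<sigma>: "1 < \<sigma>"
  shows "1 \<le> norm (dir_series (\<lambda>_. 1) (Complex \<sigma> 0)) ^ 3 * norm (dir_series (\<lambda>_. 1) (Complex \<sigma> t)) ^ 4
      * norm (dir_series (\<lambda>_. 1) (Complex \<sigma> (2 * t)))"
proof -
  define T where "T = (\<lambda>u N. dir_series (\<lambda>_. 1) (Complex \<sigma> u) * (\<Prod>p | prime p \<and> p \<le> N. 1 - of_nat p powr (- Complex \<sigma> u)))"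
  let ?Z = "\<lambda>u. norm (dir_series (\<lambda>_. 1) (Complex \<sigma> u))"
  have "(\<lambda>N. norm (T 0 N) ^ 3 * norm (T t N) ^ 4 * norm (T (2 * t) N)) \<longlonglongrightarrow> norm (1::complex) ^ 3 * norm (1::complex) ^ 4 * norm (1::complex)"
    unfolding T_def using \<sigma> by (intro tendsto_intros euler_product_tendsto) auto
  moreover have "norm (T 0 N) ^ 3 * norm (T t N) ^ 4 * norm (T (2 * t) N) \<le> ?Z 0 ^ 3 * ?Z t ^ 4 * ?Z (2 * t)" for N
  proof -
    define P where "P = {p. prime p \<and> p \<le> N}"
    let ?e = "\<lambda>p u. norm (1 - of_nat p powr (- Complex \<sigma> u))"
    have "?e p 0 ^ 3 * ?e p t ^ 4 * ?e p (2 * t) \<le> 1" if "p \<in> P" for p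
    proof -
      have p: "1 < p" using that prime_gt_1_nat by (auto simp: P_def)
      \<comment> \<open>The power of \<open>p\<close> splits into its modulus \<open>r\<close> and a
        number of modulus 1: this is \<open>w\<close> at height \<open>t\<close> and
        \<open>w\<^sup>2\<close> at height \<open>2 * t\<close>.\<close>
      define r w where "r = real p powr (-\<sigma>)" and "w = of_nat p powr (- \<i> * of_real t)"
      have "r < 1" using p \<sigma> by (simp add: r_def powr_less_one)
      moreover have "norm w = 1" using p by (simp add: w_def norm_nat_powr)
      moreover have "of_nat p powr (- Complex \<sigma> u) = of_real r * of_nat p powr (- \<i> * of_real u)" for u
      proof -
        have "of_nat p powr (- Complex \<sigma> u) = (of_nat p powr (of_real (-\<sigma>) + (- \<i> * of_real u)) :: complex)"
          by (simp add: Complex_eq)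
        also have "\<dots> = of_nat p powr (of_real (-\<sigma>)) * of_nat p powr (- \<i> * of_real u)" by (rule powr_add)
        also have "of_nat p powr (of_real (-\<sigma>)) = (of_real r :: complex)"
          using powr_of_real[of "real p" "-\<sigma>"] by (simp add: r_def)
        finally show ?thesis .
      qed
      moreover have "of_nat p powr (- \<i> * of_real (2 * t)) = w\<^sup>2"
        by (simp add: w_def power2_eq_square mult.left_commute flip: powr_add)
      ultimately show ?thesis using euler_factor_341[of r w] p by (simp add: w_def r_def)
    qed
    then have "(\<Prod>p\<in>P. ?e p 0 ^ 3 * ?e p t ^ 4 * ?e p (2 * t)) \<le> (\<Prod>p\<in>P. 1)"
      by (intro prod_mono) auto
    then have "(\<Prod>p\<in>P. ?e p 0) ^ 3 * (\<Prod>p\<in>P. ?e p t) ^ 4 * (\<Prod>p\<in>P. ?e p (2 * t)) \<le> 1"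
      by (simp add: prod.distrib prod_power_distrib)
    then have "(?Z 0 ^ 3 * ?Z t ^ 4 * ?Z (2 * t)) * ((\<Prod>p\<in>P. ?e p 0) ^ 3 * (\<Prod>p\<in>P. ?e p t) ^ 4 * (\<Prod>p\<in>P. ?e p (2 * t)))
      \<le> (?Z 0 ^ 3 * ?Z t ^ 4 * ?Z (2 * t)) * 1"
      by (intro mult_left_mono) auto
    then show ?thesis
      by (simp add: T_def norm_mult prod_norm[symmetric] power_mult_distrib P_def algebra_simps)
  qed
  ultimately show ?thesis by (intro LIMSEQ_le_const2) auto
qed

section \<open>Continuation and growth of \<open>(s - 1) \<zeta>(s)\<close>\<close>

text \<open>This is (s - 1) times the difference between \<open>of_nat n powr (-s)\<close> and the
  integral of x^(-s) over [n, n + 1]. With the integral evaluated, s - 1 cancels its denominator, so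
  \<open>s = 1\<close> needs no separate case.\<close>

definition zeta_term :: "nat \<Rightarrow> complex \<Rightarrow> complex" where
  "zeta_term n s = (s - 1) * of_nat n powr (-s) + (of_nat (Suc n) powr (1 - s) - of_nat n powr (1 - s))"

text \<open>The continuation of (s - 1) zeta(s). The leading 1 is (s - 1) times the integral of
  x^(-s) over [1, \<infinity>), which the terms subtract piece by piece; the factor s - 1 removes
  the pole. \<open>Suc n\<close> keeps the sum off \<open>n = 0\<close>.\<close>

definition zetaF :: "complex \<Rightarrow> complex" where
  "zetaF s = 1 + (\<Sum>n. zeta_term (Suc n) s)"

lemma norm_diff_le_real_segment:
  fixes f f' :: "complex \<Rightarrow> complex"
  assumes "a \<le> b"
    and "\<And>x. a \<le> x \<Longrightarrow> x \<le> b \<Longrightarrow> (f has_field_derivative f' (of_real x)) (at (of_real x))"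
    and "\<And>x. a \<le> x \<Longrightarrow> x \<le> b \<Longrightarrow> norm (f' (of_real x)) \<le> B"
  shows "norm (f (of_real b) - f (of_real a)) \<le> B * (b - a)"
proof -
  have "convex (of_real ` {a..b} :: complex set)"
    by (intro convex_linear_image bounded_linear.linear bounded_linear_of_real) auto
  then have "norm (f (of_real b) - f (of_real a)) \<le> B * norm (of_real b - of_real a :: complex)"
    by (rule field_differentiable_bound[where f' = f'])
       (use assms in \<open>auto intro: has_field_derivative_at_within\<close>)
  also have "norm (of_real b - of_real a :: complex) = b - a"
    using assms(1) by (simp flip: of_real_diff)
  finally show ?thesis .
qed

lemma norm_of_real_powr: "0 \<le> x \<Longrightarrow> norm (of_real x powr s :: complex) = x powr (Re s)"
  by (subst norm_powr_real_powr) auto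

lemma has_field_derivative_powr_base:
  assumes "0 < x"
  shows "((\<lambda>z. z powr s) has_field_derivative s * of_real x powr (s - 1)) (at (of_real x :: complex))"
  by (rule has_field_derivative_powr) (use assms in auto)

text \<open>The first estimate is the mean value inequality, better when \<open>n\<close> is large
  compared with \<open>norm s\<close>; the second is the triangle inequality.\<close>

lemma norm_powr_diff_le:
  assumes "0 < Re s" "1 \<le> n" "real n \<le> x" "x \<le> real n + 1"
  shows "norm (of_nat n powr (-s) - of_real x powr (-s) :: complex) \<le> norm s * real n powr (- Re s - 1)"
    "norm (of_nat n powr (-s) - of_real x powr (-s) :: complex) \<le> 2 * real n powr (- Re s)"
proof -
  have "norm (of_real x powr (-s) - of_real (real n) powr (-s) :: complex) \<le> norm s * real n powr (- Re s - 1) * (x - real n)"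
  proof (rule norm_diff_le_real_segment[where f' = "\<lambda>z. -s * z powr (-s - 1)"])
    fix y assume y: "real n \<le> y" "y \<le> x"
    show "((\<lambda>z. z powr (-s)) has_field_derivative -s * of_real y powr (-s - 1)) (at (of_real y))"
      by (rule has_field_derivative_powr_base) (use y assms in auto)
    have "y powr (- Re s - 1) \<le> real n powr (- Re s - 1)"
      using y assms by (intro powr_mono2') auto
    then show "norm (- s * of_real y powr (- s - 1)) \<le> norm s * real n powr (- Re s - 1)"
      using y assms by (simp add: norm_mult norm_of_real_powr mult_left_mono)
  qed (use assms in auto)
  also have "\<dots> \<le> norm s * real n powr (- Re s - 1) * 1" using assms by (intro mult_left_mono) auto
  finally show "norm (of_nat n powr (-s) - of_real x powr (-s) :: complex) \<le> norm s * real n powr (- Re s - 1)"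
    by (simp add: norm_minus_commute)
  have "norm (of_nat n powr (-s) - of_real x powr (-s) :: complex) \<le> real n powr (- Re s) + x powr (- Re s)"
    using norm_triangle_ineq4[of "of_nat n powr (-s)" "of_real x powr (-s)"] assms
    by (simp add: norm_nat_powr norm_of_real_powr)
  also have "x powr (- Re s) \<le> real n powr (- Re s)" using assms by (intro powr_mono2') auto
  finally show "norm (of_nat n powr (-s) - of_real x powr (-s) :: complex) \<le> 2 * real n powr (- Re s)" by simp
qed

text \<open>\<open>zeta_term n s\<close> is the increment over [n, n + 1] of the function
  \<open>f\<close> in the proof, whose derivative is
  \<open>(s - 1) * (of_nat n powr (-s) - z powr (-s))\<close>; the mean value inequality then avoids
  any integral.\<close>

lemma norm_zeta_term_le_aux:
  assumes "1 \<le> n" and B: "\<And>x. real n \<le> x \<Longrightarrow> x \<le> real n + 1 \<Longrightarrow> norm (of_nat n powr (-s) - of_real x powr (-s) :: complex) \<le> B"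
  shows "norm (zeta_term n s) \<le> norm (s - 1) * B"
proof -
  define f where "f = (\<lambda>z. (s - 1) * ((z - of_nat n) * of_nat n powr (-s)) + z powr (1 - s))"
  have "norm (f (of_real (real n + 1)) - f (of_real (real n))) \<le> norm (s - 1) * B * (real n + 1 - real n)"
  proof (rule norm_diff_le_real_segment[where f' = "\<lambda>z. (s - 1) * (of_nat n powr (-s) - z powr (-s))"])
    fix x assume x: "real n \<le> x" "x \<le> real n + 1"
    then have x0: "0 < x" using assms(1) by simp
    then have "((\<lambda>z. z powr (1 - s)) has_field_derivative (1 - s) * of_real x powr (-s)) (at (of_real x))"
      using has_field_derivative_powr_base[of x "1 - s"] by simp
    with x0 show "(f has_field_derivative (s - 1) * (of_nat n powr (-s) - of_real x powr (-s))) (at (of_real x))"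
      unfolding f_def by (auto intro!: derivative_eq_intros simp: algebra_simps)
    show "norm ((s - 1) * (of_nat n powr (-s) - of_real x powr (-s))) \<le> norm (s - 1) * B"
      unfolding norm_mult by (intro mult_left_mono B x) auto
  qed auto
  also have "f (of_real (real n + 1)) - f (of_real (real n)) = zeta_term n s"
    by (simp add: f_def zeta_term_def add.commute)
  finally show ?thesis by simp
qed

text \<open>Using whichever of the two bounds in \<open>norm_powr_diff_le\<close> is smaller gains a convergent
  series at the cost of only a small power of \<open>s\<close>.\<close>
lemma norm_zeta_term_le:
  assumes s: "95/96 \<le> Re s" and n: "1 \<le> n"
  shows "norm (zeta_term n s) \<le> 2 * norm (s - 1) * norm s powr (1/48) * real n powr (- 97/96)"
proof -
  have ns: "0 < norm s" using s by auto
  \<comment> \<open>Relative to \<open>real n powr (- Re s)\<close>, and with u =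
    \<open>norm s / real n\<close>, the two bounds are u and 2; the first is at most 2 u^(1/48) when
    u \<le> 1, the second when u > 1.\<close>
  have B: "norm (of_nat n powr (-s) - of_real x powr (-s) :: complex) \<le> 2 * (norm s / real n) powr (1/48) * real n powr (- Re s)"
    if "real n \<le> x" "x \<le> real n + 1" for x
  proof (cases "norm s \<le> real n")
    case True
    have "norm (of_nat n powr (-s) - of_real x powr (-s) :: complex) \<le> norm s * real n powr (- Re s - 1)"
      by (rule norm_powr_diff_le) (use that s n in auto)
    also have "\<dots> = (norm s / real n) powr 1 * real n powr (- Re s)"
      using n ns by (simp add: powr_diff field_simps)
    also have "\<dots> \<le> 2 * (norm s / real n) powr (1/48) * real n powr (- Re s)"
    proof (rule mult_right_mono)
      have "(norm s / real n) powr 1 \<le> (norm s / real n) powr (1/48)"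
        using True n ns by (intro powr_mono') (auto simp: divide_le_eq_1)
      then show "(norm s / real n) powr 1 \<le> 2 * (norm s / real n) powr (1/48)"
        using powr_ge_zero[of "norm s / real n" "1/48"] by linarith
    qed auto
    finally show ?thesis .
  next
    case False
    have "norm (of_nat n powr (-s) - of_real x powr (-s) :: complex) \<le> 2 * real n powr (- Re s)"
      by (rule norm_powr_diff_le) (use that s n in auto)
    also have "\<dots> \<le> 2 * (norm s / real n) powr (1/48) * real n powr (- Re s)"
      using False n by (intro mult_right_mono) (auto simp: field_simps intro!: ge_one_powr_ge_zero)
    finally show ?thesis .
  qed
  have "norm (zeta_term n s) \<le> norm (s - 1) * (2 * (norm s / real n) powr (1/48) * real n powr (- Re s))"
    by (rule norm_zeta_term_le_aux[OF n B])
  also have "(norm s / real n) powr (1/48) = norm s powr (1/48) * real n powr (-1/48)"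
    using n ns by (simp add: powr_divide powr_minus_divide)
  also have "norm (s - 1) * (2 * (norm s powr (1/48) * real n powr (-1/48)) * real n powr (- Re s))
    = 2 * norm (s - 1) * norm s powr (1/48) * (real n powr (-1/48) * real n powr (- Re s))" by simp
  also have "real n powr (-1/48) * real n powr (- Re s) = real n powr (-1/48 - Re s)"
    by (simp flip: powr_add)
  \<comment> \<open>95/96 + 1/48 = 97/96 exceeds 1: the abscissa may lie left of 1 by half of the
    exponent gained.\<close>
  also have "2 * norm (s - 1) * norm s powr (1/48) * real n powr (-1/48 - Re s)
    \<le> 2 * norm (s - 1) * norm s powr (1/48) * real n powr (- 97/96)"
    using n s by (intro mult_left_mono powr_mono) auto
  finally show ?thesis .
qed

lemma summable_Suc_powr: "summable (\<lambda>n. real (Suc n) powr (- 97/96))"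
  using summable_Suc_iff[of "\<lambda>n. real n powr (- 97/96)"] by (simp add: summable_real_powr_iff)

lemma holomorphic_zetaF: "zetaF holomorphic_on {s. 95/96 < Re s}"
proof -
  let ?S = "{s::complex. 95/96 < Re s}"
  define f' where "f' = (\<lambda>n. deriv (zeta_term (Suc n)))"
  have hol: "zeta_term (Suc n) holomorphic_on UNIV" for n
    unfolding zeta_term_def by (intro holomorphic_intros)
  have "\<exists>g g'. \<forall>s\<in>?S. (\<lambda>n. zeta_term (Suc n) s) sums g s \<and> (\<lambda>n. f' n s) sums g' s \<and> (g has_field_derivative g' s) (at s)"
  proof (rule series_and_derivative_comparison_local)
    show "(zeta_term (Suc n) has_field_derivative f' n x) (at x)" for n x
      unfolding f'_def using holomorphic_derivI[OF hol open_UNIV, of x n] by simp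
    fix s :: complex assume s: "s \<in> ?S"
    have "norm (zeta_term (Suc n) z) \<le> 2 * (norm s + 2) * (norm s + 1) powr (1/48) * real (Suc n) powr (- 97/96)"
      if "z \<in> ball s 1 \<inter> ?S" for n z
    proof -
      have z: "norm z \<le> norm s + 1"
        using that norm_triangle_ineq2[of z s] by (simp add: dist_norm norm_minus_commute)
      then have z1: "norm (z - 1) \<le> norm s + 2" using norm_triangle_ineq4[of z 1] by simp
      have "norm (zeta_term (Suc n) z) \<le> 2 * norm (z - 1) * norm z powr (1/48) * real (Suc n) powr (- 97/96)"
        by (rule norm_zeta_term_le) (use that in auto)
      also have "\<dots> \<le> 2 * (norm s + 2) * (norm s + 1) powr (1/48) * real (Suc n) powr (- 97/96)"
        by (intro mult_right_mono mult_mono powr_mono2 z z1) auto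
      finally show ?thesis .
    qed
    then show "\<exists>d h. 0 < d \<and> summable h \<and> (\<forall>\<^sub>F n in sequentially. \<forall>y\<in>ball s d \<inter> ?S. norm (zeta_term (Suc n) y) \<le> h n)"
      by (intro exI[of _ 1] exI[of _ "\<lambda>n. 2 * (norm s + 2) * (norm s + 1) powr (1/48) * real (Suc n) powr (- 97/96)"]
          conjI summable_mult summable_Suc_powr always_eventually) auto
  qed (rule open_halfspace_Re_gt)
  then obtain g g' where g: "\<And>s. s \<in> ?S \<Longrightarrow> (\<lambda>n. zeta_term (Suc n) s) sums g s"
    "\<And>s. s \<in> ?S \<Longrightarrow> (g has_field_derivative g' s) (at s)" by auto
  have "g holomorphic_on ?S"
    unfolding holomorphic_on_open[OF open_halfspace_Re_gt] using g(2) by blast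
  then have "(\<lambda>s. 1 + g s) holomorphic_on ?S" by (intro holomorphic_intros)
  then show ?thesis
    by (rule holomorphic_transform) (use g(1) in \<open>auto simp: zetaF_def sums_iff\<close>)
qed

text \<open>The bracketed part of \<open>zeta_term\<close> telescopes to
  \<open>of_nat (Suc N) powr (1 - s) - 1\<close>; the power tends to 0 and the -1 cancels the
  leading 1 of \<open>zetaF\<close>.\<close>

lemma zetaF_eq:
  assumes s: "1 < Re s"
  shows "zetaF s = (s - 1) * dir_series (\<lambda>_. 1) s"
proof -
  have A: "(\<Sum>n<N. zeta_term (Suc n) s) = (s - 1) * (\<Sum>n<Suc N. of_real 1 * of_nat n powr (-s)) + (of_nat (Suc N) powr (1 - s) - 1)" for N
    by (induction N) (simp_all add: zeta_term_def algebra_simps)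
  have B: "(\<lambda>N. of_nat (Suc N) powr (1 - s) :: complex) \<longlonglongrightarrow> 0"
  proof (rule tendsto_norm_zero_cancel)
    have "(\<lambda>N. real (Suc N) powr (1 - Re s)) \<longlonglongrightarrow> 0"
      using s by (intro tendsto_neg_powr filterlim_compose[OF filterlim_real_sequentially filterlim_Suc]) auto
    then show "(\<lambda>N. norm (of_nat (Suc N) powr (1 - s) :: complex)) \<longlonglongrightarrow> 0"
      unfolding norm_nat_powr by simp
  qed
  have D: "(\<lambda>N. \<Sum>n<Suc N. of_real 1 * of_nat n powr (-s)) \<longlonglongrightarrow> dir_series (\<lambda>_. 1) s"
    using dir_series_sums[OF dir_summable_1 s] unfolding sums_def by (rule LIMSEQ_Suc)
  have "(\<lambda>N. \<Sum>n<N. zeta_term (Suc n) s) \<longlonglongrightarrow> (s - 1) * dir_series (\<lambda>_. 1) s + (0 - 1)"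
    unfolding A by (intro tendsto_intros B D)
  then have "(\<lambda>n. zeta_term (Suc n) s) sums ((s - 1) * dir_series (\<lambda>_. 1) s - 1)" by (simp add: sums_def)
  then show ?thesis by (simp add: zetaF_def sums_iff)
qed

lemma zetaF_1: "zetaF 1 = 1"
  by (simp add: zetaF_def zeta_term_def del: of_nat_Suc)

text \<open>The exponent is 1 from the factor s - 1 plus the 1/48 paid in
  \<open>norm_zeta_term_le\<close>.\<close>

lemma zetaF_bound:
  obtains C where "0 < C" "\<And>s. 95/96 \<le> Re s \<Longrightarrow> Re s \<le> 3 \<Longrightarrow> norm (zetaF s) \<le> C * (1 + \<bar>Im s\<bar>) powr (49/48)"
proof -
  define Z where "Z = (\<Sum>n. real (Suc n) powr (- 97/96))"
  have Z: "0 \<le> Z" unfolding Z_def by (intro suminf_nonneg summable_Suc_powr) auto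
  have "norm (zetaF s) \<le> (1 + 12 * Z) * (1 + \<bar>Im s\<bar>) powr (49/48)" if s: "95/96 \<le> Re s" "Re s \<le> 3" for s
  proof -
    let ?t = "1 + \<bar>Im s\<bar>"
    have t: "1 \<le> ?t powr (49/48)" by (intro ge_one_powr_ge_zero) auto
    have n1: "norm s \<le> 3 * ?t" using cmod_le[of s] s by simp
    have n2: "norm (s - 1) \<le> 2 * ?t" using cmod_le[of "s - 1"] s by simp
    have "norm (\<Sum>n. zeta_term (Suc n) s) \<le> (\<Sum>n. 2 * norm (s - 1) * norm s powr (1/48) * real (Suc n) powr (- 97/96))"
      by (intro norm_suminf_le norm_zeta_term_le summable_mult summable_Suc_powr) (use s in auto)
    also have "\<dots> = 2 * norm (s - 1) * norm s powr (1/48) * Z"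
      unfolding Z_def by (intro suminf_mult summable_Suc_powr)
    also have "\<dots> \<le> 2 * (2 * ?t) * (3 * ?t) powr (1/48) * Z"
      by (intro mult_right_mono mult_mono powr_mono2 n1 n2 Z) simp_all
    also have "(3 * ?t) powr (1/48) = 3 powr (1/48) * ?t powr (1/48)" by (intro powr_mult)
    also have "(3::real) powr (1/48) \<le> 3 powr 1" by (intro powr_mono) auto
    also have "2 * (2 * ?t) * (3 powr 1 * ?t powr (1/48)) * Z = 12 * Z * (?t powr 1 * ?t powr (1/48))" by simp
    also have "?t powr 1 * ?t powr (1/48) = ?t powr (49/48)" by (subst powr_add[symmetric]) simp
    finally have "norm (\<Sum>n. zeta_term (Suc n) s) \<le> 12 * Z * ?t powr (49/48)"
      using Z by (simp add: mult_left_mono mult_right_mono)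
    then show ?thesis unfolding zetaF_def using norm_triangle_ineq[of 1 "\<Sum>n. zeta_term (Suc n) s"] t
      by (simp add: distrib_right)
  qed
  then show ?thesis using Z by (intro that[of "1 + 12 * Z"]) auto
qed

text \<open>Cauchy's estimate on circles of radius 1/192, half the distance from 95/96 to 1, along
  which \<open>1 + \<bar>Im z\<bar>\<close> at most doubles. The bound on \<open>f\<close> starts at
  191/192 rather than 95/96 because for \<open>zetaH\<close> it rests on compactness, which requires
  a closed region inside the domain of holomorphy.\<close>

lemma deriv_bound_strip:
  fixes f :: "complex \<Rightarrow> complex"
  assumes hol: "f holomorphic_on {s. 95/96 < Re s}" and a: "0 \<le> a" and C: "0 \<le> C"
    and bound: "\<And>s. 191/192 \<le> Re s \<Longrightarrow> Re s \<le> 3 \<Longrightarrow> norm (f s) \<le> C * (1 + \<bar>Im s\<bar>) powr a"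
    and s: "1 \<le> Re s" "Re s \<le> 2"
  shows "norm ((deriv ^^ k) f s) \<le> fact k * C * 2 powr a * 192 ^ k * (1 + \<bar>Im s\<bar>) powr a"
proof -
  have sub: "cball s (1/192) \<subseteq> {z. 191/192 \<le> Re z \<and> Re z \<le> 3 \<and> 1 + \<bar>Im z\<bar> \<le> 2 * (1 + \<bar>Im s\<bar>)}"
  proof
    fix z assume "z \<in> cball s (1/192)"
    then have "norm (s - z) \<le> 1/192" by (simp add: dist_norm)
    with abs_Re_le_cmod[of "s - z"] abs_Im_le_cmod[of "s - z"]
    have "\<bar>Re s - Re z\<bar> \<le> 1/192" "\<bar>Im s - Im z\<bar> \<le> 1/192" by auto
    moreover have "\<bar>Im z\<bar> \<le> \<bar>Im s\<bar> + \<bar>Im s - Im z\<bar>"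
      using abs_triangle_ineq[of "Im s" "Im z - Im s"] by (simp add: abs_minus_commute)
    moreover have "a \<le> b + d \<Longrightarrow> d \<le> 1/192 \<Longrightarrow> 0 \<le> b \<Longrightarrow> 1 + a \<le> 2 * (1 + b)" for a b d :: real
      by simp
    ultimately have "191/192 \<le> Re z" "Re z \<le> 3" "1 + \<bar>Im z\<bar> \<le> 2 * (1 + \<bar>Im s\<bar>)"
      using s abs_ge_zero[of "Im s"] by (linarith, linarith, blast)
    then show "z \<in> {z. 191/192 \<le> Re z \<and> Re z \<le> 3 \<and> 1 + \<bar>Im z\<bar> \<le> 2 * (1 + \<bar>Im s\<bar>)}" by simp
  qed
  have hol': "f holomorphic_on cball s (1/192)"
    by (rule holomorphic_on_subset[OF hol]) (use sub in force)
  have "norm ((deriv ^^ k) f s) \<le> fact k * (C * (2 * (1 + \<bar>Im s\<bar>)) powr a) / (1/192) ^ k"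
  proof (rule Cauchy_inequality)
    show "f holomorphic_on ball s (1/192)" using hol' holomorphic_on_subset ball_subset_cball by blast
    show "continuous_on (cball s (1/192)) f" using hol' by (rule holomorphic_on_imp_continuous_on)
    fix z assume "norm (s - z) = 1/192"
    then have z: "191/192 \<le> Re z" "Re z \<le> 3" "1 + \<bar>Im z\<bar> \<le> 2 * (1 + \<bar>Im s\<bar>)"
      using sub by (auto simp: subset_iff dist_norm)
    have "norm (f z) \<le> C * (1 + \<bar>Im z\<bar>) powr a" by (rule bound[OF z(1,2)])
    also have "\<dots> \<le> C * (2 * (1 + \<bar>Im s\<bar>)) powr a" using z a C by (intro mult_left_mono powr_mono2) auto
    finally show "norm (f z) \<le> C * (2 * (1 + \<bar>Im s\<bar>)) powr a" .
  qed auto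
  also have "\<dots> = fact k * C * 2 powr a * 192 ^ k * (1 + \<bar>Im s\<bar>) powr a"
    unfolding powr_mult[of 2] by (simp add: power_one_over)
  finally show ?thesis .
qed

lemma zetaF_deriv_bound:
  obtains C where "0 < C" "\<And>s. 1 \<le> Re s \<Longrightarrow> Re s \<le> 2 \<Longrightarrow> norm ((deriv ^^ k) zetaF s) \<le> C * (1 + \<bar>Im s\<bar>) powr (49/48)"
proof -
  obtain C where C: "0 < C" "\<And>s. 95/96 \<le> Re s \<Longrightarrow> Re s \<le> 3 \<Longrightarrow> norm (zetaF s) \<le> C * (1 + \<bar>Im s\<bar>) powr (49/48)"
    using zetaF_bound by blast
  show ?thesis
    by (rule that[OF _ deriv_bound_strip[OF holomorphic_zetaF, of "49/48" C]]) (use C in auto)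
qed

section \<open>Non-vanishing and lower bounds for \<open>zetaF\<close> up to the line
  \<open>Re s = 1\<close>\<close>

lemma zetaF_nonzero_right:
  assumes "1 < Re s"
  shows "zetaF s \<noteq> 0"
proof -
  have "dir_series (\<lambda>_. 1) s \<noteq> 0"
    using euler_product_tendsto[OF assms] LIMSEQ_unique[OF _ tendsto_const] by force
  then show ?thesis using assms by (auto simp: zetaF_eq[OF assms])
qed

text \<open>\<open>zeta_341\<close> multiplied through by the factors s - 1: their moduli are
  \<open>\<sigma> - 1\<close> three times, at least \<open>\<bar>t\<bar>\<close> four times, and at
  least \<open>\<bar>2 * t\<bar>\<close>, of which \<open>\<bar>t\<bar>\<close> is kept,
  once.\<close>

lemma zetaF_341:
  assumes \<sigma>: "1 < \<sigma>"
  shows "(\<sigma> - 1) ^ 3 * \<bar>t\<bar> ^ 5 \<le> norm (zetaF (Complex \<sigma> 0)) ^ 3 * norm (zetaF (Complex \<sigma> t)) ^ 4 * norm (zetaF (Complex \<sigma> (2 * t)))"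
proof -
  let ?Z = "\<lambda>u. norm (dir_series (\<lambda>_. 1) (Complex \<sigma> u))"
  have Z: "norm (zetaF (Complex \<sigma> u)) = norm (Complex \<sigma> u - 1) * ?Z u" for u
    by (subst zetaF_eq) (use \<sigma> in \<open>auto simp: norm_mult\<close>)
  have i: "\<bar>u\<bar> \<le> norm (Complex \<sigma> u - 1)" for u using abs_Im_le_cmod[of "Complex \<sigma> u - 1"] by simp
  have r: "\<sigma> - 1 \<le> norm (Complex \<sigma> u - 1)" for u using abs_Re_le_cmod[of "Complex \<sigma> u - 1"] \<sigma> by simp
  have "(\<sigma> - 1) ^ 3 * \<bar>t\<bar> ^ 5 = (\<sigma> - 1) ^ 3 * \<bar>t\<bar> ^ 4 * \<bar>t\<bar>" by (simp add: power_eq_if)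
  also have "\<dots> \<le> norm (Complex \<sigma> 0 - 1) ^ 3 * norm (Complex \<sigma> t - 1) ^ 4 * norm (Complex \<sigma> (2 * t) - 1)"
    using r[of 0] i[of t] i[of "2 * t"] \<sigma> by (intro mult_mono power_mono) auto
  also have "\<dots> \<le> \<dots> * (?Z 0 ^ 3 * ?Z t ^ 4 * ?Z (2 * t))"
    using mult_left_mono[OF zeta_341[OF \<sigma>, of t], of "norm (Complex \<sigma> 0 - 1) ^ 3 * norm (Complex \<sigma> t - 1) ^ 4 * norm (Complex \<sigma> (2 * t) - 1)"] by simp
  also have "\<dots> = norm (zetaF (Complex \<sigma> 0)) ^ 3 * norm (zetaF (Complex \<sigma> t)) ^ 4 * norm (zetaF (Complex \<sigma> (2 * t)))"
    by (simp add: Z power_mult_distrib)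
  finally show ?thesis .
qed

text \<open>The 3-4-1 inequality bounds \<open>zetaF\<close> from below at distance \<open>\<kappa> \<tau> powr (-1/6)\<close> to the right of
  the line \<open>Re s = 1\<close>, \<open>\<tau> = 1 + \<bar>Im s\<bar>\<close>; the derivative bound carries this over to the line itself.\<close>
lemma zetaF_lower_bound_away:
  assumes t0: "0 < t0"
  obtains c where "0 < c" "\<And>s. 1 \<le> Re s \<Longrightarrow> Re s \<le> 2 \<Longrightarrow> t0 \<le> \<bar>Im s\<bar> \<Longrightarrow> c * (1 + \<bar>Im s\<bar>) powr (41/48) \<le> norm (zetaF s)"
proof -
  obtain C where C: "0 < C" "\<And>s. 95/96 \<le> Re s \<Longrightarrow> Re s \<le> 3 \<Longrightarrow> norm (zetaF s) \<le> C * (1 + \<bar>Im s\<bar>) powr (49/48)"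
    using zetaF_bound by blast
  obtain D where D: "0 < D" "\<And>s. 1 \<le> Re s \<Longrightarrow> Re s \<le> 2 \<Longrightarrow> norm ((deriv ^^ 1) zetaF s) \<le> D * (1 + \<bar>Im s\<bar>) powr (49/48)"
    using zetaF_deriv_bound by blast
  \<comment> \<open>For \<open>\<bar>t\<bar> \<ge> t0\<close> this gives
    \<open>c0 * (1 + \<bar>t\<bar>) \<le> \<bar>t\<bar>\<close>, which trades
    \<open>\<bar>t\<bar> ^ 5\<close> for a power of \<open>1 + \<bar>t\<bar>\<close>.\<close>
  define c0 where "c0 = t0 / (1 + t0)"
  define a where "a = c0 ^ 5 / (C ^ 3 * (4 * C))"
  \<comment> \<open>Small enough that the fourth root of \<open>a * \<kappa> ^ 3\<close>, supplied
    by the 3-4-1 inequality, is at least \<open>2 * D * \<kappa>\<close>: twice the change that the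
    derivative bound allows on the way to the line.\<close>
  define \<kappa> where "\<kappa> = min 1 (a / (2 * D) ^ 4)"
  have c0: "0 < c0" using t0 by (simp add: c0_def)
  have a: "0 < a" using c0 C by (simp add: a_def)
  have \<kappa>: "0 < \<kappa>" "\<kappa> \<le> 1" using a D by (auto simp: \<kappa>_def)
  have "\<kappa> * (2 * D) ^ 4 \<le> a" using D by (simp add: \<kappa>_def min_def field_simps)
  then have a\<kappa>: "(2 * D * \<kappa>) ^ 4 \<le> a * \<kappa> ^ 3"
    using \<kappa> mult_right_mono[of "\<kappa> * (2 * D) ^ 4" a "\<kappa> ^ 3"] by (simp add: power_mult_distrib power_eq_if algebra_simps)
  have far: "2 * D * \<kappa> * (1 + \<bar>t\<bar>) powr (41/48) \<le> norm (zetaF (Complex \<sigma> t))"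
    if t: "t0 \<le> \<bar>t\<bar>" and \<sigma>: "\<sigma> \<le> 2" "1 + \<kappa> * (1 + \<bar>t\<bar>) powr (-1/6) \<le> \<sigma>" for \<sigma> t
  proof -
    let ?\<tau> = "1 + \<bar>t\<bar>"
    have \<tau>1: "1 \<le> ?\<tau>" by simp
    have "0 < ?\<tau> powr (-1/6)" by (subst powr_gt_zero) linarith
    from mult_pos_pos[OF \<kappa>(1) this] have \<sigma>1: "1 < \<sigma>" using \<sigma>(2) by linarith
    have c0t: "c0 * ?\<tau> \<le> \<bar>t\<bar>"
    proof -
      have "t0 * ?\<tau> \<le> \<bar>t\<bar> * (1 + t0)" using t by (simp add: algebra_simps)
      then show ?thesis using t0 by (simp add: c0_def field_simps)
    qed
    have "norm (zetaF (Complex \<sigma> 0)) \<le> C" using C(2)[of "Complex \<sigma> 0"] \<sigma> \<sigma>1 by simp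
    moreover have "norm (zetaF (Complex \<sigma> (2 * t))) \<le> 4 * C * ?\<tau> powr (49/48)"
    proof -
      have "norm (zetaF (Complex \<sigma> (2 * t))) \<le> C * (1 + \<bar>2 * t\<bar>) powr (49/48)"
        using C(2)[of "Complex \<sigma> (2 * t)"] \<sigma> \<sigma>1 by simp
      also have "\<dots> \<le> C * (2 * ?\<tau>) powr (49/48)" using C by (intro mult_left_mono powr_mono2) auto
      also have "\<dots> = C * 2 powr (49/48) * ?\<tau> powr (49/48)" by (simp only: powr_mult mult.assoc)
      also have "(2::real) powr (49/48) \<le> 2 powr 2" by (intro powr_mono) auto
      then have "C * 2 powr (49/48) * ?\<tau> powr (49/48) \<le> C * 2 powr 2 * ?\<tau> powr (49/48)"
        using C by (intro mult_right_mono mult_left_mono) auto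
      finally show ?thesis by simp
    qed
    ultimately have "norm (zetaF (Complex \<sigma> 0)) ^ 3 * norm (zetaF (Complex \<sigma> t)) ^ 4 * norm (zetaF (Complex \<sigma> (2 * t)))
      \<le> C ^ 3 * norm (zetaF (Complex \<sigma> t)) ^ 4 * (4 * C * ?\<tau> powr (49/48))"
      using C by (intro mult_mono power_mono) auto
    with zetaF_341[OF \<sigma>1, of t]
    have "(\<sigma> - 1) ^ 3 * \<bar>t\<bar> ^ 5 \<le> C ^ 3 * norm (zetaF (Complex \<sigma> t)) ^ 4 * (4 * C * ?\<tau> powr (49/48))" by simp
    moreover have "(\<kappa> * ?\<tau> powr (-1/6)) ^ 3 * (c0 * ?\<tau>) ^ 5 \<le> (\<sigma> - 1) ^ 3 * \<bar>t\<bar> ^ 5"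
      using \<sigma> \<sigma>1 \<kappa> c0 c0t by (intro mult_mono power_mono) auto
    ultimately have "(\<kappa> * ?\<tau> powr (-1/6)) ^ 3 * (c0 * ?\<tau>) ^ 5 \<le> (C ^ 3 * (4 * C)) * (norm (zetaF (Complex \<sigma> t)) ^ 4 * ?\<tau> powr (49/48))"
      by (simp add: mult_ac)
    then have "a * \<kappa> ^ 3 * ((?\<tau> powr (-1/6)) ^ 3 * ?\<tau> ^ 5) \<le> norm (zetaF (Complex \<sigma> t)) ^ 4 * ?\<tau> powr (49/48)"
    proof -
      define K where "K = C ^ 3 * (4 * C)"
      have K: "0 < K" using C by (simp add: K_def)
      assume "(\<kappa> * ?\<tau> powr (-1/6)) ^ 3 * (c0 * ?\<tau>) ^ 5 \<le> (C ^ 3 * (4 * C)) * (norm (zetaF (Complex \<sigma> t)) ^ 4 * ?\<tau> powr (49/48))"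
      moreover have "(\<kappa> * ?\<tau> powr (-1/6)) ^ 3 * (c0 * ?\<tau>) ^ 5 = c0 ^ 5 * \<kappa> ^ 3 * ((?\<tau> powr (-1/6)) ^ 3 * ?\<tau> ^ 5)"
        by (simp only: power_mult_distrib mult_ac)
      ultimately have "c0 ^ 5 * \<kappa> ^ 3 * ((?\<tau> powr (-1/6)) ^ 3 * ?\<tau> ^ 5) / K \<le> norm (zetaF (Complex \<sigma> t)) ^ 4 * ?\<tau> powr (49/48)"
        using K by (simp only: pos_divide_le_eq K_def[symmetric] mult.commute[of K])
      then show ?thesis by (simp add: a_def K_def)
    qed
    then have "a * \<kappa> ^ 3 * ((?\<tau> powr (-1/6)) ^ 3 * ?\<tau> ^ 5) * ?\<tau> powr (-49/48) \<le> norm (zetaF (Complex \<sigma> t)) ^ 4 * ?\<tau> powr (49/48) * ?\<tau> powr (-49/48)"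
      by (rule mult_right_mono) auto
    also have "norm (zetaF (Complex \<sigma> t)) ^ 4 * ?\<tau> powr (49/48) * ?\<tau> powr (-49/48) = norm (zetaF (Complex \<sigma> t)) ^ 4"
      using \<tau>1 by (simp add: mult.assoc flip: powr_add)
    \<comment> \<open>Exponents: -3/6 + 5 - 49/48 = 167/48, slightly more than four times
      41/48.\<close>
    also have "a * \<kappa> ^ 3 * ((?\<tau> powr (-1/6)) ^ 3 * ?\<tau> ^ 5) * ?\<tau> powr (-49/48) = a * \<kappa> ^ 3 * ?\<tau> powr (167/48)"
    proof -
      have "(?\<tau> powr (-1/6)) ^ 3 * ?\<tau> ^ 5 * ?\<tau> powr (-49/48) = ?\<tau> powr (-1/2) * ?\<tau> powr 5 * ?\<tau> powr (-49/48)"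
        using \<tau>1 by (simp add: powr_power)
      also have "\<dots> = ?\<tau> powr (167/48)" by (simp only: powr_add[symmetric]) simp
      finally show ?thesis by (simp add: mult.assoc)
    qed
    finally have "a * \<kappa> ^ 3 * ?\<tau> powr (167/48) \<le> norm (zetaF (Complex \<sigma> t)) ^ 4" .
    moreover have "(2 * D * \<kappa> * ?\<tau> powr (41/48)) ^ 4 \<le> a * \<kappa> ^ 3 * ?\<tau> powr (167/48)"
    proof -
      have "(2 * D * \<kappa> * ?\<tau> powr (41/48)) ^ 4 = (2 * D * \<kappa>) ^ 4 * ?\<tau> powr (41/12)"
        unfolding power_mult_distrib[of _ "?\<tau> powr (41/48)"] by (simp add: powr_power)
      also have "\<dots> \<le> a * \<kappa> ^ 3 * ?\<tau> powr (167/48)"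
        using a\<kappa> a \<kappa> by (intro mult_mono powr_mono) auto
      finally show ?thesis .
    qed
    ultimately have "(2 * D * \<kappa> * ?\<tau> powr (41/48)) ^ 4 \<le> norm (zetaF (Complex \<sigma> t)) ^ 4" by simp
    then show ?thesis using power_le_imp_le_base[of _ 3 "norm (zetaF (Complex \<sigma> t))"] by simp
  qed
  have "D * \<kappa> * (1 + \<bar>Im s\<bar>) powr (41/48) \<le> norm (zetaF s)"
    if s: "1 \<le> Re s" "Re s \<le> 2" "t0 \<le> \<bar>Im s\<bar>" for s
  proof (cases "1 + \<kappa> * (1 + \<bar>Im s\<bar>) powr (-1/6) \<le> Re s")
    case True
    have "0 \<le> D * \<kappa> * (1 + \<bar>Im s\<bar>) powr (41/48)" using D \<kappa> by simp
    then show ?thesis using far[of "Im s" "Re s"] s True by simp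
  next
    case False
    \<comment> \<open>Too close to the line, \<open>zetaF s\<close> is compared with the value at
      abscissa \<open>\<sigma>\<close> on the same horizontal; the change has exponent 49/48 - 1/6 =
      41/48, the claimed one.\<close>
    define t where "t = Im s"
    define \<sigma> where "\<sigma> = 1 + \<kappa> * (1 + \<bar>t\<bar>) powr (-1/6)"
    have "1 + \<bar>t\<bar> \<noteq> 0" by linarith
    then have "(1 + \<bar>t\<bar>) powr (-1/6) \<le> 1" using powr_mono[of "-1/6" 0 "1 + \<bar>t\<bar>"] by simp
    then have \<sigma>: "\<sigma> \<le> 2" "Re s \<le> \<sigma>" using \<kappa> False mult_mono[of \<kappa> 1 "(1 + \<bar>t\<bar>) powr (-1/6)" 1]
      by (auto simp: \<sigma>_def t_def)
    have "norm (zetaF (Complex \<sigma> t) - zetaF s) \<le> D * (1 + \<bar>t\<bar>) powr (49/48) * norm (Complex \<sigma> t - s)"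
    proof (rule field_differentiable_bound)
      show "convex (closed_segment s (Complex \<sigma> t))" by simp
      fix z assume "z \<in> closed_segment s (Complex \<sigma> t)"
      then have z: "Im z = t" "Re z \<in> closed_segment (Re s) \<sigma>"
        using closed_segment_same_Im[of s "Complex \<sigma> t"] by (auto simp: t_def)
      then have z1: "1 \<le> Re z" "Re z \<le> 2" using s \<sigma> by (auto simp: closed_segment_eq_real_ivl)
      have "(zetaF has_field_derivative deriv zetaF z) (at z)"
        by (rule holomorphic_derivI[OF holomorphic_zetaF open_halfspace_Re_gt]) (use z1 in auto)
      then show "(zetaF has_field_derivative deriv zetaF z) (at z within closed_segment s (Complex \<sigma> t))"
        by (rule has_field_derivative_at_within)
      show "norm (deriv zetaF z) \<le> D * (1 + \<bar>t\<bar>) powr (49/48)" using D(2)[OF z1] z by simp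
    qed auto
    also have "norm (Complex \<sigma> t - s) = \<sigma> - Re s" using \<sigma> by (simp add: cmod_def t_def)
    also have "D * (1 + \<bar>t\<bar>) powr (49/48) * (\<sigma> - Re s) \<le> D * (1 + \<bar>t\<bar>) powr (49/48) * (\<kappa> * (1 + \<bar>t\<bar>) powr (-1/6))"
      using D s by (intro mult_left_mono) (auto simp: \<sigma>_def)
    also have "\<dots> = D * \<kappa> * ((1 + \<bar>t\<bar>) powr (49/48) * (1 + \<bar>t\<bar>) powr (-1/6))" by simp
    also have "(1 + \<bar>t\<bar>) powr (49/48) * (1 + \<bar>t\<bar>) powr (-1/6) = (1 + \<bar>t\<bar>) powr (41/48)" by (simp flip: powr_add)
    finally have "norm (zetaF (Complex \<sigma> t) - zetaF s) \<le> D * \<kappa> * (1 + \<bar>t\<bar>) powr (41/48)" .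
    moreover have "2 * D * \<kappa> * (1 + \<bar>t\<bar>) powr (41/48) \<le> norm (zetaF (Complex \<sigma> t))"
      using far[of t \<sigma>] s \<sigma> by (simp add: \<sigma>_def t_def)
    ultimately show ?thesis using norm_triangle_ineq2[of "zetaF (Complex \<sigma> t)" "zetaF s"] by (simp add: t_def)
  qed
  then show ?thesis using D \<kappa> by (intro that[of "D * \<kappa>"]) auto
qed

text \<open>The height \<open>t0\<close> in \<open>zetaF_lower_bound_away\<close> is an arbitrary
  positive number, so it may be \<open>\<bar>Im s\<bar>\<close> itself; on the real axis only
  \<open>s = 1\<close> is new, and there the value is 1.\<close>

lemma zetaF_nonzero:
  assumes "1 \<le> Re s" "Re s \<le> 2"
  shows "zetaF s \<noteq> 0"
proof (cases "Im s = 0")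
  case True
  show ?thesis
  proof (cases "Re s = 1")
    case r: True
    have "s = 1" using True r by (simp add: complex_eq_iff)
    then show ?thesis by (simp add: zetaF_1)
  qed (use assms zetaF_nonzero_right in force)
next
  case False
  obtain c where c: "0 < c" "\<And>z. 1 \<le> Re z \<Longrightarrow> Re z \<le> 2 \<Longrightarrow> \<bar>Im s\<bar> \<le> \<bar>Im z\<bar> \<Longrightarrow> c * (1 + \<bar>Im z\<bar>) powr (41/48) \<le> norm (zetaF z)"
    using zetaF_lower_bound_away[of "\<bar>Im s\<bar>"] False by auto
  have "0 < c * (1 + \<bar>Im s\<bar>) powr (41/48)" using c(1) by simp
  also have "\<dots> \<le> norm (zetaF s)" using c(2)[of s] assms by simp
  finally show ?thesis by simp
qed

text \<open>At heights up to 1, non-vanishing on a compact rectangle gives a positive minimum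
  \<open>m\<close>; halving it absorbs
  \<open>(1 + \<bar>Im s\<bar>) powr (41/48) \<le> 2\<close>.\<close>

lemma zetaF_lower_bound:
  obtains c where "0 < c" "\<And>s. 1 \<le> Re s \<Longrightarrow> Re s \<le> 2 \<Longrightarrow> c * (1 + \<bar>Im s\<bar>) powr (41/48) \<le> norm (zetaF s)"
proof -
  obtain c where c: "0 < c" "\<And>s. 1 \<le> Re s \<Longrightarrow> Re s \<le> 2 \<Longrightarrow> 1 \<le> \<bar>Im s\<bar> \<Longrightarrow> c * (1 + \<bar>Im s\<bar>) powr (41/48) \<le> norm (zetaF s)"
    using zetaF_lower_bound_away[of 1] by auto
  let ?K = "cbox (Complex 1 (-1)) (Complex 2 1)"
  have "continuous_on ?K zetaF"
    by (rule continuous_on_subset[OF holomorphic_on_imp_continuous_on[OF holomorphic_zetaF]]) (auto simp: in_cbox_complex_iff)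
  then have "continuous_on ?K (\<lambda>s. norm (zetaF s))" by (intro continuous_intros)
  moreover have "?K \<noteq> {}" by (auto simp: box_ne_empty Basis_complex_def)
  ultimately obtain z where z: "z \<in> ?K" "\<And>s. s \<in> ?K \<Longrightarrow> norm (zetaF z) \<le> norm (zetaF s)"
    using continuous_attains_inf[of ?K "\<lambda>s. norm (zetaF s)"] by auto
  define m where "m = norm (zetaF z)"
  have m: "0 < m" using zetaF_nonzero[of z] z(1) by (simp add: m_def in_cbox_complex_iff)
  have "min c (m / 2) * (1 + \<bar>Im s\<bar>) powr (41/48) \<le> norm (zetaF s)" if s: "1 \<le> Re s" "Re s \<le> 2" for s
  proof (cases "1 \<le> \<bar>Im s\<bar>")
    case True
    have "min c (m / 2) * (1 + \<bar>Im s\<bar>) powr (41/48) \<le> c * (1 + \<bar>Im s\<bar>) powr (41/48)"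
      by (intro mult_right_mono) auto
    with c(2)[OF s True] show ?thesis by simp
  next
    case False
    have "(1 + \<bar>Im s\<bar>) powr (41/48) \<le> (1 + \<bar>Im s\<bar>) powr 1" by (intro powr_mono) auto
    also have "\<dots> \<le> 2" using False by simp
    finally have "min c (m / 2) * (1 + \<bar>Im s\<bar>) powr (41/48) \<le> (m / 2) * 2" using c m by (intro mult_mono) auto
    also have "- 1 \<le> Im s" "Im s \<le> 1" using False by linarith+
    then have "(m / 2) * 2 \<le> norm (zetaF s)" using z(2)[of s] s by (simp add: m_def in_cbox_complex_iff)
    finally show ?thesis .
  qed
  then show ?thesis using c m by (intro that[of "min c (m / 2)"]) auto
qed

section \<open>The logarithmic derivative and the weighted prime sum\<close>

text \<open>This is zeta(s) - 1/(s - 1), since \<open>zetaF 1 = 1\<close>; as a difference quotient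
  of \<open>zetaF\<close> its singularity at 1 is visibly removable.\<close>

definition zetaH :: "complex \<Rightarrow> complex" where
  "zetaH s = (if s = 1 then deriv zetaF 1 else (zetaF s - zetaF 1) / (s - 1))"

lemma holomorphic_zetaH: "zetaH holomorphic_on {s. 95/96 < Re s}"
proof -
  have "1 \<in> interior {s::complex. 95/96 < Re s}"
    by (subst interior_open[OF open_halfspace_Re_gt]) simp
  from pole_lemma[OF holomorphic_zetaF this] show ?thesis by (simp add: zetaH_def[abs_def])
qed

text \<open>Away from the real axis, division by s - 1 takes one unit off the exponent 49/48; near
  it compactness suffices, as \<open>zetaH\<close> has no pole.\<close>

lemma zetaH_bound:
  obtains C where "0 < C" "\<And>s. 191/192 \<le> Re s \<Longrightarrow> Re s \<le> 3 \<Longrightarrow> norm (zetaH s) \<le> C * (1 + \<bar>Im s\<bar>) powr (1/48)"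
proof -
  obtain C where C: "0 < C" "\<And>s. 95/96 \<le> Re s \<Longrightarrow> Re s \<le> 3 \<Longrightarrow> norm (zetaF s) \<le> C * (1 + \<bar>Im s\<bar>) powr (49/48)"
    using zetaF_bound by blast
  let ?K = "cbox (Complex (191/192) (-1)) (Complex 3 1)"
  have "continuous_on ?K zetaH"
    by (rule continuous_on_subset[OF holomorphic_on_imp_continuous_on[OF holomorphic_zetaH]]) (auto simp: in_cbox_complex_iff)
  then have "bounded (zetaH ` ?K)" by (intro compact_imp_bounded compact_continuous_image) auto
  then obtain B where B: "0 < B" "\<And>s. s \<in> ?K \<Longrightarrow> norm (zetaH s) \<le> B" by (auto simp: bounded_pos)
  have "norm (zetaH s) \<le> (B + 2 * (C + 1)) * (1 + \<bar>Im s\<bar>) powr (1/48)" if s: "191/192 \<le> Re s" "Re s \<le> 3" for s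
  proof -
    let ?t = "1 + \<bar>Im s\<bar>"
    have t1: "1 \<le> ?t powr (1/48)" "1 \<le> ?t powr (49/48)" by (intro ge_one_powr_ge_zero; simp)+
    show ?thesis
    proof (cases "\<bar>Im s\<bar> \<le> 1")
      case True
      then have "norm (zetaH s) \<le> B" using s by (intro B(2)) (auto simp: in_cbox_complex_iff)
      also have "\<dots> \<le> B * ?t powr (1/48)" using B(1) t1 by simp
      also have "\<dots> \<le> (B + 2 * (C + 1)) * ?t powr (1/48)" using C by (intro mult_right_mono) auto
      finally show ?thesis .
    next
      case False
      then have s1: "s \<noteq> 1" by auto
      have n: "?t / 2 \<le> norm (s - 1)" using abs_Im_le_cmod[of "s - 1"] False by simp
      have "norm (zetaF s - zetaF 1) \<le> C * ?t powr (49/48) + 1"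
        using norm_triangle_ineq4[of "zetaF s" "zetaF 1"] C(2)[of s] s by (simp add: zetaF_1)
      also have "\<dots> \<le> (C + 1) * ?t powr (49/48)" using t1 by (simp add: distrib_right)
      finally have "norm (zetaF s - zetaF 1) / norm (s - 1) \<le> (C + 1) * ?t powr (49/48) / (?t / 2)"
        using n C by (intro frac_le) auto
      then have "norm (zetaH s) \<le> (C + 1) * ?t powr (49/48) / (?t / 2)"
        using s1 by (simp add: zetaH_def norm_divide)
      also have "\<dots> = 2 * (C + 1) * (?t powr (49/48) / ?t powr 1)" by simp
      also have "?t powr (49/48) / ?t powr 1 = ?t powr (1/48)" by (subst powr_diff[symmetric]) simp
      also have "2 * (C + 1) * ?t powr (1/48) \<le> (B + 2 * (C + 1)) * ?t powr (1/48)"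
        using B by (intro mult_right_mono) auto
      finally show ?thesis .
    qed
  qed
  then show ?thesis using B C by (intro that[of "B + 2 * (C + 1)"]) auto
qed

lemma zetaH_eq: "1 < Re s \<Longrightarrow> zetaH s = dir_series (\<lambda>_. 1) s - 1 / (s - 1)"
  by (auto simp: zetaH_def zetaF_1 zetaF_eq diff_divide_distrib)

text \<open>The logarithmic derivative of \<open>zetaF\<close>, negated, is -zeta'/zeta - 1/(s - 1),
  and \<open>zetaH\<close> is zeta - 1/(s - 1); the polar parts cancel and -zeta'/zeta - zeta
  remains.\<close>

lemma zetaF_log_deriv:
  assumes s: "1 < Re s"
  shows "- deriv zetaF s / zetaF s - zetaH s = dir_series (\<lambda>n. mangoldt n - 1) s"
proof -
  let ?Z = "dir_series (\<lambda>_. 1)" and ?L = "dir_series (\<lambda>n. ln (real n))"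
  have Z: "(?Z has_field_derivative - ?L s) (at s)"
    using has_field_derivative_dir_series[OF dir_summable_1 s] by simp
  have "((\<lambda>s. (s - 1) * ?Z s) has_field_derivative (s - 1) * - ?L s + ?Z s) (at s)"
    by (auto intro!: derivative_eq_intros Z)
  then have "(zetaF has_field_derivative (s - 1) * - ?L s + ?Z s) (at s)"
    by (rule has_field_derivative_transform_within_open[of _ _ _ "{s. 1 < Re s}"])
       (use s zetaF_eq in \<open>auto simp: open_halfspace_Re_gt\<close>)
  then have d: "deriv zetaF s = (s - 1) * - ?L s + ?Z s" by (rule DERIV_imp_deriv)
  have nz: "s - 1 \<noteq> 0" "?Z s \<noteq> 0" using s zetaF_nonzero_right[OF s] by (auto simp: zetaF_eq)
  have "- deriv zetaF s / zetaF s - zetaH s = ?L s / ?Z s - ?Z s"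
  proof -
    have "- (u * - l + z) / (u * z) - (z - 1 / u) = l / z - z" if "u \<noteq> 0" "z \<noteq> 0" for u l z :: complex
      using that by (simp add: field_simps)
    from this[OF nz] show ?thesis unfolding d zetaF_eq[OF s] zetaH_eq[OF s] .
  qed
  also have "?L s / ?Z s = dir_series mangoldt s"
    using nz dir_series_mangoldt[OF s] by (simp add: field_simps)
  finally show ?thesis using dir_series_diff[OF dir_summable_mangoldt dir_summable_1 s] by simp
qed

lemma dir_summable_mangoldt_minus_1: "dir_summable (\<lambda>n. mangoldt n - 1)"
  by (rule dir_summable_diff[OF dir_summable_mangoldt dir_summable_1])

text \<open>\<open>zetaF_log_deriv\<close> is differentiated twice termwise, and the two signs
  cancel. The quotients are closed under differentiation: the derivative of \<open>F k\<close> is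
  \<open>F (Suc k) - F k * F 1\<close> (fact \<open>dQ\<close>), so the outcome is a polynomial of
  degree three in them.\<close>

lemma dir_series_ln_squared_eq:
  assumes s: "1 < Re s"
  defines "F \<equiv> \<lambda>k. (deriv ^^ k) zetaF s / zetaF s"
  shows "dir_series (\<lambda>n. ln (real n) * (ln (real n) * (mangoldt n - 1))) s
    = - (F 3 - F 2 * F 1 - 2 * F 1 * (F 2 - (F 1)\<^sup>2)) - (deriv ^^ 2) zetaH s"
proof -
  let ?S = "{s::complex. 1 < Re s}" and ?S' = "{s::complex. 95/96 < Re s}"
  let ?a = "\<lambda>n. mangoldt n - 1 :: real"
  let ?Q = "\<lambda>k s. (deriv ^^ k) zetaF s / zetaF s"
  have op: "open ?S" "open ?S'" by (rule open_halfspace_Re_gt)+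
  have dF: "((deriv ^^ k) zetaF has_field_derivative (deriv ^^ Suc k) zetaF z) (at z)" if "1 < Re z" for z k
    using holomorphic_derivI[OF holomorphic_higher_deriv[OF holomorphic_zetaF op(2), of k] op(2), of z] that by simp
  have dH: "((deriv ^^ k) zetaH has_field_derivative (deriv ^^ Suc k) zetaH z) (at z)" if "1 < Re z" for z k
    using holomorphic_derivI[OF holomorphic_higher_deriv[OF holomorphic_zetaH op(2), of k] op(2), of z] that by simp
  have dQ: "(?Q k has_field_derivative ?Q (Suc k) z - ?Q k z * ?Q 1 z) (at z)" if z: "1 < Re z" for z k
    using dF[OF z, of k] dF[OF z, of 0] zetaF_nonzero_right[OF z]
    by (auto intro!: derivative_eq_intros simp: field_simps power2_eq_square)
  have A: "dir_series ?a z = - ?Q 1 z - zetaH z" if "1 < Re z" for z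
    using zetaF_log_deriv[OF that] by simp
  have B: "dir_series (\<lambda>n. ln (real n) * ?a n) z = ?Q 2 z - (?Q 1 z)\<^sup>2 + deriv zetaH z" if z: "1 < Re z" for z
  proof -
    have "((\<lambda>z. - ?Q 1 z - zetaH z) has_field_derivative - (?Q (Suc 1) z - ?Q 1 z * ?Q 1 z) - deriv zetaH z) (at z)"
      using dH[OF z, of 0] by (intro DERIV_diff DERIV_minus dQ z) simp
    then have "(dir_series ?a has_field_derivative - (?Q (Suc 1) z - ?Q 1 z * ?Q 1 z) - deriv zetaH z) (at z)"
      by (rule has_field_derivative_transform_within_open[OF _ op(1)]) (use z A in auto)
    from DERIV_unique[OF this has_field_derivative_dir_series[OF dir_summable_mangoldt_minus_1 z]]
    show ?thesis by (simp add: power2_eq_square numeral_2_eq_2 algebra_simps)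
  qed
  have "((\<lambda>z. ?Q 2 z - (?Q 1 z)\<^sup>2 + deriv zetaH z) has_field_derivative
      (?Q (Suc 2) s - ?Q 2 s * ?Q 1 s) - 2 * (?Q 1 s * (?Q (Suc 1) s - ?Q 1 s * ?Q 1 s)) + (deriv ^^ Suc 1) zetaH s) (at s)"
  proof (intro DERIV_add DERIV_diff dQ s)
    show "((\<lambda>z. (?Q 1 z)\<^sup>2) has_field_derivative 2 * (?Q 1 s * (?Q (Suc 1) s - ?Q 1 s * ?Q 1 s))) (at s)"
      by (rule DERIV_cong[OF DERIV_power[OF dQ[OF s, of 1], of 2]]) simp
    show "(deriv zetaH has_field_derivative (deriv ^^ Suc 1) zetaH s) (at s)"
      using dH[OF s, of 1] by simp
  qed
  then have "(dir_series (\<lambda>n. ln (real n) * ?a n) has_field_derivative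
      (?Q (Suc 2) s - ?Q 2 s * ?Q 1 s) - 2 * (?Q 1 s * (?Q (Suc 1) s - ?Q 1 s * ?Q 1 s)) + (deriv ^^ Suc 1) zetaH s) (at s)"
    by (rule has_field_derivative_transform_within_open[OF _ op(1)]) (use s B in auto)
  from DERIV_unique[OF this has_field_derivative_dir_series[OF dir_summable_ln[OF dir_summable_mangoldt_minus_1] s]]
  show ?thesis by (simp add: F_def power2_eq_square numeral_2_eq_2 numeral_3_eq_3 algebra_simps)
qed

lemma dir_series_ln_squared_bound:
  obtains C where "0 < C" "\<And>s. 1 < Re s \<Longrightarrow> Re s \<le> 2 \<Longrightarrow>
    norm (dir_series (\<lambda>n. ln (real n) * (ln (real n) * (mangoldt n - 1))) s) \<le> C * (1 + \<bar>Im s\<bar>) powr (1/2)"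
proof -
  obtain c where c: "0 < c" "\<And>s. 1 \<le> Re s \<Longrightarrow> Re s \<le> 2 \<Longrightarrow> c * (1 + \<bar>Im s\<bar>) powr (41/48) \<le> norm (zetaF s)"
    using zetaF_lower_bound by blast
  have "\<exists>D. \<forall>k. 0 < D k \<and> (\<forall>s. 1 \<le> Re s \<longrightarrow> Re s \<le> 2 \<longrightarrow> norm ((deriv ^^ k) zetaF s) \<le> D k * (1 + \<bar>Im s\<bar>) powr (49/48))"
    using zetaF_deriv_bound by (intro choice allI) metis
  then obtain D where D: "\<And>k. 0 < D k"
    "\<And>k s. 1 \<le> Re s \<Longrightarrow> Re s \<le> 2 \<Longrightarrow> norm ((deriv ^^ k) zetaF s) \<le> D k * (1 + \<bar>Im s\<bar>) powr (49/48)" by blast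
  obtain E where E: "0 < E" "\<And>s. 191/192 \<le> Re s \<Longrightarrow> Re s \<le> 3 \<Longrightarrow> norm (zetaH s) \<le> E * (1 + \<bar>Im s\<bar>) powr (1/48)"
    using zetaH_bound by blast
  define E' where "E' = fact 2 * E * 2 powr (1/48) * 192 ^ 2"
  have E': "0 < E'" using E by (simp add: E'_def)
  define M where "M = max 1 ((D 1 + D 2 + D 3) / c)"
  have M: "1 \<le> M" "(D 1 + D 2 + D 3) / c \<le> M" by (auto simp: M_def)
  have "norm (dir_series (\<lambda>n. ln (real n) * (ln (real n) * (mangoldt n - 1))) s) \<le> (6 * M ^ 3 + E') * (1 + \<bar>Im s\<bar>) powr (1/2)"
    if s: "1 < Re s" "Re s \<le> 2" for s
  proof -
    let ?t = "1 + \<bar>Im s\<bar>"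
    \<comment> \<open>\<open>X\<close> bounds all three quotients, as 49/48 - 41/48 = 1/6. Since
      \<open>X \<ge> 1\<close>, every monomial is at most \<open>X ^ 3\<close>; the coefficients 1,
      1, 2, 2 add up to 6.\<close>
    define X where "X = M * ?t powr (1/6)"
    define Q where "Q = (\<lambda>k. (deriv ^^ k) zetaF s / zetaF s)"
    have t: "1 \<le> ?t powr (1/6)" by (intro ge_one_powr_ge_zero) auto
    have X: "1 \<le> X" using M t mult_mono[of 1 M 1 "?t powr (1/6)"] by (simp add: X_def)
    have Q: "norm (Q k) \<le> X" if k: "D k \<le> D 1 + D 2 + D 3" for k
    proof -
      have "norm (Q k) \<le> (D k * ?t powr (49/48)) / (c * ?t powr (41/48))"
        unfolding Q_def norm_divide using D(2) c s less_imp_le[OF D(1)] by (intro frac_le) auto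
      also have "\<dots> = D k / c * (?t powr (49/48) / ?t powr (41/48))" by simp
      also have "?t powr (49/48) / ?t powr (41/48) = ?t powr (1/6)" by (subst powr_diff[symmetric]) simp
      also have "D k / c * ?t powr (1/6) \<le> M * ?t powr (1/6)"
        using M k c by (intro mult_right_mono order_trans[OF divide_right_mono M(2)]) auto
      finally show ?thesis by (simp add: X_def)
    qed
    have Q123: "norm (Q 1) \<le> X" "norm (Q 2) \<le> X" "norm (Q 3) \<le> X"
      by (intro Q; use D(1)[of 1] D(1)[of 2] D(1)[of 3] in linarith)+
    have "norm (- (Q 3 - Q 2 * Q 1 - 2 * Q 1 * (Q 2 - (Q 1)\<^sup>2))) \<le> norm (Q 3) + norm (Q 2) * norm (Q 1) + 2 * norm (Q 1) * (norm (Q 2) + norm (Q 1) ^ 2)"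
      unfolding norm_minus_cancel
      by (intro order_trans[OF norm_triangle_ineq4] add_mono order_refl)
         (auto simp: norm_mult norm_power intro!: mult_left_mono order_trans[OF norm_triangle_ineq4])
    also have "\<dots> \<le> X + X * X + 2 * X * (X + X ^ 2)"
      using Q123 X by (intro add_mono mult_mono power_mono) auto
    also have "\<dots> \<le> 6 * X ^ 3"
    proof -
      have "X \<le> X ^ 3" "X * X \<le> X ^ 3" using X power_increasing[of 1 3 X] power_increasing[of 2 3 X]
        by (auto simp: power2_eq_square)
      then show ?thesis by (simp add: power_eq_if algebra_simps)
    qed
    also have "X ^ 3 = M ^ 3 * ?t powr (1/2)" by (simp add: X_def power_mult_distrib powr_power)
    finally have 1: "norm (- (Q 3 - Q 2 * Q 1 - 2 * Q 1 * (Q 2 - (Q 1)\<^sup>2))) \<le> 6 * M ^ 3 * ?t powr (1/2)" by simp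
    have "norm ((deriv ^^ 2) zetaH s) \<le> E' * ?t powr (1/48)"
      unfolding E'_def by (rule deriv_bound_strip[OF holomorphic_zetaH]) (use E s in auto)
    also have "\<dots> \<le> E' * ?t powr (1/2)" using E' by (intro mult_left_mono powr_mono) auto
    finally have 2: "norm ((deriv ^^ 2) zetaH s) \<le> E' * ?t powr (1/2)" .
    show ?thesis unfolding dir_series_ln_squared_eq[OF s(1)]
      using order_trans[OF norm_triangle_ineq4 add_mono[OF 1 2]] by (simp add: Q_def distrib_right)
  qed
  moreover have "0 < 6 * M ^ 3 + E'" using M E' by (intro add_nonneg_pos) auto
  ultimately show ?thesis by (intro that[of "6 * M ^ 3 + E'"]) auto
qed

section \<open>Perron's formula for the weighted von Mangoldt coefficients\<close>

definition ln2_mangoldt_minus_1 :: "nat \<Rightarrow> real" where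
  "ln2_mangoldt_minus_1 n = ln (real n) * (ln (real n) * (mangoldt n - 1))"

lemma dir_summable_ln2_mangoldt_minus_1: "dir_summable ln2_mangoldt_minus_1"
  unfolding ln2_mangoldt_minus_1_def[abs_def] by (intro dir_summable_ln dir_summable_mangoldt_minus_1)

text \<open>Multiplying the kernel at \<open>y = ln x\<close> by \<open>of_nat n powr (-s)\<close>
  shifts it to \<open>y - ln n\<close>, so the termwise integrals give the weights
  \<open>ln (x / n)\<close> for \<open>n \<le> x\<close> and vanish beyond. Absolute convergence
  justifies the exchange, and the integral is then estimated absolutely.\<close>

lemma ln2_mangoldt_minus_1_log_average_bound:
  obtains C where "0 < C"
    "\<And>x. 3 \<le> x \<Longrightarrow> \<bar>\<Sum>n = 1..nat \<lfloor>x\<rfloor>. ln2_mangoldt_minus_1 n * ln (x / real n)\<bar> \<le> C * x"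
proof -
  obtain C where C: "0 < C" "\<And>s. 1 < Re s \<Longrightarrow> Re s \<le> 2 \<Longrightarrow>
    norm (dir_series ln2_mangoldt_minus_1 s) \<le> C * (1 + \<bar>Im s\<bar>) powr (1/2)"
    unfolding ln2_mangoldt_minus_1_def[abs_def] using dir_series_ln_squared_bound by blast
  define I where "I = (LINT t|lborel. (1 + \<bar>t::real\<bar>) powr (-3/2))"
  have I: "0 \<le> I" unfolding I_def by (intro integral_nonneg_AE) auto
  have "\<bar>\<Sum>n = 1..nat \<lfloor>x\<rfloor>. ln2_mangoldt_minus_1 n * ln (x / real n)\<bar> \<le> (C * 2 * I * exp 1) * x" if x: "3 \<le> x" for x
  proof -
    define y where "y = ln x"
    have "exp 1 \<le> x" using exp_le x by linarith
    then have "ln (exp 1) \<le> ln x" by (intro ln_mono) auto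
    then have y: "1 \<le> y" by (simp add: y_def)
    \<comment> \<open>Then \<open>exp (c * y) = exp 1 * x\<close>: the line stays inside the region
      of convergence at the cost of a constant factor only.\<close>
    define c where "c = 1 + 1 / y"
    have c: "1 < c" "c \<le> 2" using y by (auto simp: c_def)
    have "c * y = 1 + y" using y by (simp add: c_def distrib_right)
    then have ecy: "exp (c * y) = exp 1 * x" using x by (simp add: y_def exp_add)
    define K where "K = (\<lambda>v t. exp (of_real v * Complex c t) / (Complex c t)\<^sup>2)"
    define f where "f = (\<lambda>n t. of_real (ln2_mangoldt_minus_1 n) * of_nat n powr (- Complex c t) * K y t)"
    \<comment> \<open>At \<open>n = 0\<close> both sides are 0, because \<open>ln 0 = 0\<close>
      makes the coefficient vanish.\<close>
    have f_eq: "f n t = of_real (ln2_mangoldt_minus_1 n) * K (y - ln (real n)) t" for n t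
    proof (cases "n = 0")
      case False
      have "of_nat n powr (- Complex c t) * exp (of_real y * Complex c t) = exp (of_real (y - ln (real n)) * Complex c t)"
        using False by (simp add: powr_def Ln_of_nat exp_add[symmetric] algebra_simps)
      then show ?thesis by (simp add: f_def K_def)
    qed (simp add: f_def ln2_mangoldt_minus_1_def)
    have K_int: "integrable lborel (K v)" for v
      unfolding K_def by (rule integrable_perron_kernel) (use c in simp)
    have nf: "norm (f n t) = \<bar>ln2_mangoldt_minus_1 n\<bar> * real n powr (- c) * norm (K y t)" for n t
      by (simp add: f_def norm_mult norm_nat_powr)
    have sm: "summable (\<lambda>n. \<bar>ln2_mangoldt_minus_1 n\<bar> * real n powr (- c))"
      using dir_summable_ln2_mangoldt_minus_1 c by (simp add: dir_summable_def)
    have f_int: "integrable lborel (f n)" for n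
      unfolding f_eq[abs_def] by (intro integrable_mult_right K_int)
    have ae: "AE t in lborel. summable (\<lambda>n. norm (f n t))"
      unfolding nf by (intro AE_I2 summable_mult2 sm)
    have si: "summable (\<lambda>n. LINT t|lborel. norm (f n t))"
      unfolding nf by (simp add: summable_mult2 sm)
    have "(\<lambda>n. integral\<^sup>L lborel (f n)) sums (LINT t|lborel. (\<Sum>n. f n t))"
      by (rule sums_integral[OF f_int ae si])
    moreover have T: "(\<Sum>n. f n t) = dir_series ln2_mangoldt_minus_1 (Complex c t) * K y t" for t
    proof -
      have "(\<lambda>n. f n t) sums (dir_series ln2_mangoldt_minus_1 (Complex c t) * K y t)"
        unfolding f_def by (intro sums_mult2 dir_series_sums dir_summable_ln2_mangoldt_minus_1) (use c in auto)
      then show ?thesis by (simp add: sums_iff)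
    qed
    moreover have "integral\<^sup>L lborel (f n) = of_real (ln2_mangoldt_minus_1 n * (2 * pi * max 0 (y - ln (real n))))" for n
    proof -
      have "integral\<^sup>L lborel (K (y - ln (real n))) = of_real (2 * pi * max 0 (y - ln (real n)))"
        unfolding K_def by (rule perron_formula) (use c in simp)
      then show ?thesis unfolding f_eq[abs_def] by simp
    qed
    moreover have T_int: "integrable lborel (\<lambda>t. dir_series ln2_mangoldt_minus_1 (Complex c t) * K y t)"
      using integrable_suminf[OF f_int ae si] unfolding T .
    ultimately have S1: "(\<lambda>n. of_real (ln2_mangoldt_minus_1 n * (2 * pi * max 0 (y - ln (real n)))))
      sums (LINT t|lborel. dir_series ln2_mangoldt_minus_1 (Complex c t) * K y t)" by simp
    have S2: "(\<lambda>n. of_real (ln2_mangoldt_minus_1 n * (2 * pi * max 0 (y - ln (real n)))) :: complex)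
      sums (\<Sum>n = 1..nat \<lfloor>x\<rfloor>. of_real (ln2_mangoldt_minus_1 n * (2 * pi * max 0 (y - ln (real n)))))"
    proof (rule sums_finite)
      fix n assume n: "n \<notin> {1..nat \<lfloor>x\<rfloor>}"
      show "of_real (ln2_mangoldt_minus_1 n * (2 * pi * max 0 (y - ln (real n)))) = (0::complex)"
      proof (cases "n = 0")
        case False
        then have "x < real n" using n x by (auto simp: not_le nat_less_iff floor_less_iff)
        then have "y \<le> ln (real n)" using x by (simp add: y_def)
        then show ?thesis by simp
      qed (simp add: ln2_mangoldt_minus_1_def)
    qed simp
    have "(\<Sum>n = 1..nat \<lfloor>x\<rfloor>. ln2_mangoldt_minus_1 n * (2 * pi * max 0 (y - ln (real n))))
        = 2 * pi * (\<Sum>n = 1..nat \<lfloor>x\<rfloor>. ln2_mangoldt_minus_1 n * ln (x / real n))"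
      unfolding sum_distrib_left
    proof (rule sum.cong)
      fix n assume n: "n \<in> {1..nat \<lfloor>x\<rfloor>}"
      then have "real n \<le> x" "0 < real n" using x by (auto simp: le_nat_iff le_floor_iff)
      then show "ln2_mangoldt_minus_1 n * (2 * pi * max 0 (y - ln (real n))) = 2 * pi * (ln2_mangoldt_minus_1 n * ln (x / real n))"
        by (simp add: y_def ln_div)
    qed simp
    then have fin: "(\<Sum>n = 1..nat \<lfloor>x\<rfloor>. of_real (ln2_mangoldt_minus_1 n * (2 * pi * max 0 (y - ln (real n)))))
        = (of_real (2 * pi * (\<Sum>n = 1..nat \<lfloor>x\<rfloor>. ln2_mangoldt_minus_1 n * ln (x / real n))) :: complex)"
      by (simp only: of_real_sum[symmetric])
    have eq: "(LINT t|lborel. dir_series ln2_mangoldt_minus_1 (Complex c t) * K y t)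
        = of_real (2 * pi * (\<Sum>n = 1..nat \<lfloor>x\<rfloor>. ln2_mangoldt_minus_1 n * ln (x / real n)))"
      using sums_unique2[OF S1 S2] unfolding fin .
    have "norm (LINT t|lborel. dir_series ln2_mangoldt_minus_1 (Complex c t) * K y t)
        \<le> (LINT t|lborel. C * (2 * exp (c * y)) * (1 + \<bar>t\<bar>) powr (-3/2))"
    proof (rule order_trans[OF integral_norm_bound integral_mono])
      show "integrable lborel (\<lambda>t. norm (dir_series ln2_mangoldt_minus_1 (Complex c t) * K y t))"
        by (rule integrable_norm[OF T_int])
      show "integrable lborel (\<lambda>t::real. C * (2 * exp (c * y)) * (1 + \<bar>t\<bar>) powr (-3/2))"
        using integrable_one_plus_abs_powr by simp
      fix t :: real
      have c1: "1 \<le> c\<^sup>2" using c by (intro one_le_power) auto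
      have "norm (K y t) = exp (c * y) * (1 / (norm (Complex c t))\<^sup>2)"
        by (simp add: K_def norm_divide norm_power mult.commute)
      also have "\<dots> \<le> exp (c * y) * (2 * max 1 (1 / c\<^sup>2) * (1 + \<bar>t\<bar>) powr (-2))"
        by (intro mult_left_mono inverse_norm_square_vertical_le) (use c in auto)
      also have "max 1 (1 / c\<^sup>2) = 1" using c1 by (intro max_absorb1) (simp add: divide_le_eq_1)
      finally have "norm (K y t) \<le> 2 * exp (c * y) * (1 + \<bar>t\<bar>) powr (-2)" by simp
      moreover have "norm (dir_series ln2_mangoldt_minus_1 (Complex c t)) \<le> C * (1 + \<bar>t\<bar>) powr (1/2)"
        using C(2)[of "Complex c t"] c by simp
      ultimately have "norm (dir_series ln2_mangoldt_minus_1 (Complex c t) * K y t)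
          \<le> (C * (1 + \<bar>t\<bar>) powr (1/2)) * (2 * exp (c * y) * (1 + \<bar>t\<bar>) powr (-2))"
        unfolding norm_mult using C by (intro mult_mono) auto
      also have "\<dots> = C * (2 * exp (c * y)) * ((1 + \<bar>t\<bar>) powr (1/2) * (1 + \<bar>t\<bar>) powr (-2))" by simp
      also have "(1 + \<bar>t\<bar>) powr (1/2) * (1 + \<bar>t\<bar>) powr (-2) = (1 + \<bar>t\<bar>) powr (-3/2)"
        by (subst powr_add[symmetric]) simp
      finally show "norm (dir_series ln2_mangoldt_minus_1 (Complex c t) * K y t) \<le> C * (2 * exp (c * y)) * (1 + \<bar>t\<bar>) powr (-3/2)" .
    qed
    also have "\<dots> = C * (2 * (exp 1 * x)) * I" by (simp add: I_def ecy)
    finally have "2 * pi * \<bar>\<Sum>n = 1..nat \<lfloor>x\<rfloor>. ln2_mangoldt_minus_1 n * ln (x / real n)\<bar> \<le> C * 2 * I * exp 1 * x"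
      unfolding eq norm_of_real by (simp add: abs_mult mult_ac)
    moreover have "1 * \<bar>\<Sum>n = 1..nat \<lfloor>x\<rfloor>. ln2_mangoldt_minus_1 n * ln (x / real n)\<bar> \<le> 2 * pi * \<bar>\<Sum>n = 1..nat \<lfloor>x\<rfloor>. ln2_mangoldt_minus_1 n * ln (x / real n)\<bar>"
      using pi_gt3 by (intro mult_right_mono) auto
    ultimately show ?thesis by simp
  qed
  \<comment> \<open>The \<open>+ 1\<close> makes the constant positive when only
    \<open>I \<ge> 0\<close> is known.\<close>
  then have "\<bar>\<Sum>n = 1..nat \<lfloor>x\<rfloor>. ln2_mangoldt_minus_1 n * ln (x / real n)\<bar> \<le> (C * 2 * I * exp 1 + 1) * x" if "3 \<le> x" for x
    using that by (simp add: distrib_right add_increasing2)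
  moreover have "0 < C * 2 * I * exp 1 + 1" using C I by (intro add_nonneg_pos) auto
  ultimately show ?thesis by (intro that[of "C * 2 * I * exp 1 + 1"]) auto
qed

section \<open>Removing the logarithmic average\<close>

definition psum :: "(nat \<Rightarrow> real) \<Rightarrow> real \<Rightarrow> real" where
  "psum a x = (\<Sum>n = 1..nat \<lfloor>x\<rfloor>. a n)"

text \<open>For \<open>x \<ge> 1\<close> this is the integral of \<open>psum a u / u\<close> over
  [1, x].\<close>

definition psum_log :: "(nat \<Rightarrow> real) \<Rightarrow> real \<Rightarrow> real" where
  "psum_log a x = (\<Sum>n = 1..nat \<lfloor>x\<rfloor>. a n * ln (x / real n))"

lemma psum_split:
  assumes "0 \<le> x" "x \<le> z"
  shows "(\<Sum>n = 1..nat \<lfloor>z\<rfloor>. f n) = (\<Sum>n = 1..nat \<lfloor>x\<rfloor>. f n) + (\<Sum>n\<in>{nat \<lfloor>x\<rfloor><..nat \<lfloor>z\<rfloor>}. f n :: real)"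
proof -
  have "nat \<lfloor>x\<rfloor> \<le> nat \<lfloor>z\<rfloor>" using assms by (intro nat_mono floor_mono)
  then have "{1..nat \<lfloor>z\<rfloor>} = {1..nat \<lfloor>x\<rfloor>} \<union> {nat \<lfloor>x\<rfloor><..nat \<lfloor>z\<rfloor>}" by auto
  moreover have "{1..nat \<lfloor>x\<rfloor>} \<inter> {nat \<lfloor>x\<rfloor><..nat \<lfloor>z\<rfloor>} = {}" by auto
  ultimately show ?thesis by (simp only: sum.union_disjoint finite_atLeastAtMost finite_greaterThanAtMost)
qed

lemma psum_mono:
  assumes "\<And>n. 0 \<le> a n" "0 \<le> x" "x \<le> z"
  shows "psum a x \<le> psum a z"
  unfolding psum_def psum_split[OF assms(2,3)] using assms(1) by (simp add: sum_nonneg)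

lemma psum_nonneg: "(\<And>n. 0 \<le> a n) \<Longrightarrow> 0 \<le> psum a x"
  by (simp add: psum_def sum_nonneg)

text \<open>For non-negative coefficients \<open>psum a\<close> is non-decreasing, so its mean over
  [x, z] with respect to du/u lies between its end values.\<close>

lemma psum_log_diff:
  assumes a: "\<And>n. 0 \<le> a n" and x: "1 \<le> x" "x \<le> z"
  shows "psum a x * ln (z / x) \<le> psum_log a z - psum_log a x"
    and "psum_log a z - psum_log a x \<le> psum a z * ln (z / x)"
proof -
  define T where "T = (\<Sum>n\<in>{nat \<lfloor>x\<rfloor><..nat \<lfloor>z\<rfloor>}. a n * ln (z / real n))"
  have in_T: "x < real n \<and> real n \<le> z" if "n \<in> {nat \<lfloor>x\<rfloor><..nat \<lfloor>z\<rfloor>}" for n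
    using that x by (auto simp: nat_less_iff floor_less_iff le_nat_iff le_floor_iff)
  have "(\<Sum>n = 1..nat \<lfloor>x\<rfloor>. a n * ln (z / real n)) = psum_log a x + psum a x * ln (z / x)"
    unfolding psum_log_def psum_def sum_distrib_right sum.distrib[symmetric]
  proof (rule sum.cong)
    fix n assume "n \<in> {1..nat \<lfloor>x\<rfloor>}"
    then show "a n * ln (z / real n) = a n * ln (x / real n) + a n * ln (z / x)"
      using x by (simp add: ln_div algebra_simps)
  qed simp
  then have eq: "psum_log a z - psum_log a x = psum a x * ln (z / x) + T"
    unfolding psum_log_def[of a z] by (subst psum_split[of x z]) (use x in \<open>auto simp: T_def\<close>)
  have "0 \<le> T" unfolding T_def
    by (intro sum_nonneg mult_nonneg_nonneg a ln_ge_zero) (use in_T x in \<open>force simp: field_simps\<close>)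
  then show "psum a x * ln (z / x) \<le> psum_log a z - psum_log a x" using eq by simp
  have "T \<le> (\<Sum>n\<in>{nat \<lfloor>x\<rfloor><..nat \<lfloor>z\<rfloor>}. a n * ln (z / x))" unfolding T_def
  proof (intro sum_mono mult_left_mono a)
    fix n assume "n \<in> {nat \<lfloor>x\<rfloor><..nat \<lfloor>z\<rfloor>}"
    from in_T[OF this] show "ln (z / real n) \<le> ln (z / x)" using x by (intro ln_mono) (auto intro!: divide_left_mono)
  qed
  also have "psum a x * ln (z / x) + \<dots> = psum a z * ln (z / x)"
    unfolding psum_def[of a z] by (subst psum_split[of x z]) (use x in \<open>auto simp: psum_def sum_distrib_right distrib_right\<close>)
  finally show "psum_log a z - psum_log a x \<le> psum a z * ln (z / x)" using eq by simp
qed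

text \<open>At most z - x + 1 integers lie in (x, z].\<close>

lemma psum_ln_squared_diff:
  assumes x: "1 \<le> x" "x \<le> z"
  shows "psum (\<lambda>n. (ln (real n))\<^sup>2) z - psum (\<lambda>n. (ln (real n))\<^sup>2) x \<le> (z - x + 1) * (ln z)\<^sup>2"
proof -
  have "psum (\<lambda>n. (ln (real n))\<^sup>2) z - psum (\<lambda>n. (ln (real n))\<^sup>2) x = (\<Sum>n\<in>{nat \<lfloor>x\<rfloor><..nat \<lfloor>z\<rfloor>}. (ln (real n))\<^sup>2)"
    unfolding psum_def by (subst psum_split[of x z]) (use x in auto)
  also have "\<dots> \<le> (\<Sum>n\<in>{nat \<lfloor>x\<rfloor><..nat \<lfloor>z\<rfloor>}. (ln z)\<^sup>2)"
  proof (intro sum_mono power_mono)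
    fix n assume "n \<in> {nat \<lfloor>x\<rfloor><..nat \<lfloor>z\<rfloor>}"
    then have "real n \<le> z" "1 \<le> n" using x by (auto simp: le_nat_iff le_floor_iff)
    then show "ln (real n) \<le> ln z" "0 \<le> ln (real n)" by auto
  qed
  also have "\<dots> = real (nat \<lfloor>z\<rfloor> - nat \<lfloor>x\<rfloor>) * (ln z)\<^sup>2" by simp
  also have "\<dots> \<le> (z - x + 1) * (ln z)\<^sup>2"
    by (intro mult_right_mono) (use x in linarith, simp)
  finally show ?thesis .
qed

text \<open>The averaged estimate is differenced over windows of logarithmic length
  \<open>d = 1 / ln x\<close> on either side of \<open>x\<close>. The averaging error becomes
  O(x)/d, and moving the sum of ln^2 n from the far end of the window to \<open>x\<close> costs O(d
  x ln^2 x); both are O(x ln x). The averaged form is exported as well, for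
  \<open>psum_log_prime_ln3_bound\<close>.\<close>

lemma psum_mangoldt_ln_squared:
  obtains C where "0 < C"
    "\<And>x. 9 \<le> x \<Longrightarrow> \<bar>psum (\<lambda>n. mangoldt n * (ln (real n))\<^sup>2) x - psum (\<lambda>n. (ln (real n))\<^sup>2) x\<bar> \<le> C * (x * ln x)"
    "\<And>x. 3 \<le> x \<Longrightarrow> \<bar>psum_log (\<lambda>n. mangoldt n * (ln (real n))\<^sup>2) x - psum_log (\<lambda>n. (ln (real n))\<^sup>2) x\<bar> \<le> C * x"
proof -
  let ?a = "\<lambda>n. mangoldt n * (ln (real n))\<^sup>2 :: real" and ?b = "\<lambda>n. (ln (real n))\<^sup>2"
  have a: "0 \<le> ?a n" for n by (simp add: mangoldt_nonneg)
  obtain C where C: "0 < C" "\<And>x. 3 \<le> x \<Longrightarrow> \<bar>\<Sum>n = 1..nat \<lfloor>x\<rfloor>. ln2_mangoldt_minus_1 n * ln (x / real n)\<bar> \<le> C * x"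
    using ln2_mangoldt_minus_1_log_average_bound by blast
  have "psum_log ?a x - psum_log ?b x = (\<Sum>n = 1..nat \<lfloor>x\<rfloor>. ln2_mangoldt_minus_1 n * ln (x / real n))" for x
    unfolding psum_log_def sum_subtractf[symmetric]
    by (intro sum.cong) (auto simp: ln2_mangoldt_minus_1_def power2_eq_square algebra_simps)
  then have D: "\<bar>psum_log ?a x - psum_log ?b x\<bar> \<le> C * x" if "3 \<le> x" for x using C(2)[OF that] by simp
  have main: "\<bar>psum ?a x - psum ?b x\<bar> \<le> (12 + 4 * C) * (x * ln x)" if x: "9 \<le> x" for x
  proof -
    define L where "L = ln x"
    have "exp 1 \<le> x" using exp_le x by linarith
    then have "ln (exp 1) \<le> ln x" by (intro ln_mono) auto
    then have L: "1 \<le> L" by (simp add: L_def)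
    have Lx: "L \<le> x" unfolding L_def using x ln_le_minus_one[of x] by simp
    define d where "d = 1 / L"
    have d: "0 < d" "d \<le> 1" "d * L = 1" using L by (auto simp: d_def)
    define z where "z = x * exp d"
    define w where "w = x * exp (- d)"
    have "exp d \<le> exp 1" using d by simp
    then have ed: "exp d \<le> 3" using exp_le by linarith
    have "exp d \<le> 1 + d + d\<^sup>2" using d by (intro exp_bound) auto
    also have "d\<^sup>2 \<le> d" using d by (simp add: power2_eq_square mult_left_le)
    finally have ed2: "exp d \<le> 1 + 2 * d" by simp
    have em: "1 - d \<le> exp (- d)" using exp_ge_add_one_self[of "- d"] by simp
    have z: "x \<le> z" "z \<le> 3 * x" "z - x \<le> 2 * (d * x)" "ln (z / x) = d" "ln z = L + d"
      using x d ed ed2 mult_left_mono[OF ed2, of x] by (auto simp: z_def algebra_simps L_def ln_mult)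
    \<comment> \<open>With \<open>x \<ge> 9\<close> this puts the lower end of the window at 3 or
      more, where the averaged estimate is available.\<close>
    have w3: "x / 3 \<le> w"
    proof -
      have "x * exp (- d) = x / exp d" by (simp add: exp_minus field_simps)
      moreover have "x / 3 \<le> x / exp d" using ed x by (intro divide_left_mono) auto
      ultimately show ?thesis by (simp add: w_def)
    qed
    have "3 \<le> w" using w3 x by linarith
    then have w: "3 \<le> w" "w \<le> x" "x - w \<le> d * x" "ln (x / w) = d"
      using x d em mult_left_mono[OF em, of x] by (auto simp: w_def algebra_simps ln_div ln_mult)
    have Cz: "C * z \<le> C * (3 * x)" and Cw: "C * w \<le> C * x" using z(2) w(2) C by (auto intro: mult_left_mono)
    have bz: "psum_log ?b z - psum_log ?b x \<le> psum ?b z * d" using psum_log_diff(2)[of ?b x z] x z by simp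
    have bw: "psum ?b w * d \<le> psum_log ?b x - psum_log ?b w" using psum_log_diff(1)[of ?b w x] w by simp
    have "psum ?a x * d \<le> psum_log ?a z - psum_log ?a x"
      using psum_log_diff(1)[of ?a x z, OF a] x z by simp
    also have "\<dots> \<le> (psum_log ?b z - psum_log ?b x) + C * z + C * x" using D[of z] D[of x] x z by linarith
    also have "\<dots> \<le> psum ?b z * d + C * (3 * x) + C * x"
      using bz Cz by linarith
    finally have "psum ?a x * d * L \<le> (psum ?b z * d + 4 * (C * x)) * L"
      using L by (intro mult_right_mono) auto
    then have "psum ?a x * (d * L) \<le> psum ?b z * (d * L) + 4 * (C * x) * L" by (simp add: algebra_simps)
    then have up: "psum ?a x \<le> psum ?b z + 4 * (C * x) * L" by (simp only: d(3) mult_1_right)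
    have "psum ?b z - psum ?b x \<le> (z - x + 1) * (ln z)\<^sup>2" by (rule psum_ln_squared_diff) (use x z in auto)
    also have "\<dots> \<le> (2 * (d * x) + 1) * (2 * L)\<^sup>2"
      using z d L x by (intro mult_mono power_mono) auto
    also have "\<dots> = 8 * (d * L) * (x * L) + 4 * L * L" by (simp add: power2_eq_square algebra_simps)
    also have "\<dots> \<le> 12 * (x * L)" using d Lx L mult_right_mono[OF Lx, of L] by simp
    finally have "psum ?a x - psum ?b x \<le> (12 + 4 * C) * (x * L)" using up by (simp add: algebra_simps)
    moreover have "psum ?b x - psum ?a x \<le> (12 + 4 * C) * (x * L)"
    proof -
      have "psum ?b w * d - C * x - C * x \<le> (psum_log ?b x - psum_log ?b w) - C * x - C * w"
        using bw Cw by linarith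
      also have "\<dots> \<le> psum_log ?a x - psum_log ?a w" using D[of w] D[of x] x w by linarith
      also have "\<dots> \<le> psum ?a x * d"
        using psum_log_diff(2)[of ?a w x, OF a] w by simp
      finally have "(psum ?b w * d - 2 * (C * x)) * L \<le> psum ?a x * d * L"
        using L by (intro mult_right_mono) auto
      then have "psum ?b w * (d * L) - 2 * (C * x) * L \<le> psum ?a x * (d * L)" by (simp add: algebra_simps)
      then have lo: "psum ?b w - 2 * (C * x) * L \<le> psum ?a x" by (simp only: d(3) mult_1_right)
      have "psum ?b x - psum ?b w \<le> (x - w + 1) * L\<^sup>2" unfolding L_def by (rule psum_ln_squared_diff) (use w in auto)
      also have "\<dots> \<le> (d * x + 1) * L\<^sup>2" using w by (intro mult_right_mono) auto
      also have "\<dots> = (d * L) * (x * L) + L * L" by (simp add: power2_eq_square algebra_simps)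
      also have "\<dots> \<le> 2 * (x * L)" using d Lx L mult_right_mono[OF Lx, of L] by simp
      finally have "psum ?b x - psum ?a x \<le> (2 + 2 * C) * (x * L)" using lo by (simp add: algebra_simps)
      also have "\<dots> \<le> (12 + 4 * C) * (x * L)" using C x L by (intro mult_right_mono) auto
      finally show ?thesis .
    qed
    ultimately show ?thesis by (simp add: L_def)
  qed
  show ?thesis
  proof (rule that[of "12 + 4 * C"])
    show "\<bar>psum_log ?a x - psum_log ?b x\<bar> \<le> (12 + 4 * C) * x" if "3 \<le> x" for x
    proof -
      have "C * x \<le> (12 + 4 * C) * x" using that C by (intro mult_right_mono) auto
      then show ?thesis using D[OF that] by linarith
    qed
  qed (use C main in auto)
qed

text \<open>The sum is \<open>ln (R ^ N / fact N)\<close> with \<open>N\<close> the integer part of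
  \<open>R\<close>, and \<open>R ^ N / fact N\<close> is a single term of the series for
  \<open>exp R\<close>.\<close>

lemma sum_ln_quotient_le:
  assumes R: "1 \<le> R"
  shows "psum_log (\<lambda>_. 1) R \<le> R"
proof -
  define N where "N = nat \<lfloor>R\<rfloor>"
  have "psum_log (\<lambda>_. 1) R = (\<Sum>n = 1..N. ln R - ln (real n))"
    unfolding psum_log_def N_def using R by (intro sum.cong) (auto simp: ln_div)
  also have "\<dots> = real N * ln R - ln (\<Prod>n = 1..N. real n)"
    by (subst ln_prod) (auto simp: sum_subtractf)
  also have "(\<Prod>n = 1..N. real n) = fact N" by (simp add: fact_prod)
  also have "real N * ln R - ln (fact N) = ln (R ^ N / fact N)"
    using R by (simp add: ln_div ln_realpow)
  also have "\<dots> \<le> ln (exp R)"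
  proof (rule ln_mono)
    have "(\<Sum>n\<in>{N}. R ^ n /\<^sub>R fact n) \<le> (\<Sum>n. R ^ n /\<^sub>R fact n)"
      using R by (intro sum_le_suminf summable_exp_generic) auto
    then show "R ^ N / fact N \<le> exp R" by (simp add: exp_def divide_inverse mult.commute)
  qed (use R in auto)
  finally show ?thesis by simp
qed

text \<open>The logarithm is frozen at \<open>R\<close> so that the main term is linear in
  \<open>y\<close>, as the later integration over the quarter disc requires. Each term falls short
  of ln^2 R by at most \<open>2 * ln R * ln (R / n)\<close>, and \<open>sum_ln_quotient_le\<close>
  sums these shortfalls to O(R ln R).\<close>

lemma psum_ln_squared_approx:
  assumes R: "exp 1 \<le> R" and y: "0 \<le> y" "y \<le> R"
  shows "\<bar>psum (\<lambda>n. (ln (real n))\<^sup>2) y - y * (ln R)\<^sup>2\<bar> \<le> 3 * (R * ln R)"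
proof -
  define L where "L = ln R"
  define N where "N = nat \<lfloor>y\<rfloor>"
  have R1: "1 \<le> R" using R exp_ge_add_one_self[of 1] by linarith
  have "ln (exp 1) \<le> ln R" using R by (intro ln_mono) auto
  then have L: "1 \<le> L" by (simp add: L_def)
  have LR: "L \<le> R" unfolding L_def using R1 ln_le_minus_one[of R] by simp
  have N: "real N \<le> y" "y - 1 \<le> real N" using y by (auto simp: N_def)
  have n: "0 \<le> ln (real n)" "ln (real n) \<le> L" if "n \<in> {1..N}" for n
  proof -
    have "real n \<le> R" "1 \<le> real n" using that N y by auto
    then show "0 \<le> ln (real n)" "ln (real n) \<le> L" by (auto simp: L_def)
  qed
  have "psum (\<lambda>n. (ln (real n))\<^sup>2) y \<le> (\<Sum>n = 1..N. L\<^sup>2)"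
    unfolding psum_def N_def[symmetric] by (intro sum_mono power_mono n)
  also have "\<dots> = real N * L\<^sup>2" by simp
  finally have N_up: "psum (\<lambda>n. (ln (real n))\<^sup>2) y \<le> real N * L\<^sup>2" .
  also have "\<dots> \<le> y * L\<^sup>2" using N by (intro mult_right_mono) auto
  finally have up: "psum (\<lambda>n. (ln (real n))\<^sup>2) y \<le> y * L\<^sup>2" .
  have "real N * L\<^sup>2 - psum (\<lambda>n. (ln (real n))\<^sup>2) y = (\<Sum>n = 1..N. L\<^sup>2 - (ln (real n))\<^sup>2)"
    unfolding psum_def N_def[symmetric] by (simp add: sum_subtractf)
  also have "\<dots> \<le> (\<Sum>n = 1..N. 2 * L * ln (R / real n))"
  proof (rule sum_mono)
    fix k assume k: "k \<in> {1..N}"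
    have "L\<^sup>2 - (ln (real k))\<^sup>2 = (L + ln (real k)) * (L - ln (real k))" by (simp add: power2_eq_square algebra_simps)
    also have "\<dots> \<le> (2 * L) * (L - ln (real k))" using n[OF k] by (intro mult_right_mono) auto
    also have "L - ln (real k) = ln (R / real k)" using k R1 by (simp add: L_def ln_div)
    finally show "L\<^sup>2 - (ln (real k))\<^sup>2 \<le> 2 * L * ln (R / real k)" .
  qed
  also have "\<dots> = 2 * L * (\<Sum>n = 1..N. ln (R / real n))" by (simp add: sum_distrib_left)
  also have "(\<Sum>n = 1..N. ln (R / real n)) \<le> (\<Sum>n = 1..nat \<lfloor>R\<rfloor>. ln (R / real n))"
  proof (rule sum_mono2)
    have "N \<le> nat \<lfloor>R\<rfloor>" unfolding N_def using y by (intro nat_mono floor_mono)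
    then show "{1..N} \<subseteq> {1..nat \<lfloor>R\<rfloor>}" by auto
    fix k assume "k \<in> {1..nat \<lfloor>R\<rfloor>} - {1..N}"
    then have "real k \<le> R" "0 < k" using R1 by (auto simp: le_nat_iff le_floor_iff)
    then show "0 \<le> ln (R / real k)" by (intro ln_ge_zero) simp
  qed simp
  also have "\<dots> \<le> R" using sum_ln_quotient_le[OF R1] by (simp add: psum_log_def)
  finally have "real N * L\<^sup>2 - psum (\<lambda>n. (ln (real n))\<^sup>2) y \<le> 2 * L * R" using L by simp
  moreover have "(y - 1) * L\<^sup>2 \<le> real N * L\<^sup>2" using N by (intro mult_right_mono) auto
  moreover have "L\<^sup>2 \<le> R * L" using LR L by (simp add: power2_eq_square mult_right_mono)
  ultimately have "y * L\<^sup>2 - psum (\<lambda>n. (ln (real n))\<^sup>2) y \<le> 3 * (R * L)" by (simp add: algebra_simps)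
  moreover have "0 \<le> R * L" using R1 L by simp
  ultimately show ?thesis using up unfolding L_def by (simp add: abs_le_iff)
qed

section \<open>From von Mangoldt weights to primes\<close>

definition prime_ln3 :: "nat \<Rightarrow> real" where
  "prime_ln3 n = (if prime n then (ln (real n)) ^ 3 else 0)"

lemma prime_ln3_nonneg: "0 \<le> prime_ln3 n"
  by (auto simp: prime_ln3_def dest: prime_ge_1_nat)

text \<open>A proper prime power up to \<open>R\<close> has base at most \<open>sqrt R\<close> and
  exponent at most \<open>log 2 R\<close>; the ranges include 0, hence both
  \<open>+ 1\<close>.\<close>

lemma card_proper_primepow_le:
  fixes R :: real
  assumes R: "1 \<le> R"
  shows "real (card {n \<in> {1..nat \<lfloor>R\<rfloor>}. primepow n \<and> \<not> prime n}) \<le> (sqrt R + 1) * (log 2 R + 1)"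
proof -
  let ?A = "{n \<in> {1..nat \<lfloor>R\<rfloor>}. primepow n \<and> \<not> prime n}"
  let ?S = "{..nat \<lfloor>sqrt R\<rfloor>} \<times> {..nat \<lfloor>log 2 R\<rfloor>}"
  have "?A \<subseteq> (\<lambda>(p, k). p ^ k) ` ?S"
  proof
    fix n assume n: "n \<in> ?A"
    then obtain p k where pk: "prime p" "0 < k" "n = p ^ k" by (auto simp: primepow_def)
    have k: "2 \<le> k" using pk n by (cases "k = 1") auto
    have p: "2 \<le> p" using pk prime_ge_2_nat by auto
    have nR: "real n \<le> R" using n R by (auto simp: le_nat_iff le_floor_iff)
    have "p ^ 2 \<le> n" unfolding pk(3) using k p by (intro power_increasing) auto
    then have "(real p)\<^sup>2 \<le> R" using nR by (metis of_nat_le_iff of_nat_power order_trans)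
    then have "real p \<le> sqrt R" by (rule real_le_rsqrt)
    moreover have "2 ^ k \<le> n" unfolding pk(3) using p by (intro power_mono) auto
    then have "2 ^ k \<le> R" using nR by (metis of_nat_le_iff of_nat_numeral of_nat_power order_trans)
    then have "real k \<le> log 2 R" using R by (subst le_log_iff) (auto simp: powr_realpow)
    ultimately have "(p, k) \<in> ?S" by (auto intro: le_nat_floor)
    then show "n \<in> (\<lambda>(p, k). p ^ k) ` ?S" using pk by force
  qed
  then have "card ?A \<le> card ((\<lambda>(p, k). p ^ k) ` ?S)" by (intro card_mono) auto
  also have "\<dots> \<le> card ?S" by (intro card_image_le) auto
  finally have "real (card ?A) \<le> real (card ?S)" by (rule of_nat_mono)
  also have "\<dots> = (real (nat \<lfloor>sqrt R\<rfloor>) + 1) * (real (nat \<lfloor>log 2 R\<rfloor>) + 1)"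
    by (simp add: card_cartesian_product algebra_simps)
  also have "\<dots> \<le> (sqrt R + 1) * (log 2 R + 1)" using R by (intro mult_mono add_right_mono) auto
  finally show ?thesis .
qed

text \<open>At a prime, \<open>mangoldt n * (ln n)\<^sup>2\<close> is exactly
  \<open>(ln n) ^ 3\<close>; only proper prime powers differ, each by at most
  \<open>(ln R) ^ 3\<close>.\<close>

lemma psum_prime_ln3_diff:
  assumes R: "1 \<le> R" and y: "0 \<le> y" "y \<le> R"
  shows "\<bar>psum prime_ln3 y - psum (\<lambda>n. mangoldt n * (ln (real n))\<^sup>2) y\<bar> \<le> (sqrt R + 1) * (log 2 R + 1) * (ln R) ^ 3"
proof -
  let ?a = "\<lambda>n. mangoldt n * (ln (real n))\<^sup>2 :: real"
  let ?A = "{n \<in> {1..nat \<lfloor>R\<rfloor>}. primepow n \<and> \<not> prime n}"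
  let ?B = "{n \<in> {1..nat \<lfloor>y\<rfloor>}. primepow n \<and> \<not> prime n}"
  have "nat \<lfloor>y\<rfloor> \<le> nat \<lfloor>R\<rfloor>" using y by (intro nat_mono floor_mono)
  then have BA: "?B \<subseteq> ?A" by auto
  have "psum ?a y - psum prime_ln3 y = (\<Sum>n = 1..nat \<lfloor>y\<rfloor>. ?a n - prime_ln3 n)"
    by (simp add: psum_def sum_subtractf)
  also have "\<dots> = (\<Sum>n\<in>?B. ?a n - prime_ln3 n)"
  proof (rule sum.mono_neutral_right)
    show "\<forall>n\<in>{1..nat \<lfloor>y\<rfloor>} - ?B. ?a n - prime_ln3 n = 0"
    proof
      fix n assume n: "n \<in> {1..nat \<lfloor>y\<rfloor>} - ?B"
      show "?a n - prime_ln3 n = 0"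
      proof (cases "prime n")
        case False
        then have "\<not> primepow n" using n by auto
        with False show ?thesis by (simp add: prime_ln3_def mangoldt_def)
      qed (simp add: prime_ln3_def power3_eq_cube power2_eq_square)
    qed
  qed auto
  also have "\<dots> = (\<Sum>n\<in>?B. ?a n)" by (intro sum.cong) (auto simp: prime_ln3_def)
  finally have eq: "psum ?a y - psum prime_ln3 y = (\<Sum>n\<in>?B. ?a n)" .
  have "(\<Sum>n\<in>?B. ?a n) \<le> (\<Sum>n\<in>?B. (ln R) ^ 3)"
  proof (rule sum_mono)
    fix n assume "n \<in> ?B"
    then have n: "0 < n" "real n \<le> R" using y by (auto simp: le_nat_iff le_floor_iff)
    then have "ln (real n) \<le> ln R" "0 \<le> ln (real n)" by auto
    moreover have "mangoldt n \<le> ln (real n)" using mangoldt_le[OF n(1)] .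
    ultimately have "?a n \<le> ln R * (ln R)\<^sup>2" by (intro mult_mono power_mono) (auto simp: mangoldt_nonneg)
    then show "?a n \<le> (ln R) ^ 3" by (simp add: power3_eq_cube power2_eq_square)
  qed
  also have "\<dots> = real (card ?B) * (ln R) ^ 3" by simp
  also have "\<dots> \<le> real (card ?A) * (ln R) ^ 3" using R BA by (intro mult_right_mono) (auto intro!: card_mono)
  also have "\<dots> \<le> (sqrt R + 1) * (log 2 R + 1) * (ln R) ^ 3"
    using R by (intro mult_right_mono card_proper_primepow_le) auto
  finally have "(\<Sum>n\<in>?B. ?a n) \<le> (sqrt R + 1) * (log 2 R + 1) * (ln R) ^ 3" .
  moreover have "0 \<le> (\<Sum>n\<in>?B. ?a n)" by (intro sum_nonneg) (simp add: mangoldt_nonneg)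
  ultimately show ?thesis using eq by linarith
qed

text \<open>The prime number theorem in the form used from here on: relative error of order 1/ln R
  at \<open>y = R\<close>, and the same absolute error for every smaller \<open>y\<close>.\<close>

lemma psum_prime_ln3_approx:
  obtains C where "0 < C"
    "\<forall>\<^sub>F R in at_top. \<forall>y. 0 \<le> y \<and> y \<le> R \<longrightarrow> \<bar>psum prime_ln3 y - y * (ln R)\<^sup>2\<bar> \<le> C * (R * ln R)"
proof -
  let ?a = "\<lambda>n. mangoldt n * (ln (real n))\<^sup>2 :: real" and ?b = "\<lambda>n. (ln (real n))\<^sup>2"
  obtain C where C: "0 < C" "\<And>x. 9 \<le> x \<Longrightarrow> \<bar>psum ?a x - psum ?b x\<bar> \<le> C * (x * ln x)"
    by (rule psum_mangoldt_ln_squared) (rule that; assumption)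
  \<comment> \<open>\<open>K\<close> covers \<open>y < 9\<close>, outside the range of the estimate
    with \<open>C\<close>; a constant is eventually below \<open>R * ln R\<close>.\<close>
  define K where "K = psum ?a 9 + psum ?b 9"
  have a: "0 \<le> ?a n" for n by (simp add: mangoldt_nonneg)
  have "\<forall>\<^sub>F R::real in at_top. (sqrt R + 1) * (log 2 R + 1) * (ln R) ^ 3 \<le> R * ln R" by real_asymp
  moreover have "\<forall>\<^sub>F R::real in at_top. K \<le> R * ln R" by real_asymp
  ultimately have "\<forall>\<^sub>F R in at_top. \<forall>y. 0 \<le> y \<and> y \<le> R \<longrightarrow> \<bar>psum prime_ln3 y - y * (ln R)\<^sup>2\<bar> \<le> (C + 5) * (R * ln R)"
    using eventually_ge_at_top[of 9] eventually_ge_at_top[of "exp 1"]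
  proof eventually_elim
    case (elim R)
    show ?case
    proof (intro allI impI, elim conjE)
      fix y assume y: "0 \<le> y" "y \<le> R"
      have 1: "\<bar>psum prime_ln3 y - psum ?a y\<bar> \<le> R * ln R"
        using psum_prime_ln3_diff[of R y] y elim by linarith
      have 2: "\<bar>psum ?b y - y * (ln R)\<^sup>2\<bar> \<le> 3 * (R * ln R)"
        by (rule psum_ln_squared_approx) (use y elim in auto)
      have RL: "0 \<le> R * ln R" using elim by simp
      have 3: "\<bar>psum ?a y - psum ?b y\<bar> \<le> (C + 1) * (R * ln R)"
      proof (cases "9 \<le> y")
        case True
        have "\<bar>psum ?a y - psum ?b y\<bar> \<le> C * (y * ln y)" by (rule C(2)[OF True])
        also have "\<dots> \<le> C * (R * ln R)" using True y C by (intro mult_left_mono mult_mono) auto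
        also have "\<dots> \<le> (C + 1) * (R * ln R)" using RL by (intro mult_right_mono) auto
        finally show ?thesis .
      next
        case False
        have "psum ?a y \<le> psum ?a 9" "psum ?b y \<le> psum ?b 9" "0 \<le> psum ?a y" "0 \<le> psum ?b y"
          by ((rule psum_mono psum_nonneg; use y False a in simp)+)
        then have "\<bar>psum ?a y - psum ?b y\<bar> \<le> K" unfolding K_def by linarith
        also have "\<dots> \<le> R * ln R" by (rule elim)
        also have "\<dots> \<le> (C + 1) * (R * ln R)" using RL C by (simp add: distrib_right)
        finally show ?thesis .
      qed
      have "(C + 5) * (R * ln R) = R * ln R + 3 * (R * ln R) + (C + 1) * (R * ln R)" by (simp add: algebra_simps)
      then show "\<bar>psum prime_ln3 y - y * (ln R)\<^sup>2\<bar> \<le> (C + 5) * (R * ln R)" using 1 2 3 by linarith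
    qed
  qed
  then show ?thesis using C by (intro that[of "C + 5"]) auto
qed

text \<open>Bounding \<open>ln (R / n)\<close> by \<open>ln R\<close> would only give order R ln^3
  R. The averaged estimate saves a logarithm, because \<open>ln (R / n)\<close> sums to O(R) over
  all integers up to \<open>R\<close>.\<close>

lemma psum_log_prime_ln3_bound:
  obtains C where "0 < C" "\<forall>\<^sub>F R in at_top. psum_log prime_ln3 R \<le> C * (R * (ln R)\<^sup>2)"
proof -
  let ?a = "\<lambda>n. mangoldt n * (ln (real n))\<^sup>2 :: real" and ?b = "\<lambda>n. (ln (real n))\<^sup>2"
  obtain C where C: "0 < C" "\<And>x. 3 \<le> x \<Longrightarrow> \<bar>psum_log ?a x - psum_log ?b x\<bar> \<le> C * x"
    by (rule psum_mangoldt_ln_squared) (rule that; assumption)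
  have "\<forall>\<^sub>F R in at_top. psum_log prime_ln3 R \<le> (C + 1) * (R * (ln R)\<^sup>2)"
    using eventually_ge_at_top[of 3]
  proof eventually_elim
    case (elim R)
    have "ln (exp 1) \<le> ln R" using elim exp_le by (intro ln_mono) auto
    then have L: "1 \<le> (ln R)\<^sup>2" by (simp add: one_le_power)
    have q: "0 \<le> ln (R / real n)" "0 < n" "ln (real n) \<le> ln R" if "n \<in> {1..nat \<lfloor>R\<rfloor>}" for n
    proof -
      have "real n \<le> R" "0 < n" using that elim by (auto simp: le_nat_iff le_floor_iff)
      then show "0 \<le> ln (R / real n)" "0 < n" "ln (real n) \<le> ln R" by (auto intro!: ln_ge_zero)
    qed
    have "psum_log prime_ln3 R \<le> psum_log ?a R"
      unfolding psum_log_def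
      by (intro sum_mono mult_right_mono q) (auto simp: prime_ln3_def power3_eq_cube power2_eq_square mangoldt_nonneg)
    also have "\<dots> \<le> psum_log ?b R + C * R" using C(2)[OF elim] by linarith
    also have "psum_log ?b R \<le> (\<Sum>n = 1..nat \<lfloor>R\<rfloor>. (ln R)\<^sup>2 * ln (R / real n))"
      unfolding psum_log_def by (intro sum_mono mult_right_mono power_mono q) auto
    also have "\<dots> = (ln R)\<^sup>2 * psum_log (\<lambda>_. 1) R" by (simp add: psum_log_def sum_distrib_left)
    also have "\<dots> \<le> (ln R)\<^sup>2 * R" using elim by (intro mult_left_mono sum_ln_quotient_le) auto
    also have "C * R \<le> C * (R * (ln R)\<^sup>2)" using C elim L by simp
    finally show ?case by (simp add: algebra_simps)
  qed
  then show ?thesis using C by (intro that[of "C + 1"]) auto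
qed

text \<open>Primes below \<open>sqrt R\<close> are negligible, and for the others \<open>prime_ln3 p\<close> is at least \<open>(ln R) ^ 3 / 8\<close>.\<close>
lemma sum_primes_ln_quotient:
  obtains C where "0 < C"
    "\<forall>\<^sub>F R in at_top. (\<Sum>p | prime p \<and> real p \<le> R. ln (R / real p)) \<le> C * (R / ln R)"
    "\<forall>\<^sub>F R in at_top. real (card {p::nat. prime p \<and> real p \<le> R}) \<le> C * (R / ln R)"
proof -
  obtain A where A: "0 < A" "\<forall>\<^sub>F R in at_top. psum_log prime_ln3 R \<le> A * (R * (ln R)\<^sup>2)"
    using psum_log_prime_ln3_bound by blast
  obtain B where B: "0 < B" "\<forall>\<^sub>F R in at_top. \<forall>y. 0 \<le> y \<and> y \<le> R \<longrightarrow> \<bar>psum prime_ln3 y - y * (ln R)\<^sup>2\<bar> \<le> B * (R * ln R)"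
    using psum_prime_ln3_approx by blast
  \<comment> \<open>Applied to \<open>ln (R / p)\<close> with \<open>M = ln R\<close>, and to the
    constant 1 with \<open>M = 1\<close> for the count of primes.\<close>
  have split: "(\<Sum>p | prime p \<and> real p \<le> R. g p) \<le> sqrt R * M + 8 / (ln R) ^ 3 * (\<Sum>n = 1..nat \<lfloor>R\<rfloor>. prime_ln3 n * g n)"
    if R: "3 \<le> R" and M: "0 \<le> M" and g: "\<And>n. 0 < n \<Longrightarrow> real n \<le> R \<Longrightarrow> 0 \<le> g n \<and> g n \<le> M" for R M :: real and g :: "nat \<Rightarrow> real"
  proof -
    let ?P = "{p::nat. prime p \<and> real p \<le> R}"
    have fin: "finite ?P" by (rule finite_subset[of _ "{..nat \<lfloor>R\<rfloor>}"]) (auto simp: le_nat_floor)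
    have L: "0 < ln R" using R by simp
    have pos: "0 < p" if "p \<in> ?P" for p using that prime_gt_0_nat by auto
    have "(\<Sum>p\<in>?P. g p) = (\<Sum>p\<in>?P \<inter> {p. real p \<le> sqrt R}. g p) + (\<Sum>p\<in>?P - {p. real p \<le> sqrt R}. g p)"
      by (rule sum.Int_Diff[OF fin])
    also have "(\<Sum>p\<in>?P \<inter> {p. real p \<le> sqrt R}. g p) \<le> (\<Sum>p\<in>{1..nat \<lfloor>sqrt R\<rfloor>}. M)"
    proof -
      have "(\<Sum>p\<in>?P \<inter> {p. real p \<le> sqrt R}. g p) \<le> (\<Sum>p\<in>?P \<inter> {p. real p \<le> sqrt R}. M)"
        using g pos by (intro sum_mono) auto
      also have "\<dots> \<le> (\<Sum>p\<in>{1..nat \<lfloor>sqrt R\<rfloor>}. M)"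
        using M by (intro sum_mono2) (auto simp: le_nat_floor Suc_le_eq prime_gt_0_nat)
      finally show ?thesis .
    qed
    also have "\<dots> \<le> sqrt R * M" using M R by (simp add: mult_right_mono)
    also have "(\<Sum>p\<in>?P - {p. real p \<le> sqrt R}. g p) \<le> (\<Sum>p\<in>?P - {p. real p \<le> sqrt R}. 8 / (ln R) ^ 3 * (prime_ln3 p * g p))"
    proof (rule sum_mono)
      fix p assume p: "p \<in> ?P - {p. real p \<le> sqrt R}"
      then have "ln (sqrt R) \<le> ln (real p)" using R by (intro ln_mono) auto
      then have "ln R / 2 \<le> ln (real p)" using R by (simp add: ln_sqrt)
      then have "(ln R / 2) ^ 3 \<le> prime_ln3 p" using p L unfolding prime_ln3_def by (auto intro!: power_mono)
      then have "1 \<le> 8 / (ln R) ^ 3 * prime_ln3 p" using L by (simp add: field_simps)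
      moreover have "0 \<le> g p" using g[of p] p pos by auto
      ultimately show "g p \<le> 8 / (ln R) ^ 3 * (prime_ln3 p * g p)"
        using mult_right_mono[of 1 "8 / (ln R) ^ 3 * prime_ln3 p" "g p"] by (simp add: mult_ac)
    qed
    also have "\<dots> \<le> (\<Sum>p = 1..nat \<lfloor>R\<rfloor>. 8 / (ln R) ^ 3 * (prime_ln3 p * g p))"
    proof (rule sum_mono2)
      fix n assume "n \<in> {1..nat \<lfloor>R\<rfloor>} - (?P - {p. real p \<le> sqrt R})"
      then have "0 < n" "real n \<le> R" using R by (auto simp: le_nat_iff le_floor_iff)
      then show "0 \<le> 8 / (ln R) ^ 3 * (prime_ln3 n * g n)" using g[of n] L prime_ln3_nonneg[of n] by simp
    qed (auto simp: le_nat_floor Suc_le_eq prime_gt_0_nat)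
    also have "\<dots> = 8 / (ln R) ^ 3 * (\<Sum>n = 1..nat \<lfloor>R\<rfloor>. prime_ln3 n * g n)" by (simp add: sum_distrib_left)
    finally show ?thesis by simp
  qed
  have ev: "\<forall>\<^sub>F R::real in at_top. sqrt R * ln R \<le> R / ln R" "\<forall>\<^sub>F R::real in at_top. sqrt R * 1 \<le> R / ln R" by real_asymp+
  have 1: "\<forall>\<^sub>F R in at_top. (\<Sum>p | prime p \<and> real p \<le> R. ln (R / real p)) \<le> (8 * A + 8 * B + 9) * (R / ln R)"
    using ev(1) A(2) eventually_ge_at_top[of 3]
  proof eventually_elim
    case (elim R)
    have L: "0 < ln R" using elim by simp
    have "(\<Sum>p | prime p \<and> real p \<le> R. ln (R / real p)) \<le> sqrt R * ln R + 8 / (ln R) ^ 3 * psum_log prime_ln3 R"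
      unfolding psum_log_def
    proof (rule split)
      fix n :: nat assume n: "0 < n" "real n \<le> R"
      then have "ln (R / real n) \<le> ln R" using elim by (simp add: ln_div)
      then show "0 \<le> ln (R / real n) \<and> ln (R / real n) \<le> ln R" using n by (auto intro!: ln_ge_zero)
    qed (use elim L in auto)
    also have "8 / (ln R) ^ 3 * psum_log prime_ln3 R \<le> 8 / (ln R) ^ 3 * (A * (R * (ln R)\<^sup>2))"
      using elim L by (intro mult_left_mono) auto
    also have "\<dots> = 8 * A * (R / ln R)" using L by (simp add: power3_eq_cube power2_eq_square)
    also have "sqrt R * ln R + 8 * A * (R / ln R) \<le> (8 * A + 1) * (R / ln R)"
      using elim(1) by (simp only: distrib_right mult_1_left add.commute add_le_cancel_right)
    also have "\<dots> \<le> (8 * A + 8 * B + 9) * (R / ln R)" using B L elim by (intro mult_right_mono) auto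
    finally show ?case by simp
  qed
  have 2: "\<forall>\<^sub>F R in at_top. real (card {p::nat. prime p \<and> real p \<le> R}) \<le> (8 * A + 8 * B + 9) * (R / ln R)"
    using ev(2) B(2) eventually_ge_at_top[of 3]
  proof eventually_elim
    case (elim R)
    have "exp 1 \<le> R" using elim exp_le by linarith
    then have "ln (exp 1) \<le> ln R" by (intro ln_mono) auto
    then have L: "1 \<le> ln R" by simp
    have "real (card {p::nat. prime p \<and> real p \<le> R}) = (\<Sum>p | prime p \<and> real p \<le> R. 1)" by simp
    also have "\<dots> \<le> sqrt R * 1 + 8 / (ln R) ^ 3 * (\<Sum>n = 1..nat \<lfloor>R\<rfloor>. prime_ln3 n * 1)"
      by (rule split) (use elim in auto)
    also have "(\<Sum>n = 1..nat \<lfloor>R\<rfloor>. prime_ln3 n * 1) = psum prime_ln3 R" by (simp add: psum_def)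
    also have "psum prime_ln3 R \<le> R * (ln R)\<^sup>2 + B * (R * ln R)" using elim(2)[rule_format, of R] elim(3) by simp
    also have "B * (R * ln R) \<le> B * (R * (ln R)\<^sup>2)"
      using B L elim by (intro mult_left_mono) (auto simp: power2_eq_square mult_left_mono)
    also have "8 / (ln R) ^ 3 * (R * (ln R)\<^sup>2 + B * (R * (ln R)\<^sup>2)) = (8 + 8 * B) * (R / ln R)"
      using L by (simp add: power3_eq_cube power2_eq_square field_simps)
    finally have "real (card {p::nat. prime p \<and> real p \<le> R}) \<le> sqrt R * 1 + (8 + 8 * B) * (R / ln R)"
      using L by (simp add: divide_right_mono)
    also have "\<dots> \<le> R / ln R + (8 + 8 * B) * (R / ln R)" using elim(1) by (rule add_right_mono)
    also have "\<dots> = (9 + 8 * B) * (R / ln R)"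
      using distrib_right[of 1 "8 + 8 * B" "R / ln R"] by simp
    also have "\<dots> \<le> (8 * A + 8 * B + 9) * (R / ln R)" using A L elim by (intro mult_right_mono) auto
    finally show ?case by simp
  qed
  show ?thesis by (rule that[OF _ 1 2]) (use A B in auto)
qed

section \<open>Pairs of primes\<close>

definition prime_pairs :: "real \<Rightarrow> (nat \<times> nat) set" where
  "prime_pairs x = {(p, q). prime p \<and> prime q \<and> (real p)\<^sup>2 + (real q)\<^sup>2 \<le> x}"

lemma sum_r2_eq_card:
  assumes "0 \<le> x"
  shows "(\<Sum>n\<in>{n::nat. 1 \<le> n \<and> real n \<le> x}. real (r2 n)) = real (card (prime_pairs x))"
proof -
  let ?N = "{n::nat. 1 \<le> n \<and> real n \<le> x}"
  let ?A = "\<lambda>n. {(p, q). prime (p::nat) \<and> prime (q::nat) \<and> p\<^sup>2 + q\<^sup>2 = n}"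
  have finN: "finite ?N" by (rule finite_subset[of _ "{..nat \<lfloor>x\<rfloor>}"]) (auto simp: le_nat_floor)
  have finA: "finite (?A n)" for n
  proof (rule finite_subset[of _ "{..n} \<times> {..n}"])
    show "?A n \<subseteq> {..n} \<times> {..n}"
      by (auto intro: order_trans[OF self_le_power, of _ 2] trans_le_add1 trans_le_add2 simp: prime_gt_0_nat Suc_le_eq)
  qed auto
  have "prime_pairs x = (\<Union>n\<in>?N. ?A n)"
  proof (intro equalityI subsetI)
    fix z assume "z \<in> prime_pairs x"
    then obtain p q where z: "z = (p, q)" "prime p" "prime q" "(real p)\<^sup>2 + (real q)\<^sup>2 \<le> x"
      by (auto simp: prime_pairs_def)
    have "real (p\<^sup>2 + q\<^sup>2) \<le> x" using z by simp
    moreover have "1 \<le> p\<^sup>2 + q\<^sup>2" using prime_gt_0_nat[OF z(2)] by (simp add: Suc_le_eq)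
    ultimately show "z \<in> (\<Union>n\<in>?N. ?A n)" using z by blast
  qed (auto simp: prime_pairs_def)
  then have "card (prime_pairs x) = (\<Sum>n\<in>?N. card (?A n))"
    using finN finA by (simp only:) (rule card_UN_disjoint, auto)
  then show ?thesis by (simp add: r2_def)
qed

lemma integral_quarter_disc:
  assumes "0 < R"
  shows "((\<lambda>v. sqrt (R\<^sup>2 - v\<^sup>2)) has_integral (pi / 4 * R\<^sup>2)) {0..R}"
proof -
  define F where "F = (\<lambda>v. (v * sqrt (R\<^sup>2 - v\<^sup>2) + R\<^sup>2 * arcsin (v / R)) / 2)"
  \<comment> \<open>Differentiability is asked for in the interior only, since the derivatives of
    the square root and of the arcsine blow up at \<open>v = R\<close>.\<close>
  have "((\<lambda>v. sqrt (R\<^sup>2 - v\<^sup>2)) has_integral (F R - F 0)) {0..R}"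
  proof (rule fundamental_theorem_of_calculus_interior)
    show "continuous_on {0..R} F" unfolding F_def
      using assms by (intro continuous_intros) (auto intro: order_trans[of "-1" 0])
    fix v assume v: "v \<in> {0<..<R}"
    then have q: "0 < R\<^sup>2 - v\<^sup>2" using assms by (simp add: power_strict_mono)
    define s where "s = sqrt (R\<^sup>2 - v\<^sup>2)"
    have s: "0 < s" "s\<^sup>2 = R\<^sup>2 - v\<^sup>2" using q by (auto simp: s_def)
    have "sqrt (1 - (v / R)\<^sup>2) = s / R"
    proof -
      have "1 - (v / R)\<^sup>2 = (s / R)\<^sup>2" using s assms by (simp add: power_divide field_simps)
      then show ?thesis using s assms by simp
    qed
    then have "((\<lambda>v. arcsin (v / R)) has_real_derivative inverse (s / R) * (1 / R)) (at v)"
      using v assms by (auto intro!: derivative_eq_intros simp: field_simps)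
    moreover have "((\<lambda>v. sqrt (R\<^sup>2 - v\<^sup>2)) has_real_derivative (- v / s)) (at v)"
      using q by (auto intro!: derivative_eq_intros simp: s_def field_simps)
    ultimately have "(F has_real_derivative (1 * s + (- v / s) * v + R\<^sup>2 * (inverse (s / R) * (1 / R))) / 2) (at v)"
      unfolding F_def s_def by (intro DERIV_cdivide DERIV_add DERIV_mult DERIV_cmult DERIV_ident) auto
    also have "(1 * s + (- v / s) * v + R\<^sup>2 * (inverse (s / R) * (1 / R))) / 2 = (s\<^sup>2 + (R\<^sup>2 - v\<^sup>2)) / (2 * s)"
      using s(1) assms by (simp add: field_simps power2_eq_square)
    also have "\<dots> = s" unfolding s(2)[symmetric] using s(1) by (simp add: power2_eq_square)
    finally show "(F has_vector_derivative sqrt (R\<^sup>2 - v\<^sup>2)) (at v)"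
      by (simp add: s_def has_real_derivative_iff_has_vector_derivative)
  qed (use assms in auto)
  also have "F R - F 0 = pi / 4 * R\<^sup>2" using assms by (simp add: F_def)
  finally show ?thesis .
qed

lemma psum_prime_ln3_eq:
  assumes "0 \<le> y"
  shows "psum prime_ln3 y = (\<Sum>p | prime p \<and> real p \<le> y. (ln (real p)) ^ 3)"
proof -
  have "psum prime_ln3 y = (\<Sum>n\<in>{n \<in> {1..nat \<lfloor>y\<rfloor>}. prime n}. (ln (real n)) ^ 3)"
    unfolding psum_def prime_ln3_def by (rule sum.inter_filter[symmetric]) simp
  also have "{n \<in> {1..nat \<lfloor>y\<rfloor>}. prime n} = {p. prime p \<and> real p \<le> y}"
    using assms by (auto simp: le_nat_iff le_floor_iff prime_gt_0_nat Suc_le_eq)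
  finally show ?thesis .
qed

lemma finite_primes_le: "finite {p::nat. prime p \<and> real p \<le> R}"
  by (rule finite_subset[of _ "{..nat \<lfloor>R\<rfloor>}"]) (auto simp: le_nat_floor)

lemma le_sqrt_diff_iff:
  assumes "0 \<le> a" "0 \<le> b" "a \<le> R" 
  shows "b \<le> sqrt (R\<^sup>2 - a\<^sup>2) \<longleftrightarrow> a\<^sup>2 + b\<^sup>2 \<le> R\<^sup>2"
proof -
  have "b \<le> sqrt (R\<^sup>2 - a\<^sup>2) \<longleftrightarrow> sqrt (b\<^sup>2) \<le> sqrt (R\<^sup>2 - a\<^sup>2)" using assms by simp
  also have "\<dots> \<longleftrightarrow> b\<^sup>2 \<le> R\<^sup>2 - a\<^sup>2" by (rule real_sqrt_le_iff)
  finally show ?thesis by auto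
qed

text \<open>\<open>p \<le> sqrt (R\<^sup>2 - v\<^sup>2)\<close> and
  \<open>v \<le> sqrt (R\<^sup>2 - p\<^sup>2)\<close> are the same condition. Writing the second
  root as the length of an interval and exchanging sum and integral does the work of partial
  summation.\<close>

lemma sum_prime_ln3_sqrt_eq_integral:
  assumes R: "0 < R"
  shows "((\<lambda>v. psum prime_ln3 (sqrt (R\<^sup>2 - v\<^sup>2))) has_integral
    (\<Sum>p | prime p \<and> real p \<le> R. (ln (real p)) ^ 3 * sqrt (R\<^sup>2 - (real p)\<^sup>2))) {0..R}"
proof -
  let ?P = "{p::nat. prime p \<and> real p \<le> R}"
  have "((\<lambda>v. \<Sum>p\<in>?P. (ln (real p)) ^ 3 * (if v \<in> {0..sqrt (R\<^sup>2 - (real p)\<^sup>2)} then 1 else 0)) has_integral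
    (\<Sum>p\<in>?P. (ln (real p)) ^ 3 * sqrt (R\<^sup>2 - (real p)\<^sup>2))) {0..R}"
  proof (intro has_integral_sum finite_primes_le has_integral_mult_right)
    fix p assume p: "p \<in> ?P"
    define b where "b = sqrt (R\<^sup>2 - (real p)\<^sup>2)"
    have "(real p)\<^sup>2 \<le> R\<^sup>2" using p by (intro power_mono) auto
    then have b: "0 \<le> b" by (simp add: b_def)
    have "b \<le> sqrt (R\<^sup>2)" unfolding b_def by (intro real_sqrt_le_mono) simp
    then have bR: "b \<le> R" using R by simp
    have "((\<lambda>v. 1::real) has_integral b) {0..b}" using has_integral_const_real[of "1::real" 0 b] b by simp
    then have "((\<lambda>v. if v \<in> {0..b} then 1 else (0::real)) has_integral b) {0..R}"
      using bR by (subst has_integral_restrict) auto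
    then show "((\<lambda>v. if v \<in> {0..sqrt (R\<^sup>2 - (real p)\<^sup>2)} then 1 else 0) has_integral sqrt (R\<^sup>2 - (real p)\<^sup>2)) {0..R}"
      by (simp add: b_def)
  qed
  moreover have "(\<Sum>p\<in>?P. (ln (real p)) ^ 3 * (if v \<in> {0..sqrt (R\<^sup>2 - (real p)\<^sup>2)} then 1 else 0)) = psum prime_ln3 (sqrt (R\<^sup>2 - v\<^sup>2))"
    if v: "v \<in> {0..R}" for v
  proof -
    have le: "sqrt (R\<^sup>2 - v\<^sup>2) \<le> R" using real_sqrt_le_mono[of "R\<^sup>2 - v\<^sup>2" "R\<^sup>2"] R by simp
    have "v\<^sup>2 \<le> R\<^sup>2" using v by (intro power_mono) auto
    then have "psum prime_ln3 (sqrt (R\<^sup>2 - v\<^sup>2)) = (\<Sum>p | prime p \<and> real p \<le> sqrt (R\<^sup>2 - v\<^sup>2). (ln (real p)) ^ 3)"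
      by (intro psum_prime_ln3_eq) simp
    also have "\<dots> = (\<Sum>p\<in>{p \<in> ?P. real p \<le> sqrt (R\<^sup>2 - v\<^sup>2)}. (ln (real p)) ^ 3)"
      using le by (intro sum.cong) auto
    also have "\<dots> = (\<Sum>p\<in>?P. if real p \<le> sqrt (R\<^sup>2 - v\<^sup>2) then (ln (real p)) ^ 3 else 0)"
      by (rule sum.inter_filter[OF finite_primes_le])
    also have "\<dots> = (\<Sum>p\<in>?P. (ln (real p)) ^ 3 * (if v \<in> {0..sqrt (R\<^sup>2 - (real p)\<^sup>2)} then 1 else 0))"
    proof (rule sum.cong)
      fix p assume "p \<in> ?P"
      then have "real p \<le> sqrt (R\<^sup>2 - v\<^sup>2) \<longleftrightarrow> v \<le> sqrt (R\<^sup>2 - (real p)\<^sup>2)"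
        using v by (simp add: le_sqrt_diff_iff add.commute)
      then show "(if real p \<le> sqrt (R\<^sup>2 - v\<^sup>2) then (ln (real p)) ^ 3 else 0) =
          (ln (real p)) ^ 3 * (if v \<in> {0..sqrt (R\<^sup>2 - (real p)\<^sup>2)} then 1 else 0)"
        using v by simp
    qed simp
    finally show ?thesis by simp
  qed
  ultimately show ?thesis by (rule has_integral_eq[rotated])
qed

lemma prime_pairs_Sigma:
  assumes "0 < R"
  shows "prime_pairs (R\<^sup>2) = (SIGMA p:{p. prime p \<and> real p \<le> R}. {q. prime q \<and> real q \<le> sqrt (R\<^sup>2 - (real p)\<^sup>2)})"
proof -
  have "real p \<le> R" if "(real p)\<^sup>2 + (real q)\<^sup>2 \<le> R\<^sup>2" for p q :: nat
  proof -
    have "(real p)\<^sup>2 \<le> R\<^sup>2" using that zero_le_power2[of "real q"] by linarith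
    then show ?thesis using assms by (simp add: power2_le_iff_abs_le)
  qed
  then show ?thesis using assms by (auto simp: prime_pairs_def le_sqrt_diff_iff)
qed

text \<open>\<open>psum_prime_ln3_approx\<close> is applied twice: to the sum over \<open>q\<close>,
  whose main term leaves a weighted sum of sqrt(R^2 - p^2) over \<open>p\<close>, and, once that sum
  is an integral over \<open>v\<close>, to its integrand, whose main term integrates to the area of
  the quarter disc.\<close>

lemma weighted_prime_pairs:
  obtains C where "0 < C" "\<forall>\<^sub>F R in at_top.
    \<bar>(\<Sum>(p, q)\<in>prime_pairs (R\<^sup>2). (ln (real p)) ^ 3 * (ln (real q)) ^ 3) - pi / 4 * R\<^sup>2 * (ln R) ^ 4\<bar> \<le> C * (R\<^sup>2 * (ln R) ^ 3)"
proof -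
  obtain B where B: "0 < B" "\<forall>\<^sub>F R in at_top. \<forall>y. 0 \<le> y \<and> y \<le> R \<longrightarrow> \<bar>psum prime_ln3 y - y * (ln R)\<^sup>2\<bar> \<le> B * (R * ln R)"
    using psum_prime_ln3_approx by blast
  have "\<forall>\<^sub>F R in at_top. \<bar>(\<Sum>(p, q)\<in>prime_pairs (R\<^sup>2). (ln (real p)) ^ 3 * (ln (real q)) ^ 3) - pi / 4 * R\<^sup>2 * (ln R) ^ 4\<bar>
      \<le> (B * (1 + B) + B) * (R\<^sup>2 * (ln R) ^ 3)"
    using B(2) eventually_ge_at_top[of 3]
  proof eventually_elim
    case (elim R)
    define L where "L = ln R"
    have "exp 1 \<le> R" using elim exp_le by linarith
    then have "ln (exp 1) \<le> ln R" by (intro ln_mono) auto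
    then have L: "1 \<le> L" by (simp add: L_def)
    have R: "0 < R" using elim by simp
    let ?P = "{p::nat. prime p \<and> real p \<le> R}"
    let ?w = "\<lambda>p::nat. (ln (real p)) ^ 3"
    let ?y = "\<lambda>v. sqrt (R\<^sup>2 - v\<^sup>2)"
    have y: "0 \<le> ?y v \<and> ?y v \<le> R" if "0 \<le> v" "v \<le> R" for v
    proof -
      have "v\<^sup>2 \<le> R\<^sup>2" using that by (intro power_mono) auto
      then show ?thesis using real_sqrt_le_mono[of "R\<^sup>2 - v\<^sup>2" "R\<^sup>2"] R by simp
    qed
    have Q: "\<bar>psum prime_ln3 (?y v) - ?y v * L\<^sup>2\<bar> \<le> B * (R * L)" if "0 \<le> v" "v \<le> R" for v
      unfolding L_def using elim(1)[rule_format, OF y[OF that]] .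
    define I where "I = (\<Sum>p\<in>?P. ?w p * ?y (real p))"
    have w: "0 \<le> ?w p" if "p \<in> ?P" for p using that prime_ge_1_nat by auto
    have W: "(\<Sum>(p, q)\<in>prime_pairs (R\<^sup>2). ?w p * ?w q) = (\<Sum>p\<in>?P. ?w p * psum prime_ln3 (?y (real p)))"
    proof -
      have "(\<Sum>(p, q)\<in>prime_pairs (R\<^sup>2). ?w p * ?w q)
        = (\<Sum>p\<in>?P. \<Sum>q | prime q \<and> real q \<le> ?y (real p). ?w p * ?w q)"
        unfolding prime_pairs_Sigma[OF R] by (rule sum.Sigma[symmetric]) (auto intro: finite_primes_le)
      also have "\<dots> = (\<Sum>p\<in>?P. ?w p * psum prime_ln3 (?y (real p)))"
      proof (rule sum.cong)
        fix p assume "p \<in> ?P"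
        then have "0 \<le> ?y (real p)" using y[of "real p"] by auto
        then show "(\<Sum>q | prime q \<and> real q \<le> ?y (real p). ?w p * ?w q) = ?w p * psum prime_ln3 (?y (real p))"
          by (simp add: psum_prime_ln3_eq sum_distrib_left)
      qed simp
      finally show ?thesis .
    qed
    \<comment> \<open>First replacement: an error \<open>B * (R * L)\<close> for each
      \<open>p\<close>, against a total weight of order R L^2.\<close>
    have "\<bar>(\<Sum>p\<in>?P. ?w p * psum prime_ln3 (?y (real p))) - L\<^sup>2 * I\<bar> = \<bar>\<Sum>p\<in>?P. ?w p * (psum prime_ln3 (?y (real p)) - ?y (real p) * L\<^sup>2)\<bar>"
      unfolding I_def sum_distrib_left sum_subtractf[symmetric] by (intro arg_cong[of _ _ abs] sum.cong) (auto simp: algebra_simps)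
    also have "\<dots> \<le> (\<Sum>p\<in>?P. ?w p * (B * (R * L)))"
    proof (rule order_trans[OF sum_abs], rule sum_mono)
      fix p assume p: "p \<in> ?P"
      have "\<bar>?w p * (psum prime_ln3 (?y (real p)) - ?y (real p) * L\<^sup>2)\<bar> = ?w p * \<bar>psum prime_ln3 (?y (real p)) - ?y (real p) * L\<^sup>2\<bar>"
        using w[OF p] by (simp add: abs_mult)
      also have "\<dots> \<le> ?w p * (B * (R * L))" using p by (intro mult_left_mono Q w) auto
      finally show "\<bar>?w p * (psum prime_ln3 (?y (real p)) - ?y (real p) * L\<^sup>2)\<bar> \<le> ?w p * (B * (R * L))" .
    qed
    also have "\<dots> = psum prime_ln3 R * (B * (R * L))" using R by (simp add: psum_prime_ln3_eq sum_distrib_right)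
    also have "psum prime_ln3 R \<le> (1 + B) * (R * L\<^sup>2)"
    proof -
      have "psum prime_ln3 R \<le> R * L\<^sup>2 + B * (R * L)" using elim(1)[rule_format, of R] R by (simp add: L_def)
      also have "B * (R * L) \<le> B * (R * L\<^sup>2)"
        using B L R by (intro mult_left_mono) (auto simp: power2_eq_square)
      finally show ?thesis by (simp add: distrib_right)
    qed
    also have "(1 + B) * (R * L\<^sup>2) * (B * (R * L)) = B * (1 + B) * (R\<^sup>2 * L ^ 3)"
      by (simp add: power2_eq_square power3_eq_cube)
    finally have 1: "\<bar>(\<Sum>p\<in>?P. ?w p * psum prime_ln3 (?y (real p))) - L\<^sup>2 * I\<bar> \<le> B * (1 + B) * (R\<^sup>2 * L ^ 3)"
      using B R L by (simp add: mult_right_mono)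
    \<comment> \<open>Second replacement: the same error over an interval of length
      \<open>R\<close>, later multiplied by the \<open>L\<^sup>2\<close> left from the
      first.\<close>
    have int: "((\<lambda>v. psum prime_ln3 (?y v) - ?y v * L\<^sup>2) has_integral (I - pi / 4 * R\<^sup>2 * L\<^sup>2)) {0..R}"
      unfolding I_def by (intro has_integral_diff sum_prime_ln3_sqrt_eq_integral[OF R] has_integral_mult_left integral_quarter_disc[OF R])
    have "norm (I - pi / 4 * R\<^sup>2 * L\<^sup>2) \<le> B * (R * L) * measure lborel {0..R}"
      by (rule has_integral_bound_real[OF _ finite.emptyI int]) (use B R L Q in auto)
    then have "\<bar>I - pi / 4 * R\<^sup>2 * L\<^sup>2\<bar> \<le> B * (R\<^sup>2 * L)"
      using R by (simp add: power2_eq_square mult_ac)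
    then have "L\<^sup>2 * \<bar>I - pi / 4 * R\<^sup>2 * L\<^sup>2\<bar> \<le> L\<^sup>2 * (B * (R\<^sup>2 * L))" by (rule mult_left_mono) simp
    then have 2: "\<bar>L\<^sup>2 * I - pi / 4 * R\<^sup>2 * L ^ 4\<bar> \<le> B * (R\<^sup>2 * L ^ 3)"
    proof -
      have "\<bar>L\<^sup>2 * I - pi / 4 * R\<^sup>2 * L ^ 4\<bar> = \<bar>L\<^sup>2 * (I - pi / 4 * R\<^sup>2 * L\<^sup>2)\<bar>"
        by (simp add: power_eq_if right_diff_distrib mult_ac)
      also have "\<dots> = L\<^sup>2 * \<bar>I - pi / 4 * R\<^sup>2 * L\<^sup>2\<bar>" by (simp add: abs_mult)
      also have "\<dots> \<le> L\<^sup>2 * (B * (R\<^sup>2 * L))" by fact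
      finally show ?thesis by (simp add: power3_eq_cube power2_eq_square mult_ac)
    qed
    have "(B * (1 + B) + B) * (R\<^sup>2 * L ^ 3) = B * (1 + B) * (R\<^sup>2 * L ^ 3) + B * (R\<^sup>2 * L ^ 3)"
      by (rule distrib_right)
    then show ?case using 1 2 unfolding W L_def[symmetric] by linarith
  qed
  moreover have "0 < B * (1 + B) + B" using B(1) by (simp add: add_pos_pos)
  ultimately show ?thesis using that by blast
qed

text \<open>The weight of a pair falls short of \<open>(ln R) ^ 6\<close> by at most
  \<open>3 * (ln R) ^ 5 * (ln (R / p) + ln (R / q))\<close>. The number of primes up to
  \<open>R\<close> and the sum of \<open>ln (R / p)\<close> over them are both O(R / ln R), so the
  total shortfall is O(R^2 ln^3 R), the size of the error already present.\<close>

lemma card_prime_pairs: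
  obtains C where "0 < C" "\<forall>\<^sub>F R in at_top.
    \<bar>real (card (prime_pairs (R\<^sup>2))) * (ln R) ^ 6 - pi / 4 * R\<^sup>2 * (ln R) ^ 4\<bar> \<le> C * (R\<^sup>2 * (ln R) ^ 3)"
proof -
  obtain A where A: "0 < A" "\<forall>\<^sub>F R in at_top.
    \<bar>(\<Sum>(p, q)\<in>prime_pairs (R\<^sup>2). (ln (real p)) ^ 3 * (ln (real q)) ^ 3) - pi / 4 * R\<^sup>2 * (ln R) ^ 4\<bar> \<le> A * (R\<^sup>2 * (ln R) ^ 3)"
    using weighted_prime_pairs by blast
  obtain B where B: "0 < B"
    "\<forall>\<^sub>F R in at_top. (\<Sum>p | prime p \<and> real p \<le> R. ln (R / real p)) \<le> B * (R / ln R)"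
    "\<forall>\<^sub>F R in at_top. real (card {p::nat. prime p \<and> real p \<le> R}) \<le> B * (R / ln R)"
    by (rule sum_primes_ln_quotient) (rule that; assumption)
  have "\<forall>\<^sub>F R in at_top. \<bar>real (card (prime_pairs (R\<^sup>2))) * (ln R) ^ 6 - pi / 4 * R\<^sup>2 * (ln R) ^ 4\<bar> \<le> (A + 6 * B\<^sup>2) * (R\<^sup>2 * (ln R) ^ 3)"
    using A(2) B(2,3) eventually_ge_at_top[of 3]
  proof eventually_elim
    case (elim R)
    define L where "L = ln R"
    have R: "0 < R" and L: "0 < L" using elim by (auto simp: L_def)
    let ?P = "{p::nat. prime p \<and> real p \<le> R}"
    let ?w = "\<lambda>p::nat. (ln (real p)) ^ 3"
    let ?l = "\<lambda>p::nat. ln (R / real p)"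
    have P: "0 \<le> ln (real p)" "ln (real p) \<le> L" "?l p = L - ln (real p)" if "p \<in> ?P" for p
      using that prime_ge_1_nat[of p] R by (auto simp: L_def ln_div)
    have l0: "0 \<le> ?l p" if "p \<in> ?P" for p using P[OF that] by simp
    have sub: "prime_pairs (R\<^sup>2) \<subseteq> ?P \<times> ?P"
    proof
      fix z assume z: "z \<in> prime_pairs (R\<^sup>2)"
      then obtain p q where "z = (p, q)" "p \<in> ?P" "prime q" "real q \<le> sqrt (R\<^sup>2 - (real p)\<^sup>2)"
        unfolding prime_pairs_Sigma[OF R] by auto
      moreover have "sqrt (R\<^sup>2 - (real p)\<^sup>2) \<le> R" using real_sqrt_le_mono[of "R\<^sup>2 - (real p)\<^sup>2" "R\<^sup>2"] R by simp
      ultimately show "z \<in> ?P \<times> ?P" by auto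
    qed
    have cube: "L ^ 3 - a ^ 3 \<le> 3 * L\<^sup>2 * (L - a)" "a ^ 3 \<le> L ^ 3" if "0 \<le> a" "a \<le> L" for a
    proof -
      have "L ^ 3 - a ^ 3 = (L\<^sup>2 + L * a + a\<^sup>2) * (L - a)" by (simp add: power3_eq_cube power2_eq_square algebra_simps)
      also have "\<dots> \<le> (L\<^sup>2 + L * L + L\<^sup>2) * (L - a)"
        using that L by (intro mult_right_mono add_mono mult_left_mono power_mono) auto
      also have "\<dots> = 3 * L\<^sup>2 * (L - a)" by (simp add: power2_eq_square)
      finally show "L ^ 3 - a ^ 3 \<le> 3 * L\<^sup>2 * (L - a)" .
      show "a ^ 3 \<le> L ^ 3" using that by (intro power_mono) auto
    qed
    have pair: "0 \<le> L ^ 6 - ?w p * ?w q" "L ^ 6 - ?w p * ?w q \<le> 3 * L ^ 5 * (?l p + ?l q)"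
      if pq: "p \<in> ?P" "q \<in> ?P" for p q
    proof -
      note p = P[OF pq(1)] and q = P[OF pq(2)]
      have L6: "L ^ 6 = L ^ 3 * L ^ 3" by (simp flip: power_add)
      have "?w p * ?w q \<le> L ^ 3 * L ^ 3" using cube(2) p q L by (intro mult_mono) auto
      then show "0 \<le> L ^ 6 - ?w p * ?w q" unfolding L6 by simp
      \<comment> \<open>One factor is exchanged at a time.\<close>
      have "L ^ 6 - ?w p * ?w q = L ^ 3 * (L ^ 3 - ?w p) + ?w p * (L ^ 3 - ?w q)"
        unfolding L6 by (simp add: algebra_simps)
      also have "\<dots> \<le> L ^ 3 * (3 * L\<^sup>2 * ?l p) + L ^ 3 * (3 * L\<^sup>2 * ?l q)"
        unfolding p(3) q(3) using cube p q L by (intro add_mono mult_mono mult_left_mono) auto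
      also have "\<dots> = 3 * L ^ 5 * (?l p + ?l q)" by (simp add: algebra_simps power_eq_if)
      finally show "L ^ 6 - ?w p * ?w q \<le> 3 * L ^ 5 * (?l p + ?l q)" .
    qed
    let ?W = "\<Sum>(p, q)\<in>prime_pairs (R\<^sup>2). ?w p * ?w q"
    have eq: "real (card (prime_pairs (R\<^sup>2))) * L ^ 6 - ?W = (\<Sum>(p, q)\<in>prime_pairs (R\<^sup>2). L ^ 6 - ?w p * ?w q)"
      by (simp add: case_prod_unfold sum_subtractf)
    have lo: "0 \<le> (\<Sum>(p, q)\<in>prime_pairs (R\<^sup>2). L ^ 6 - ?w p * ?w q)"
      by (intro sum_nonneg) (use sub pair(1) in force)
    have "(\<Sum>(p, q)\<in>prime_pairs (R\<^sup>2). L ^ 6 - ?w p * ?w q) \<le> (\<Sum>(p, q)\<in>prime_pairs (R\<^sup>2). 3 * L ^ 5 * (?l p + ?l q))"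
      by (intro sum_mono) (use sub pair(2) in force)
    \<comment> \<open>Enlarging the quarter disc to the full square lets the double sum
      factor.\<close>
    also have "\<dots> \<le> (\<Sum>(p, q)\<in>?P \<times> ?P. 3 * L ^ 5 * (?l p + ?l q))"
    proof (rule sum_mono2[OF _ sub])
      show "finite (?P \<times> ?P)" by (intro finite_cartesian_product finite_primes_le)
      show "0 \<le> (case z of (p, q) \<Rightarrow> 3 * L ^ 5 * (?l p + ?l q))" if "z \<in> ?P \<times> ?P - prime_pairs (R\<^sup>2)" for z
        using that l0 L by (auto intro!: mult_nonneg_nonneg add_nonneg_nonneg)
    qed
    also have "\<dots> = (\<Sum>p\<in>?P. \<Sum>q\<in>?P. 3 * L ^ 5 * (?l p + ?l q))"
      by (rule sum.cartesian_product[symmetric])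
    also have "\<dots> = 3 * L ^ 5 * (\<Sum>p\<in>?P. \<Sum>q\<in>?P. ?l p + ?l q)"
      by (simp only: sum_distrib_left)
    also have "(\<Sum>p\<in>?P. \<Sum>q\<in>?P. ?l p + ?l q) = 2 * (real (card ?P) * (\<Sum>p\<in>?P. ?l p))"
      by (simp add: sum.distrib sum_distrib_left[symmetric])
    also have "3 * L ^ 5 * (2 * (real (card ?P) * (\<Sum>p\<in>?P. ?l p))) = 6 * L ^ 5 * (real (card ?P) * (\<Sum>p\<in>?P. ?l p))"
      by simp
    also have "\<dots> \<le> 6 * L ^ 5 * ((B * (R / L)) * (B * (R / L)))"
      using elim B R L P by (intro mult_left_mono mult_mono sum_nonneg) (auto simp: L_def)
    also have "\<dots> = 6 * B\<^sup>2 * (R\<^sup>2 * L ^ 3)"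
      using L by (simp add: power_eq_if)
    finally have up: "(\<Sum>(p, q)\<in>prime_pairs (R\<^sup>2). L ^ 6 - ?w p * ?w q) \<le> 6 * B\<^sup>2 * (R\<^sup>2 * L ^ 3)" .
    have "(A + 6 * B\<^sup>2) * (R\<^sup>2 * L ^ 3) = A * (R\<^sup>2 * L ^ 3) + 6 * B\<^sup>2 * (R\<^sup>2 * L ^ 3)" by (rule distrib_right)
    then show ?case using elim(1) eq lo up unfolding L_def[symmetric] by linarith
  qed
  then show ?thesis using A by (intro that[of "A + 6 * B\<^sup>2"]) (auto simp: add_pos_nonneg)
qed

theorem lemma3p2p2:
  "\<exists>E :: real \<Rightarrow> real. E \<in> O[at_top](\<lambda>x. 1 / ln x) \<and>
     (\<forall>\<^sub>F x in at_top.
        (\<Sum>n\<in>{n::nat. 1 \<le> n \<and> real n \<le> x}. real (r2 n)) = pi * (x / (ln x)\<^sup>2) * (1 + E x))"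
proof -
  obtain C where C: "0 < C" "\<forall>\<^sub>F R in at_top.
    \<bar>real (card (prime_pairs (R\<^sup>2))) * (ln R) ^ 6 - pi / 4 * R\<^sup>2 * (ln R) ^ 4\<bar> \<le> C * (R\<^sup>2 * (ln R) ^ 3)"
    using card_prime_pairs by blast
  define N where "N = (\<lambda>x. real (card (prime_pairs x)))"
  \<comment> \<open>\<open>E\<close> solves the claimed identity for \<open>x > 1\<close> by
    construction; only its size needs an estimate.\<close>
  define E where "E = (\<lambda>x. N x * (ln x)\<^sup>2 / (pi * x) - 1)"
  have "\<forall>\<^sub>F x in at_top. \<bar>N ((sqrt x)\<^sup>2) * (ln (sqrt x)) ^ 6 - pi / 4 * (sqrt x)\<^sup>2 * (ln (sqrt x)) ^ 4\<bar> \<le> C * ((sqrt x)\<^sup>2 * (ln (sqrt x)) ^ 3)"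
    using eventually_compose_filterlim[OF C(2) sqrt_at_top] by (simp add: N_def)
  then have "\<forall>\<^sub>F x in at_top. norm (E x) \<le> 8 * C / pi * norm (1 / ln x)"
    using eventually_gt_at_top[of 1]
  proof eventually_elim
    case (elim x)
    define L where "L = ln x"
    have L: "0 < L" and x: "0 < x" using elim by (auto simp: L_def)
    have s: "ln (sqrt x) = L / 2" using x by (simp add: L_def ln_sqrt)
    have bd: "\<bar>N x * (L / 2) ^ 6 - pi / 4 * x * (L / 2) ^ 4\<bar> \<le> C * (x * (L / 2) ^ 3)"
      using elim x unfolding s by simp
    \<comment> \<open>With \<open>R = sqrt x\<close> the logarithm halves: (1/2)^6 and (1/4)(1/2)^4
      are both 1/64, which turns \<pi>/4 into \<pi>, while the (1/2)^3 of the error leaves the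
      factor 8 of the final bound.\<close>
    have eq: "N x * (L / 2) ^ 6 - pi / 4 * x * (L / 2) ^ 4 = E x * (pi * x * L ^ 4 / 64)"
      using L x by (simp add: E_def L_def[symmetric] field_simps power_eq_if)
    have "\<bar>E x\<bar> * (pi * x * L ^ 4 / 64) = \<bar>E x * (pi * x * L ^ 4 / 64)\<bar>"
      using L x by (simp add: abs_mult)
    also have "\<dots> \<le> C * (x * (L / 2) ^ 3)" using bd unfolding eq .
    also have "\<dots> = (8 * C / pi * (1 / L)) * (pi * x * L ^ 4 / 64)"
      using L x by (simp add: field_simps power_eq_if)
    finally have "\<bar>E x\<bar> \<le> 8 * C / pi * (1 / L)"
      using L x by (subst (asm) mult_le_cancel_right_pos) auto
    then show ?case using L by (simp add: L_def[symmetric])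
  qed
  then have "E \<in> O[at_top](\<lambda>x. 1 / ln x)" by (rule bigoI)
  moreover have "\<forall>\<^sub>F x in at_top. (\<Sum>n\<in>{n::nat. 1 \<le> n \<and> real n \<le> x}. real (r2 n)) = pi * (x / (ln x)\<^sup>2) * (1 + E x)"
    using eventually_gt_at_top[of 1]
  proof eventually_elim
    case (elim x)
    then have "0 < ln x" "0 < x" by auto
    then show ?case using sum_r2_eq_card[of x] by (simp add: E_def N_def)
  qed
  ultimately show ?thesis by blast
qed

end
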